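(* For every integer $d\ge3$, $$\sup_{z\in\mathbb{C}\setminus[0,\infty)}\big\||x|^{-1}(-\Delta-z)^{-1}|x|^{-1}\big\|_{L^2(\mathbb{R}^d)\to L^2(\mathbb{R}^d)}\le\begin{cases}4, & d=3,\\[2pt] \dfrac{2}{\sqrt{(d-1)(d-3)}}, & d\ge4.\end{cases}$$
   Context: $-\Delta$ is the self-adjoint Laplacian in $L^2(\mathbb{R}^d)$ with domain $H^2(\mathbb{R}^d)$, and $|x|^{-1}$ denotes the operator of multiplication by $1/|x|$. For $z\in\mathbb{C}\setminus[0,\infty)$ and $d\ge3$ the operator $|x|^{-1}(-\Delta-z)^{-1}|x|^{-1}$, defined e.g. on $C_0^\infty(\mathbb{R}^d\setminus\{0\})$, extends to a bounded operator on $L^2(\mathbb{R}^d)$, whose operator norm is meant. *)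

theory Defs
  imports "HOL-Analysis.Analysis"
begin

fun iterated_partial :: "'a::euclidean_space list \<Rightarrow> ('a \<Rightarrow> complex) \<Rightarrow> 'a \<Rightarrow> complex" where
  "iterated_partial [] f = f"
| "iterated_partial (b # bs) f = (\<lambda>x. frechet_derivative (iterated_partial bs f) (at x) b)"

definition smooth :: "('a::euclidean_space \<Rightarrow> complex) \<Rightarrow> bool" where
  "smooth f \<longleftrightarrow> (\<forall>bs. set bs \<subseteq> Basis \<longrightarrow> (\<forall>x. iterated_partial bs f differentiable at x))"

definition test_functions :: "'a::euclidean_space set \<Rightarrow> ('a \<Rightarrow> complex) set" where
  "test_functions U = {\<phi>. smooth \<phi> \<and> compact (closure {x. \<phi> x \<noteq> 0}) \<and> closure {x. \<phi> x \<noteq> 0} \<subseteq> U}"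

text \<open>
  Elements of \<open>L\<^sup>2\<close> are handled through Borel representatives; functions that agree almost
  everywhere are not identified.
\<close>

definition L2 :: "('a::euclidean_space \<Rightarrow> complex) set" where
  "L2 = {f \<in> borel_measurable lborel. integrable lborel (\<lambda>x. (norm (f x))\<^sup>2)}"

definition L2_norm :: "('a::euclidean_space \<Rightarrow> complex) \<Rightarrow> ennreal" where
  "L2_norm f = (if f \<in> L2 then ennreal (sqrt (LINT x|lborel. (norm (f x))\<^sup>2)) else \<infinity>)"

definition weak_deriv ::
    "'a::euclidean_space list \<Rightarrow> ('a \<Rightarrow> complex) \<Rightarrow> ('a \<Rightarrow> complex) \<Rightarrow> bool" where
  "weak_deriv bs u w \<longleftrightarrow> (\<forall>\<phi>\<in>test_functions UNIV.
     (LINT x|lborel. u x * iterated_partial bs \<phi> x) =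
       (- 1) ^ length bs * (LINT x|lborel. w x * \<phi> x))"

definition sobolev :: "nat \<Rightarrow> ('a::euclidean_space \<Rightarrow> complex) set" where
  "sobolev k = {u \<in> L2. \<forall>bs. set bs \<subseteq> Basis \<and> length bs \<le> k \<longrightarrow> (\<exists>w\<in>L2. weak_deriv bs u w)}"

text \<open>
  The Laplacian with domain \<open>H\<^sup>2\<close>, given by its graph. The second weak derivatives
  \<open>D b\<close> are determined by \<open>u\<close> up to null sets.
\<close>

definition laplacian_graph :: "(('a::euclidean_space \<Rightarrow> complex) \<times> ('a \<Rightarrow> complex)) set" where
  "laplacian_graph = {(u, \<lambda>x. \<Sum>b\<in>Basis. D b x) | u D.
     u \<in> sobolev 2 \<and> (\<forall>b\<in>Basis. D b \<in> L2 \<and> weak_deriv [b, b] u (D b))}"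

text \<open>
  \<open>(-\<Delta> - z)\<^sup>-\<^sup>1 g\<close>: a representative of the almost everywhere unique solution
  \<open>u \<in> H\<^sup>2\<close> of \<open>-\<Delta>u - z u = g\<close>.
\<close>

definition laplace_resolvent :: "complex \<Rightarrow> ('a::euclidean_space \<Rightarrow> complex) \<Rightarrow> 'a \<Rightarrow> complex" where
  "laplace_resolvent z g =
     (SOME u. \<exists>v. (u, v) \<in> laplacian_graph \<and> (AE x in lborel. - v x - z * u x = g x))"

definition mult_inv_norm :: "('a::euclidean_space \<Rightarrow> complex) \<Rightarrow> 'a \<Rightarrow> complex" where
  "mult_inv_norm f = (\<lambda>x. complex_of_real (1 / norm x) * f x)"

text \<open>
  Norm of an operator given on a dense subspace \<open>D\<close> of \<open>L\<^sup>2\<close>. The value is \<open>\<infinity>\<close> if the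
  operator is unbounded or leaves \<open>L\<^sup>2\<close>; otherwise it is the norm of the unique bounded
  extension to \<open>L\<^sup>2\<close>.
\<close>

definition L2_opnorm ::
    "('a::euclidean_space \<Rightarrow> complex) set \<Rightarrow> (('a \<Rightarrow> complex) \<Rightarrow> 'a \<Rightarrow> complex) \<Rightarrow> ennreal" where
  "L2_opnorm D T = (SUP f\<in>{f \<in> D. L2_norm f \<le> 1}. L2_norm (T f))"

end

theory Submission
  imports Defs
begin

text \<open>
  Write \<open>z = k\<^sup>2\<close> with \<open>Im k > 0\<close>, let \<open>r = |x|\<close>, \<open>m = (d - 1) / 2\<close>, and let \<open>u\<close> solve
  \<open>- \<Delta>u - k\<^sup>2 u = g\<close>. Testing the equation with \<open>r q\<close>, where
  \<open>q = \<partial>\<^sub>r u - \<i> k u + (m / r) u\<close>, gives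
  \<open>\<integral> |q|\<^sup>2 / 2 + (m\<^sup>2 - m) / 2 |u|\<^sup>2 / r\<^sup>2 \<le> Re \<integral> g r cnj q\<close>: all other terms have a sign or
  integrate to zero. If \<open>d \<ge> 4\<close>, the right-hand side is at most \<open>\<integral> r\<^sup>2 |g|\<^sup>2 / 2 + |q|\<^sup>2 / 2\<close>, and
  \<open>m\<^sup>2 - m = (d - 1) (d - 3) / 4\<close>. If \<open>d = 3\<close>, one gets \<open>\<parallel>q\<parallel> \<le> 2 \<parallel>r g\<parallel>\<close>, and testing \<open>q\<close> with \<open>u / r\<close>
  gives the Hardy inequality \<open>\<parallel>u / r\<parallel> \<le> 2 \<parallel>q\<parallel>\<close>.

  For test functions \<open>g\<close> the solution \<open>u\<close> is a rapidly decreasing smooth function, namely an integral of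
  complex-time heat kernels. It is the only solution in \<open>H\<^sup>2\<close>, because the adjoint problem can be
  solved for every test function.
\<close>

section \<open>Integrability and integration by parts\<close>

text \<open>Why this multiplier: with 2 m = d - 1, the substitution v = r^m u removes the
  first-order term of the radial Laplacian, and q = r^(-m) (d/dr - i k) (r^m u) vanishes on the
  outgoing wave r^(-m) exp (i k r). Since k enters the surviving terms only through signs, the bound
  is uniform up to the spectrum. The coefficient m^2 - m belongs to the inverse-square potential
  that the substitution creates. It vanishes for d = 3, where control of u has to be recovered from
  q: this is the reason for the case split, and 4 is the product of two factors 2. For d >= 4 the
  constant is 1 / sqrt (m^2 - m).

  The weights are singular at the origin. This is harmless because r^(-2) is locally integrable for
  d >= 3 and almost every line parallel to an axis misses the origin, so integration by parts may
  ignore that point.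

  The heat kernel representation asks only for Gaussian decay and differentiation under the integral
  sign. The value of the complex Gaussian integral is never computed; that it is nonzero
  suffices.\<close>

lemma integrable_decay:
  fixes f :: "'a::euclidean_space \<Rightarrow> 'b::{banach, second_countable_topology}"
  assumes [measurable]: "f \<in> borel_measurable lborel"
    and bd: "\<And>x. norm (f x) \<le> C / (1 + norm x) ^ (DIM('a) + 2)"
  shows "integrable lborel f"
proof -
  have C: "0 \<le> C"
    using bd[of 0] norm_ge_zero[of "f 0"] by (simp del: norm_ge_zero)
  define V where "V = measure lborel (ball (0::'a) 1)"
  \<comment> \<open>One majorant for each shell n <= norm x < n + 1: the bound on the shell times
    the volume of the ball of radius n + 1 leaves a multiple of 1 / (1 + n)^2. The exponent d + 2 is
    what makes this series converge.\<close>
  define g where "g n x = ennreal (C / (1 + real n) ^ (DIM('a) + 2)) * indicator (ball (0::'a) (real n + 1)) x"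
    for n x
  have vol: "emeasure lborel (ball (0::'a) r) = ennreal (V * r ^ DIM('a))" if "0 < r" for r
    using that by (simp add: V_def emeasure_ball content_ball ennreal_mult')
  have "ennreal (norm (f x)) \<le> (\<Sum>n. g n x)" for x
  proof -
    define n where "n = nat \<lfloor>norm x\<rfloor>"
    have n: "real n \<le> norm x" "norm x < real n + 1"
      by (simp_all add: n_def)
    note bd[of x]
    also have "C / (1 + norm x) ^ (DIM('a) + 2) \<le> C / (1 + real n) ^ (DIM('a) + 2)"
      using n(1) C by (intro divide_left_mono power_mono mult_pos_pos; auto intro!: add_pos_nonneg zero_less_power)
    finally have "ennreal (norm (f x)) \<le> g n x"
      using n(2) by (auto simp: g_def intro!: ennreal_leI)
    also have "\<dots> \<le> (\<Sum>n. g n x)"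
      by (intro sum_le_suminf[of "\<lambda>n. g n x" "{n}", simplified]; auto)
    finally show ?thesis .
  qed
  then have "(\<integral>\<^sup>+x. norm (f x) \<partial>lborel) \<le> (\<integral>\<^sup>+x. (\<Sum>n. g n x) \<partial>lborel)"
    by (intro nn_integral_mono)
  also have "\<dots> = (\<Sum>n. \<integral>\<^sup>+x. g n x \<partial>lborel)"
    unfolding g_def
    by (intro nn_integral_suminf borel_measurable_times_ennreal borel_measurable_const borel_measurable_indicator) simp
  also have "\<dots> = (\<Sum>n. ennreal (C * V * (1 / (1 + real n) ^ 2)))"
  proof (intro suminf_cong)
    fix n
    have "(\<integral>\<^sup>+x. g n x \<partial>lborel) = ennreal (C / (1 + real n) ^ (DIM('a) + 2)) * ennreal (V * (real n + 1) ^ DIM('a))"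
      by (simp add: g_def nn_integral_cmult_indicator vol)
    also have "\<dots> = ennreal (C / (1 + real n) ^ (DIM('a) + 2) * (V * (real n + 1) ^ DIM('a)))"
      using C by (intro ennreal_mult'[symmetric]) auto
    also have "C / (1 + real n) ^ (DIM('a) + 2) * (V * (real n + 1) ^ DIM('a)) = C * V * (1 / (1 + real n) ^ 2)"
    proof -
      have "1 + real n \<noteq> 0" by linarith
      then have "(1 + real n) ^ DIM('a) \<noteq> 0" "(1 + real n)\<^sup>2 \<noteq> 0" by auto
      then show ?thesis
        by (simp only: power_add add.commute[of "real n" 1]) (simp add: divide_simps)
    qed
    finally show "(\<integral>\<^sup>+x. g n x \<partial>lborel) = ennreal (C * V * (1 / (1 + real n) ^ 2))" .
  qed
  also have "\<dots> < \<infinity>"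
  proof -
    have "summable (\<lambda>n. C * V * (1 / (1 + real n) ^ 2))"
      using inverse_power_summable[of 2, where 'a=real, THEN summable_Suc_iff[THEN iffD2]]
      by (intro summable_mult) (simp add: inverse_eq_divide)
    then show ?thesis
      using C by (subst suminf_ennreal2) (auto simp: V_def)
  qed
  finally show ?thesis by (simp add: integrable_iff_bounded)
qed

text \<open>Dyadic shells: where (1/2)^(n+1) <= norm x < (1/2)^n the integrand is at most 4^(n+1),
  and since d >= 3 the ball of radius (1/2)^n has volume at most a multiple of (1/8)^n. The products
  are dominated by a geometric series of ratio 1/2.\<close>

lemma integrable_inverse_norm_square_ball:
  assumes "DIM('a::euclidean_space) \<ge> 3"
  shows "integrable lborel (\<lambda>x::'a. indicat_real (ball 0 1) x / (norm x)\<^sup>2)"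
proof -
  define V where "V = measure lborel (ball (0::'a) 1)"
  define g where "g n x = ennreal (4 ^ (n + 1)) * indicator (ball (0::'a) ((1/2) ^ n)) x" for n x
  have vol: "emeasure lborel (ball (0::'a) r) = ennreal (V * r ^ DIM('a))" if "0 < r" for r
    using that by (simp add: V_def emeasure_ball content_ball ennreal_mult')
  have "ennreal (norm (indicat_real (ball 0 1) x / (norm x)\<^sup>2)) \<le> (\<Sum>n. g n x)" for x :: 'a
  proof (cases "x \<in> ball 0 1 - {0}")
    case False
    then show ?thesis by (auto simp: indicator_def)
  next
    case True
    then have x: "0 < norm x" "norm x < 1" by auto
    obtain m where "(1/2::real) ^ m < norm x"
      using real_arch_pow_inv[of "norm x" "1/2"] x by auto
    then have ex: "(1/2::real) ^ m \<le> norm x" by simp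
    \<comment> \<open>The least exponent is positive because norm x < 1, so its predecessor supplies
      the upper bound of the shell.\<close>
    define N where "N = (LEAST m. (1/2::real) ^ m \<le> norm x)"
    have N: "(1/2::real) ^ N \<le> norm x" unfolding N_def by (rule LeastI[where P="\<lambda>m. (1/2) ^ m \<le> norm x", OF ex])
    have "N \<noteq> 0" using N x by (intro notI) simp
    then obtain n where n: "N = Suc n" by (cases N) auto
    have "\<not> (1/2::real) ^ n \<le> norm x" using n not_less_Least[of n "\<lambda>m. (1/2::real) ^ m \<le> norm x"]
      by (auto simp: N_def)
    then have n2: "norm x < (1/2) ^ n" by simp
    have "((1/2::real) ^ (n + 1))\<^sup>2 \<le> (norm x)\<^sup>2"
      using N n by (intro power_mono) auto
    moreover have "((1/2::real) ^ (n + 1))\<^sup>2 = 1 / 4 ^ (n + 1)"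
      by (simp only: power_divide power_mult[symmetric] mult.commute[of "n+1" 2]) (simp add: power_mult)
    ultimately have "1 / 4 ^ (n + 1) \<le> (norm x)\<^sup>2" by argo
    then have "1 / (norm x)\<^sup>2 \<le> 4 ^ (n + 1)"
      using x by (simp add: field_simps)
    then have "ennreal (norm (indicat_real (ball 0 1) x / (norm x)\<^sup>2)) \<le> g n x"
      using n2 x by (auto simp: g_def intro!: ennreal_leI)
    also have "\<dots> \<le> (\<Sum>n. g n x)"
      by (intro sum_le_suminf[of "\<lambda>n. g n x" "{n}", simplified]; auto)
    finally show ?thesis .
  qed
  then have "(\<integral>\<^sup>+x. norm (indicat_real (ball 0 1) x / (norm x)\<^sup>2) \<partial>(lborel::'a measure)) \<le> (\<integral>\<^sup>+x. (\<Sum>n. g n x) \<partial>lborel)"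
    by (intro nn_integral_mono)
  also have "\<dots> = (\<Sum>n. \<integral>\<^sup>+x. g n x \<partial>lborel)"
    unfolding g_def
    by (intro nn_integral_suminf borel_measurable_times_ennreal borel_measurable_const borel_measurable_indicator) simp
  also have "\<dots> \<le> (\<Sum>n. ennreal (4 * V * (1/2) ^ n))"
  proof (intro suminf_le allI)
    fix n
    have "(\<integral>\<^sup>+x. g n x \<partial>lborel) = ennreal (4 ^ (n + 1)) * ennreal (V * ((1/2) ^ n) ^ DIM('a))"
      by (simp add: g_def nn_integral_cmult_indicator vol)
    also have "\<dots> = ennreal (4 ^ (n + 1) * (V * ((1/2) ^ n) ^ DIM('a)))"
      by (intro ennreal_mult'[symmetric]) auto
    also have "\<dots> \<le> ennreal (4 * V * (1/2) ^ n)"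
    proof (rule ennreal_leI)
      have "((1/2::real) ^ n) ^ DIM('a) \<le> ((1/2) ^ n) ^ 3"
        using assms by (intro power_decreasing) (auto simp: power_le_one)
      also have "\<dots> = (1/2) ^ n * (1/4) ^ n"
        by (simp add: power3_eq_cube power_mult_distrib[symmetric])
      finally have "4 ^ (n + 1) * (V * ((1/2) ^ n) ^ DIM('a)) \<le> 4 ^ (n + 1) * (V * ((1/2) ^ n * (1/4) ^ n))"
        by (intro mult_left_mono) (auto simp: V_def)
      also have "\<dots> = 4 * V * (1/2) ^ n" by (simp add: power_divide)
      finally show "4 ^ (n + 1) * (V * ((1/2) ^ n) ^ DIM('a)) \<le> 4 * V * (1/2) ^ n" .
    qed
    finally show "(\<integral>\<^sup>+x. g n x \<partial>lborel) \<le> ennreal (4 * V * (1/2) ^ n)" .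
  qed auto
  also have "\<dots> < \<infinity>"
    by (subst suminf_ennreal2) (auto simp: V_def intro!: summable_mult)
  finally show ?thesis
    by (simp add: integrable_iff_bounded borel_measurable_divide borel_measurable_indicator)
qed

text \<open>Inside the unit ball the factor 1 / norm^2 is integrable by itself, and outside it is at
  most 1. The bound leaves the value at 0 free, where division by the norm has only a default
  value.\<close>

lemma integrable_singular_decay:
  fixes f :: "'a::euclidean_space \<Rightarrow> 'b::{banach, second_countable_topology}"
  assumes [measurable]: "f \<in> borel_measurable lborel" and d: "DIM('a) \<ge> 3"
    and bd: "\<And>x. x \<noteq> 0 \<Longrightarrow> norm (f x) \<le> C * (1 + 1 / (norm x)\<^sup>2) / (1 + norm x) ^ (DIM('a) + 2)"
  shows "integrable lborel f"
proof -
  obtain e :: 'a where e: "norm e = 1" using norm_Basis SOME_Basis by blast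
  then have "e \<noteq> 0" by auto
  from order_trans[OF norm_ge_zero bd[OF this]] e have "0 \<le> C * 2 / 2 ^ (DIM('a) + 2)"
    by simp
  then have C: "0 \<le> C" using zero_less_power[of "2::real" "DIM('a)"] by (simp add: zero_le_divide_iff zero_le_mult_iff not_le del: zero_less_power zero_less_power_eq)
  have 1: "integrable lborel (\<lambda>x::'a. 2 * C / (1 + norm x) ^ (DIM('a) + 2))"
    by (rule integrable_decay[where C="2*C"]) (use C in auto)
  have 2: "integrable lborel (\<lambda>x::'a. 2 * C / (1 + norm x) ^ (DIM('a) + 2) + C * (indicat_real (ball 0 1) x / (norm x)\<^sup>2))"
    using integrable_inverse_norm_square_ball[OF d] 1 by (intro Bochner_Integration.integrable_add integrable_mult_right)
  show ?thesis
  proof (rule Bochner_Integration.integrable_bound[OF 2])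
    have "AE x in lborel. x \<noteq> (0::'a)" by (rule AE_lborel_singleton)
    then show "AE x in lborel. norm (f x) \<le> norm (2 * C / (1 + norm x) ^ (DIM('a) + 2) + C * (indicat_real (ball 0 1) x / (norm x)\<^sup>2))"
    proof eventually_elim
      case (elim x)
      define P where "P = (1 + norm x) ^ (DIM('a) + 2)"
      have P: "1 \<le> P" unfolding P_def by (rule one_le_power) auto
      have "C * (1 + 1 / (norm x)\<^sup>2) / P \<le> 2 * C / P + C * (indicat_real (ball 0 1) x / (norm x)\<^sup>2)"
      proof (cases "norm x < 1")
        case True
        have "C * (1 + 1 / (norm x)\<^sup>2) / P = C / P + C / (norm x)\<^sup>2 / P"
          by (simp add: add_divide_distrib distrib_left)
        also have "C / (norm x)\<^sup>2 / P \<le> C / (norm x)\<^sup>2 / 1" using P C by (intro divide_left_mono) auto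
        also have "C / P \<le> 2 * C / P" using P C by (intro divide_right_mono) auto
        finally show ?thesis using True by simp
      next
        case False
        then have "1 \<le> (norm x)\<^sup>2" by (intro one_le_power) auto
        then have "1 / (norm x)\<^sup>2 \<le> 1" by (simp add: divide_le_eq)
        then have "C * (1 + 1 / (norm x)\<^sup>2) \<le> C * 2" using C by (intro mult_left_mono) auto
        then show ?thesis using False P by (simp add: divide_right_mono mult.commute)
      qed
      then show ?case using bd[OF elim] unfolding P_def by (auto intro: order_trans abs_ge_self)
    qed
  qed simp
qed

text \<open>The integral of \<open>h (x + b) - h x\<close> vanishes by translation invariance; by
  the fundamental theorem of calculus along the segment and Fubini it is also the integral of
  \<open>h'\<close>. The origin is exempted because the integrands below are singular there, and in
  dimension at least 2 almost no line in direction \<open>b\<close> meets it.\<close>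

lemma integral_line_derivative_eq_0:
  fixes h h' :: "'a::euclidean_space \<Rightarrow> complex"
  assumes d: "DIM('a) \<ge> 2" and b: "b \<in> Basis"
    and h: "integrable lborel h" and h': "integrable lborel h'"
    and D: "\<And>x. x \<noteq> 0 \<Longrightarrow> ((\<lambda>t. h (x + t *\<^sub>R b)) has_vector_derivative h' x) (at 0)"
  shows "(LINT x|lborel. h' x) = 0"
proof -
  have "\<exists>c\<in>Basis. c \<noteq> b"
  proof (rule ccontr)
    assume "\<not> ?thesis"
    then have "(Basis::'a set) \<subseteq> {b}" by auto
    then have "DIM('a) \<le> card {b}" by (intro card_mono) auto
    then show False using d by simp
  qed
  then obtain c where c: "c \<in> Basis" "c \<noteq> b" by auto
  have h_m[measurable]: "h \<in> borel_measurable borel" using borel_measurable_integrable[OF h] by simp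
  have h'_m[measurable]: "h' \<in> borel_measurable borel" using borel_measurable_integrable[OF h'] by simp
  have trans: "integrable lborel (\<lambda>x. f (x + v))" "(LINT x|lborel. f (x + v)) = (LINT x|lborel. f x)"
    if f: "integrable lborel f" for f :: "'a \<Rightarrow> 'c::{banach, second_countable_topology}" and v
  proof -
    have [measurable]: "f \<in> borel_measurable borel" using borel_measurable_integrable[OF f] by simp
    have "integrable (distr lborel borel ((+) v)) f" using f by (simp add: lborel_distr_plus)
    then show "integrable lborel (\<lambda>x. f (x + v))"
      by (subst (asm) integrable_distr_eq) (auto simp: add.commute)
    have "(LINT x|lborel. f x) = (LINT x|distr lborel borel ((+) v). f x)" by (simp add: lborel_distr_plus)
    also have "\<dots> = (LINT x|lborel. f (x + v))" by (subst integral_distr) (auto simp: add.commute)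
    finally show "(LINT x|lborel. f (x + v)) = (LINT x|lborel. f x)" by simp
  qed
  \<comment> \<open>For every s in the unit interval the slice of \<open>k\<close> has the same L1
    norm as \<open>h'\<close>, so \<open>k\<close> is jointly integrable and the order of
    integration may be exchanged.\<close>
  define k where "k = (\<lambda>(s::real, x::'a). indicat_real {0..1} s *\<^sub>R h' (x + s *\<^sub>R b))"
  have k_m[measurable]: "k \<in> borel_measurable (lborel \<Otimes>\<^sub>M lborel)"
    unfolding k_def by measurable
  have k: "integrable (lborel \<Otimes>\<^sub>M lborel) k"
  proof (rule lborel_pair.Fubini_integrable)
    have "(\<lambda>s. LINT x|lborel. norm (k (s, x))) = (\<lambda>s. indicat_real {0..1} s * (LINT x|lborel. norm (h' x)))"
      using trans(2)[OF integrable_norm[OF h']] by (auto simp: k_def)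
    then show "integrable lborel (\<lambda>s. LINT x|lborel. norm (k (s, x)))" by simp
    show "AE s in lborel. integrable lborel (\<lambda>x. k (s, x))"
      using trans(1)[OF h'] by (auto simp: k_def)
  qed simp
  \<comment> \<open>Off this null hyperplane the line through x in direction b keeps a nonzero
    c-coordinate, hence avoids 0.\<close>
  have "negligible {x::'a. x \<bullet> c = 0}" by (rule negligible_standard_hyperplane[OF c(1)])
  then have "{x::'a. x \<bullet> c = 0} \<in> null_sets lborel"
    by (auto simp: negligible_iff_null_sets null_sets_def)
  then have 1: "AE x in lborel. x \<bullet> c \<noteq> 0" by (auto dest!: AE_not_in)
  have 2: "AE x in lborel. integrable lborel (\<lambda>s. k (s, x))"
    using lborel_pair.AE_integrable_snd[of "\<lambda>s x. k (s, x)"] k by simp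
  have 3: "AE x in lborel. (LINT s|lborel. k (s, x)) = h (x + b) - h x"
    using 1 2
  proof eventually_elim
    case (elim x)
    have nz: "x + s *\<^sub>R b \<noteq> 0" for s
    proof
      assume "x + s *\<^sub>R b = 0"
      then have "(x + s *\<^sub>R b) \<bullet> c = 0" by simp
      then show False using elim(1) c b by (simp add: inner_add_left inner_not_same_Basis)
    qed
    have D': "((\<lambda>s. h (x + s *\<^sub>R b)) has_vector_derivative h' (x + s *\<^sub>R b)) (at s)" for s
    proof -
      have "((\<lambda>s'. h ((x + s *\<^sub>R b) + s' *\<^sub>R b)) has_vector_derivative h' (x + s *\<^sub>R b)) (at (0 + (s - s)))"
        using D[OF nz[of s]] by simp
      then have "((\<lambda>s'. h ((x + s *\<^sub>R b) + s' *\<^sub>R b)) has_vector_derivative h' (x + s *\<^sub>R b)) (at (s - s))" by simp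
      moreover have "((\<lambda>s'. s' - s) has_vector_derivative 1) (at s)"
        by (auto intro!: derivative_eq_intros)
      ultimately have "((\<lambda>s'. h ((x + s *\<^sub>R b) + s' *\<^sub>R b)) \<circ> (\<lambda>s'. s' - s) has_vector_derivative 1 *\<^sub>R h' (x + s *\<^sub>R b)) (at s)"
        by (intro vector_diff_chain_at) auto
      then show ?thesis by (simp add: o_def algebra_simps)
    qed
    have ftc: "((\<lambda>s. h' (x + s *\<^sub>R b)) has_integral (h (x + 1 *\<^sub>R b) - h (x + 0 *\<^sub>R b))) {0..1}"
      by (rule fundamental_theorem_of_calculus) (use D' in \<open>auto intro: has_vector_derivative_at_within\<close>)
    have "set_integrable lborel {0..1} (\<lambda>s. h' (x + s *\<^sub>R b))"
      using elim(2) by (simp add: k_def set_integrable_def)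
    from set_borel_integral_eq_integral(2)[OF this] ftc
    show ?case by (simp add: k_def set_lebesgue_integral_def integral_unique)
  qed
  have "0 = (LINT x|lborel. h (x + b) - h x)"
    using trans[OF h, of b] h by simp
  also have "\<dots> = (LINT x|lborel. (LINT s|lborel. k (s, x)))"
    using 3 by (intro integral_cong_AE) auto
  also have "\<dots> = (LINT s|lborel. (LINT x|lborel. k (s, x)))"
    using lborel_pair.Fubini_integral[of "\<lambda>s x. k (s, x)"] k by simp
  also have "(\<lambda>s. LINT x|lborel. k (s, x)) = (\<lambda>s. indicat_real {0..1::real} s *\<^sub>R (LINT x|lborel. h' x))"
    using trans(2)[OF h'] by (auto simp: k_def)
  also have "(LINT s|lborel. indicat_real {0..1::real} s *\<^sub>R (LINT x|lborel. h' x)) = (LINT x|lborel. h' x)"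
  proof -
    have "set_lebesgue_integral lborel {0..1::real} (\<lambda>_. LINT x|lborel. h' x) = 1 *\<^sub>R (LINT x|lborel. h' x)"
      by (subst set_integral_const) auto
    then show ?thesis unfolding set_lebesgue_integral_def scaleR_one .
  qed
  finally show ?thesis by simp
qed

section \<open>Smooth functions and bumps\<close>

definition pd :: "'a::euclidean_space \<Rightarrow> ('a \<Rightarrow> complex) \<Rightarrow> 'a \<Rightarrow> complex" where
  "pd b f = (\<lambda>x. frechet_derivative f (at x) b)"

lemma iterated_partial_Cons_pd: "iterated_partial (b # bs) f = pd b (iterated_partial bs f)"
  by (simp add: pd_def)

lemma iterated_partial_append: "iterated_partial (bs @ cs) f = iterated_partial bs (iterated_partial cs f)"
  by (induction bs) auto

lemma iterated_partial_snoc_pd: "iterated_partial (bs @ [b]) f = iterated_partial bs (pd b f)"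
  by (simp add: iterated_partial_append pd_def)

lemma pd_eqI: "(f has_derivative D) (at x) \<Longrightarrow> pd b f x = D b"
  unfolding pd_def by (drule frechet_derivative_at) simp

lemma has_derivative_pd:
  assumes "f differentiable (at x)"
  shows "(f has_derivative (\<lambda>v. \<Sum>b\<in>Basis. (v \<bullet> b) *\<^sub>R pd b f x)) (at x)"
proof -
  have *: "(f has_derivative frechet_derivative f (at x)) (at x)"
    using assms frechet_derivative_works by blast
  have "frechet_derivative f (at x) v = (\<Sum>b\<in>Basis. (v \<bullet> b) *\<^sub>R pd b f x)" for v
    unfolding pd_def
    by (subst euclidean_representation[of v, symmetric],
        subst linear_sum[OF linear_frechet_derivative[OF assms]])
       (simp add: linear_cmul[OF linear_frechet_derivative[OF assms]])
  then show ?thesis using * by (metis (no_types, lifting) ext)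
qed

lemma has_vector_derivative_line:
  assumes "f differentiable (at (x + t *\<^sub>R v))"
  shows "((\<lambda>s. f (x + s *\<^sub>R v)) has_vector_derivative (\<Sum>b\<in>Basis. (v \<bullet> b) *\<^sub>R pd b f (x + t *\<^sub>R v))) (at t)"
proof -
  have "((\<lambda>s. x + s *\<^sub>R v) has_derivative (\<lambda>s. s *\<^sub>R v)) (at t)"
    by (auto intro!: derivative_eq_intros)
  from has_derivative_compose[OF this has_derivative_pd[OF assms]]
  show ?thesis
    by (simp add: has_vector_derivative_def scaleR_sum_right mult.commute)
qed

lemma sum_Basis_inner_scaleR:
    fixes b :: "'a::euclidean_space" and f :: "'a \<Rightarrow> 'c::real_vector"
  assumes b: "b \<in> Basis"
  shows "(\<Sum>c\<in>Basis. (b \<bullet> c) *\<^sub>R f c) = f b"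
proof -
  have "(\<Sum>c\<in>Basis. (b \<bullet> c) *\<^sub>R f c) = (\<Sum>c\<in>Basis. if c = b then f b else 0)"
    using b by (intro sum.cong) (auto simp: inner_Basis)
  then show ?thesis using b by simp
qed

lemma has_vector_derivative_line_Basis:
  assumes "f differentiable (at (x + t *\<^sub>R b))" "b \<in> Basis"
  shows "((\<lambda>s. f (x + s *\<^sub>R b)) has_vector_derivative pd b f (x + t *\<^sub>R b)) (at t)"
  using has_vector_derivative_line[OF assms(1)]
  unfolding sum_Basis_inner_scaleR[OF assms(2), of "\<lambda>c. pd c f (x + t *\<^sub>R b)"] .

lemma pd_add:
  assumes "f differentiable (at x)" "g differentiable (at x)"
  shows "pd b (\<lambda>x. f x + g x) x = pd b f x + pd b g x"
  using assms unfolding frechet_derivative_works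
  by (auto intro!: pd_eqI has_derivative_add simp: pd_def[of b f] pd_def[of b g])

lemma pd_mult:
  assumes "f differentiable (at x)" "g differentiable (at x)"
  shows "pd b (\<lambda>x. f x * g x) x = f x * pd b g x + pd b f x * g x"
  using assms unfolding frechet_derivative_works
  by (auto intro!: pd_eqI has_derivative_mult[THEN has_derivative_eq_rhs] simp: pd_def[of b f] pd_def[of b g])

lemma pd_cmult:
  assumes "f differentiable (at x)"
  shows "pd b (\<lambda>x. c * f x) x = c * pd b f x"
  using assms unfolding frechet_derivative_works
  by (auto intro!: pd_eqI has_derivative_mult_right simp: pd_def[of b f])

lemma smooth_differentiable: "smooth f \<Longrightarrow> f differentiable (at x)"
  unfolding smooth_def by (metis empty_subsetI iterated_partial.simps(1) list.set(1))

lemma smooth_pd: "smooth f \<Longrightarrow> b \<in> Basis \<Longrightarrow> smooth (pd b f)"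
  unfolding smooth_def iterated_partial_snoc_pd[symmetric] by auto

section \<open>Smoothness from classes closed under differentiation\<close>

lemma iterated_partial_coinduct:
  assumes "f \<in> F" and "\<And>f b. f \<in> F \<Longrightarrow> b \<in> Basis \<Longrightarrow> pd b f \<in> F" and "set bs \<subseteq> Basis"
  shows "iterated_partial bs f \<in> F"
  using assms(3) by (induction bs) (use assms in \<open>auto simp: iterated_partial_Cons_pd simp del: iterated_partial.simps(2)\<close>)

text \<open>Smoothness is proved throughout by exhibiting a class of differentiable functions that
  partial derivatives do not leave. No formula for higher derivatives is ever written down.\<close>

lemma smooth_coinduct:
  assumes "f \<in> F" and "\<And>f x. f \<in> F \<Longrightarrow> f differentiable (at x)"
    and "\<And>f b. f \<in> F \<Longrightarrow> b \<in> Basis \<Longrightarrow> pd b f \<in> F"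
  shows "smooth f"
  unfolding smooth_def using iterated_partial_coinduct[of f F] assms by blast

text \<open>Product and chain rule turn one generator into a sum of generators, so the natural
  classes are closed under differentiation only up to linear combinations. Adding one scaled
  generator at a time gives inductions that peel off a single term.\<close>

inductive_set linear_hull :: "('a \<Rightarrow> complex) set \<Rightarrow> ('a \<Rightarrow> complex) set" for G where
  zero: "(\<lambda>_. 0) \<in> linear_hull G"
| add_scaled: "g \<in> G \<Longrightarrow> f \<in> linear_hull G \<Longrightarrow> (\<lambda>x. c * g x + f x) \<in> linear_hull G"

lemma linear_hull_base: "g \<in> G \<Longrightarrow> g \<in> linear_hull G"
  using linear_hull.add_scaled[OF _ linear_hull.zero, of g G 1] by simp

lemma linear_hull_add: "f \<in> linear_hull G \<Longrightarrow> g \<in> linear_hull G \<Longrightarrow> (\<lambda>x. f x + g x) \<in> linear_hull G"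
  by (induction rule: linear_hull.induct) (auto simp: add.assoc intro: linear_hull.add_scaled)

lemma linear_hull_cmult: "f \<in> linear_hull G \<Longrightarrow> (\<lambda>x. c * f x) \<in> linear_hull G"
  by (induction rule: linear_hull.induct)
     (auto simp: distrib_left mult.assoc[symmetric] intro: linear_hull.zero linear_hull.add_scaled)

text \<open>By linearity of \<open>pd\<close>, differentiability and closure need to be examined on
  the generators only.\<close>

lemma smooth_linear_hull:
  assumes f: "f \<in> linear_hull G" and diff: "\<And>f x. f \<in> G \<Longrightarrow> f differentiable (at x)"
    and pd: "\<And>f b. f \<in> G \<Longrightarrow> b \<in> Basis \<Longrightarrow> pd b f \<in> linear_hull G"
  shows "smooth f"
proof (rule smooth_coinduct[OF f])
  show *: "f differentiable (at x)" if "f \<in> linear_hull G" for f x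
    using that
  proof induction
    case (add_scaled g f c)
    then show ?case using diff[of g] by (intro differentiable_add differentiable_mult) auto
  qed simp
  show "pd b f \<in> linear_hull G" if "f \<in> linear_hull G" "b \<in> Basis" for f b
    using that(1)
  proof induction
    case zero
    have "pd b (\<lambda>_. 0) = (\<lambda>_. 0)" by (auto simp: pd_def)
    then show ?case using linear_hull.zero by metis
  next
    case (add_scaled g f c)
    have "pd b (\<lambda>x. c * g x + f x) = (\<lambda>x. c * pd b g x + pd b f x)"
      using add_scaled * diff by (auto simp: pd_add pd_cmult differentiable_mult)
    then show ?case using add_scaled pd that by (auto intro!: linear_hull_add linear_hull_cmult)
  qed
qed

lemma smooth_mult: assumes "smooth f" "smooth g" shows "smooth (\<lambda>x. f x * g x)"
proof (rule smooth_linear_hull[of _ "{\<lambda>x. f x * g x |f g. smooth f \<and> smooth g}"])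
  let ?G = "{\<lambda>x. f x * g x |f g. smooth f \<and> smooth g} :: ('a \<Rightarrow> complex) set"
  show "(\<lambda>x. f x * g x) \<in> linear_hull ?G" using assms by (auto intro!: linear_hull_base)
  show "f differentiable (at x)" if "f \<in> ?G" for f x
    using that smooth_differentiable differentiable_mult by fast
  show "pd b f \<in> linear_hull ?G" if f: "f \<in> ?G" and b: "b \<in> Basis" for f b
  proof -
    obtain f' g' where *: "f = (\<lambda>x. f' x * g' x)" "smooth f'" "smooth g'" using f by blast
    then have "pd b f = (\<lambda>x. f' x * pd b g' x + pd b f' x * g' x)"
      by (auto simp: pd_mult smooth_differentiable)
    also have "\<dots> \<in> linear_hull ?G"
    proof (intro linear_hull_add linear_hull_base)
      show "(\<lambda>x. f' x * pd b g' x) \<in> ?G" using *(2) smooth_pd[OF *(3) b] by blast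
      show "(\<lambda>x. pd b f' x * g' x) \<in> ?G" using *(3) smooth_pd[OF *(2) b] by blast
    qed
    finally show ?thesis .
  qed
qed

lemma smooth_if_linear_hull: assumes "f \<in> linear_hull (Collect smooth)" shows "smooth f"
proof (rule smooth_linear_hull[OF assms])
  show "f differentiable (at x)" if "f \<in> Collect smooth" for f x
    using that smooth_differentiable by simp
  show "pd b f \<in> linear_hull (Collect smooth)" if "f \<in> Collect smooth" "b \<in> Basis" for f b
    by (rule linear_hull_base) (use that smooth_pd in simp)
qed

lemma smooth_cmult: "smooth f \<Longrightarrow> smooth (\<lambda>x. c * f x)"
  by (rule smooth_if_linear_hull, rule linear_hull_cmult, rule linear_hull_base, simp)

lemma smooth_const: "smooth (\<lambda>_. c)"
  by (rule smooth_coinduct[of _ "range (\<lambda>c _. c)"]) (auto simp: pd_def)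

lemma smooth_inner: "smooth (\<lambda>x. complex_of_real (x \<bullet> v))"
proof (rule smooth_coinduct[of _ "insert (\<lambda>x. complex_of_real (x \<bullet> v)) (range (\<lambda>c _. c))"])
  have D: "((\<lambda>x. complex_of_real (x \<bullet> v)) has_derivative (\<lambda>h. complex_of_real (h \<bullet> v))) (at x)" for x
    by (auto intro!: derivative_eq_intros)
  show "f differentiable (at x)" if "f \<in> insert (\<lambda>x. complex_of_real (x \<bullet> v)) (range (\<lambda>c _. c))" for f x
    using that D[THEN differentiableI] by auto
  show "pd b f \<in> insert (\<lambda>x. complex_of_real (x \<bullet> v)) (range (\<lambda>c _. c))"
    if "f \<in> insert (\<lambda>x. complex_of_real (x \<bullet> v)) (range (\<lambda>c _. c))" for f b
  proof -
    have "pd b (\<lambda>x. complex_of_real (x \<bullet> v)) = (\<lambda>_. complex_of_real (b \<bullet> v))"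
      using pd_eqI[OF D] by auto
    then show ?thesis using that by (auto simp: pd_def)
  qed
qed auto

lemma smooth_prod: "finite I \<Longrightarrow> (\<And>i. i \<in> I \<Longrightarrow> smooth (f i)) \<Longrightarrow> smooth (\<lambda>x. \<Prod>i\<in>I. f i x)"
  by (induction rule: finite_induct) (auto intro!: smooth_const smooth_mult)

lemma pd_scale:
  assumes "f differentiable (at (r *\<^sub>R x))"
  shows "pd b (\<lambda>x. f (r *\<^sub>R x)) x = of_real r * pd b f (r *\<^sub>R x)"
proof -
  have "((\<lambda>x. r *\<^sub>R x) has_derivative (\<lambda>h. r *\<^sub>R h)) (at x)" by (auto intro!: derivative_eq_intros)
  from has_derivative_compose[OF this assms[unfolded frechet_derivative_works]]
  have "pd b (\<lambda>x. f (r *\<^sub>R x)) x = frechet_derivative f (at (r *\<^sub>R x)) (r *\<^sub>R b)" by (rule pd_eqI)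
  then show ?thesis
    using linear_cmul[OF linear_frechet_derivative[OF assms]] by (simp add: pd_def scaleR_conv_of_real)
qed

lemma smooth_scale:
  assumes "smooth f" shows "smooth (\<lambda>x. f (r *\<^sub>R x))"
\<comment> \<open>The constant \<open>c\<close> collects the factor \<open>r\<close> that each
  differentiation of the inner function produces.\<close>
proof (rule smooth_coinduct[of _ "{\<lambda>x. c * f (r *\<^sub>R x) |c f. smooth f}"])
  show "(\<lambda>x. f (r *\<^sub>R x)) \<in> {\<lambda>x. c * f (r *\<^sub>R x) |c f. smooth f}"
    using assms by (intro CollectI exI[of _ 1] exI[of _ f]) auto
  have D: "(\<lambda>x. g (r *\<^sub>R x)) differentiable (at x)" if "smooth g" for g x
  proof -
    have "((\<lambda>x. r *\<^sub>R x) has_derivative (\<lambda>h. r *\<^sub>R h)) (at x)" by (auto intro!: derivative_eq_intros)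
    from has_derivative_compose[OF this smooth_differentiable[OF that, unfolded frechet_derivative_works]]
    show ?thesis unfolding differentiable_def by blast
  qed
  show "g differentiable (at x)" if "g \<in> {\<lambda>x. c * f (r *\<^sub>R x) |c f. smooth f}" for g x
    using that D by (auto intro!: differentiable_mult)
  show "pd b g \<in> {\<lambda>x. c * f (r *\<^sub>R x) |c f. smooth f}"
    if g: "g \<in> {\<lambda>x. c * f (r *\<^sub>R x) |c f. smooth f}" and b: "b \<in> Basis" for g b
  proof -
    obtain c h where h: "g = (\<lambda>x. c * h (r *\<^sub>R x))" "smooth h" using g by auto
    have "pd b g = (\<lambda>x. (c * of_real r) * pd b h (r *\<^sub>R x))"
      unfolding h(1) using D[OF h(2)] smooth_differentiable[OF h(2)]
      by (intro ext) (subst pd_cmult, auto simp: pd_scale)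
    then show ?thesis using smooth_pd[OF h(2) b] by blast
  qed
qed

text \<open>The function exp (-1/t), extended by 0, is put into a family so that differentiation
  stays inside: the derivative of member k is a combination of members k + 1 and k + 2.\<close>

definition bump :: "nat \<Rightarrow> real \<Rightarrow> real" where
  "bump k t = (if t \<le> 0 then 0 else exp (- 1 / t) / t ^ k)"

text \<open>From (1 + x / n)^n <= exp x with x = 1 / t and n = k + 2 one gets exp (-1/t) <= (n t)^n,
  and division by t^k leaves t^2. The second power forces value and slope to tend to 0 at the gluing
  point.\<close>

lemma bump_le:
  assumes "0 < t" shows "bump k t \<le> (real k + 2) ^ (k + 2) * t\<^sup>2"
proof -
  define n where "n = k + 2"
  have n: "0 < real n" by (simp add: n_def)
  have "(1 / (real n * t)) ^ n \<le> (1 + (1 / t) / real n) ^ n"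
    using assms n by (intro power_mono) (auto simp: field_simps)
  also have "\<dots> \<le> exp (1 / t)"
    using assms n order_trans[of "- real n" 0 "1/t"] by (intro exp_ge_one_plus_x_over_n_power_n) auto
  finally have "1 / (real n * t) ^ n \<le> exp (1 / t)" by (simp add: power_divide)
  then have "exp (- 1 / t) \<le> (real n * t) ^ n"
    using assms n by (simp add: exp_minus field_simps)
  then have "exp (- 1 / t) / t ^ k \<le> (real n * t) ^ n / t ^ k"
    using assms by (intro divide_right_mono) auto
  also have "\<dots> = real n ^ n * t\<^sup>2"
    using assms by (simp add: power_mult_distrib n_def power_add power2_eq_square)
  finally show ?thesis using assms by (simp add: bump_def n_def add.commute)
qed

lemma bump_nonneg: "0 \<le> bump k t"
  by (simp add: bump_def)

lemma DERIV_bump: "(bump k has_field_derivative bump (k + 2) t - real k * bump (k + 1) t) (at t)"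
proof -
  consider "t < 0" | "t > 0" | "t = 0" by linarith
  then show ?thesis
  proof cases
    case 1
    have "(bump k has_field_derivative 0) (at t)"
      by (rule has_field_derivative_transform_within_open[OF DERIV_const, of "{..<0}"]) (use 1 in \<open>auto simp: bump_def\<close>)
    then show ?thesis using 1 by (simp add: bump_def)
  next
    case 2
    have "((\<lambda>t. exp (- 1 / t) / t ^ k) has_field_derivative bump (k + 2) t - real k * bump (k + 1) t) (at t)"
    proof (cases k)
      case 0
      show ?thesis using 2 unfolding 0
        by (auto intro!: derivative_eq_intros simp: bump_def power2_eq_square)
    next
      case (Suc j)
      show ?thesis using 2 unfolding Suc
        by (auto intro!: derivative_eq_intros simp: bump_def divide_simps)
           (cases j, simp_all add: algebra_simps power_add power2_eq_square)
    qed
    then show ?thesis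
      by (rule has_field_derivative_transform_within_open[of _ _ _ "{0<..}"]) (use 2 in \<open>auto simp: bump_def\<close>)
  next
    \<comment> \<open>At the gluing point the difference quotient is \<open>bump k h / h\<close>,
      which the quadratic bound makes at most a multiple of |h|.\<close>
    case 3
    define C where "C = (real k + 2) ^ (k + 2)"
    have C: "0 \<le> C" by (simp add: C_def)
    have "((\<lambda>h. bump k h / h) \<longlongrightarrow> 0) (at 0)"
    proof (rule Lim_null_comparison)
      show "\<forall>\<^sub>F h in at 0. norm (bump k h / h) \<le> C * \<bar>h\<bar>"
      proof (rule always_eventually, rule allI)
        fix h :: real
        show "norm (bump k h / h) \<le> C * \<bar>h\<bar>"
        proof (cases "h \<le> 0")
          case True
          then show ?thesis using mult_nonneg_nonneg[OF C, of "\<bar>h\<bar>"] by (simp add: bump_def)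
        next
          case False
          then have h: "h > 0" by simp
          have "bump k h / h \<le> C * h\<^sup>2 / h"
            using bump_le[OF h, of k] h unfolding C_def by (intro divide_right_mono) auto
          also have "\<dots> = C * \<bar>h\<bar>" using h by (simp add: power2_eq_square)
          finally show ?thesis using h bump_nonneg[of k h] by simp
        qed
      qed
      show "((\<lambda>h. C * \<bar>h\<bar>) \<longlongrightarrow> 0) (at 0)" by (auto intro!: tendsto_eq_intros)
    qed
    then have "(bump k has_field_derivative 0) (at 0)"
      by (simp add: has_field_derivative_iff bump_def)
    then show ?thesis using 3 by (simp add: bump_def)
  qed
qed

lemma smooth_bump_affine: "smooth (\<lambda>x::'a::euclidean_space. complex_of_real (bump k (\<alpha> + x \<bullet> v)))"
proof (rule smooth_linear_hull[of _ "range (\<lambda>k (x::'a). complex_of_real (bump k (\<alpha> + x \<bullet> v)))"])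
  let ?f = "\<lambda>k (x::'a). complex_of_real (bump k (\<alpha> + x \<bullet> v))"
  have D: "(?f k has_derivative (\<lambda>h. complex_of_real ((bump (k + 2) (\<alpha> + x \<bullet> v) - real k * bump (k + 1) (\<alpha> + x \<bullet> v)) * (h \<bullet> v)))) (at x)" for k x
  proof -
    have "((\<lambda>x. \<alpha> + x \<bullet> v) has_derivative (\<lambda>h. h \<bullet> v)) (at x)"
      by (auto intro!: derivative_eq_intros)
    from has_derivative_compose[OF this, of "bump k" "(*) (bump (k + 2) (\<alpha> + x \<bullet> v) - real k * bump (k + 1) (\<alpha> + x \<bullet> v))"]
    have "((\<lambda>x. bump k (\<alpha> + x \<bullet> v)) has_derivative (\<lambda>h. (bump (k + 2) (\<alpha> + x \<bullet> v) - real k * bump (k + 1) (\<alpha> + x \<bullet> v)) * (h \<bullet> v))) (at x)"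
      using DERIV_bump[of k "\<alpha> + x \<bullet> v"] by (simp add: has_field_derivative_def)
    then show ?thesis by (rule has_derivative_of_real)
  qed
  show "?f k \<in> linear_hull (range ?f)"
    by (rule linear_hull_base, rule image_eqI[of _ _ k], rule refl, rule UNIV_I)
  show "f differentiable (at x)" if "f \<in> range ?f" for f x
    using that D[THEN differentiableI] by auto
  show "pd b f \<in> linear_hull (range ?f)" if f: "f \<in> range ?f" for f b
  proof -
    obtain k where k: "f = ?f k" using f by auto
    have "pd b f = (\<lambda>x. complex_of_real (b \<bullet> v) * ?f (k + 2) x + complex_of_real (- real k * (b \<bullet> v)) * ?f (k + 1) x)"
      using pd_eqI[OF D] k by (auto simp: algebra_simps)
    also have "\<dots> \<in> linear_hull (range ?f)"
      by (intro linear_hull_add linear_hull_cmult linear_hull_base rangeI)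
    finally show ?thesis .
  qed
qed

section \<open>Rapidly decreasing functions and the fundamental lemma\<close>

definition rapid :: "('a::euclidean_space \<Rightarrow> complex) \<Rightarrow> bool" where
  "rapid f \<longleftrightarrow> (\<forall>N. \<exists>C. \<forall>x. norm (f x) * (1 + norm x) ^ N \<le> C)"

definition schwartz :: "('a::euclidean_space \<Rightarrow> complex) \<Rightarrow> bool" where
  "schwartz f \<longleftrightarrow> smooth f \<and> (\<forall>bs. set bs \<subseteq> Basis \<longrightarrow> rapid (iterated_partial bs f))"

lemma schwartz_smooth: "schwartz f \<Longrightarrow> smooth f"
  by (simp add: schwartz_def)

lemma schwartz_differentiable: "schwartz f \<Longrightarrow> f differentiable (at x)"
  using schwartz_smooth smooth_differentiable by blast

lemma schwartz_pd: "schwartz f \<Longrightarrow> b \<in> Basis \<Longrightarrow> schwartz (pd b f)"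
  unfolding schwartz_def using smooth_pd[of f b]
  by (auto simp flip: iterated_partial_snoc_pd)

lemma schwartz_rapid: "schwartz f \<Longrightarrow> rapid f"
  unfolding schwartz_def by (metis empty_subsetI iterated_partial.simps(1) list.set(1))

lemma schwartz_coinduct:
  assumes "f \<in> F" "\<And>f x. f \<in> F \<Longrightarrow> f differentiable (at x)" "\<And>f. f \<in> F \<Longrightarrow> rapid f"
    "\<And>f b. f \<in> F \<Longrightarrow> b \<in> Basis \<Longrightarrow> pd b f \<in> F"
  shows "schwartz f"
  unfolding schwartz_def
proof (intro conjI allI impI)
  show "smooth f" by (rule smooth_coinduct[of f F]) (use assms in auto)
  show "rapid (iterated_partial bs f)" if "set bs \<subseteq> Basis" for bs
    using iterated_partial_coinduct[of f F bs] assms that by blast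
qed

lemma continuous_on_smooth: "smooth f \<Longrightarrow> continuous_on S f"
  by (meson continuous_at_imp_continuous_on differentiable_imp_continuous_within smooth_differentiable)

lemma borel_measurable_smooth: "smooth f \<Longrightarrow> f \<in> borel_measurable borel"
  by (intro borel_measurable_continuous_onI continuous_on_smooth)

lemma borel_measurable_schwartz: "schwartz f \<Longrightarrow> f \<in> borel_measurable borel"
  by (intro borel_measurable_smooth schwartz_smooth)

lemma rapid_bound:
  assumes "rapid f"
  obtains C where "0 \<le> C" "\<And>x. norm (f x) \<le> C / (1 + norm x) ^ N"
proof -
  obtain C where C: "\<And>x. norm (f x) * (1 + norm x) ^ N \<le> C" using assms unfolding rapid_def by blast
  have "0 \<le> norm (f 0) * (1 + norm (0::'a)) ^ N" by simp
  also have "\<dots> \<le> C" by (rule C)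
  finally have "0 \<le> C" .
  moreover have "norm (f x) \<le> C / (1 + norm x) ^ N" for x
  proof -
    have "(1 + norm x) ^ N > 0" by (intro zero_less_power add_pos_nonneg) auto
    then show ?thesis using C[of x] by (simp add: le_divide_eq)
  qed
  ultimately show ?thesis by (rule that)
qed

lemma rapid_bounded:
  assumes "rapid f"
  obtains C where "0 \<le> C" "\<And>x. norm (f x) \<le> C"
  using rapid_bound[OF assms, of 0] by auto

section \<open>Uniform Taylor estimates for Schwartz functions\<close>

lemma schwartz_lipschitz:
  assumes "schwartz f"
  obtains C where "0 \<le> C" "\<And>x y. norm (f x - f y) \<le> C * norm (x - y)"
proof -
  have "\<forall>b\<in>Basis. \<exists>C\<ge>0. \<forall>x. norm (pd b f x) \<le> C"
  proof
    fix b :: 'a assume "b \<in> Basis"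
    from rapid_bounded[OF schwartz_rapid[OF schwartz_pd[OF assms this]]]
    show "\<exists>C\<ge>0. \<forall>x. norm (pd b f x) \<le> C" by metis
  qed
  then obtain C where C: "\<And>b. b \<in> Basis \<Longrightarrow> 0 \<le> C b" "\<And>b x. b \<in> Basis \<Longrightarrow> norm (pd b f x) \<le> C b"
    by metis
  show ?thesis
  proof (rule that)
    show "0 \<le> (\<Sum>b\<in>Basis. C b)" using C by (intro sum_nonneg) auto
    show "norm (f x - f y) \<le> (\<Sum>b\<in>Basis. C b) * norm (x - y)" for x y
    proof (rule differentiable_bound[of UNIV f "\<lambda>x v. \<Sum>b\<in>Basis. (v \<bullet> b) *\<^sub>R pd b f x"])
      show "(f has_derivative (\<lambda>v. \<Sum>b\<in>Basis. (v \<bullet> b) *\<^sub>R pd b f x)) (at x)" for x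
        using assms by (intro has_derivative_pd schwartz_differentiable)
      show "onorm (\<lambda>v. \<Sum>b\<in>Basis. (v \<bullet> b) *\<^sub>R pd b f x) \<le> (\<Sum>b\<in>Basis. C b)" for x
      proof (rule onorm_le)
        fix v
        have "norm (\<Sum>b\<in>Basis. (v \<bullet> b) *\<^sub>R pd b f x) \<le> (\<Sum>b\<in>Basis. norm v * C b)"
          using C Basis_le_norm by (intro sum_norm_le) (auto intro!: mult_mono)
        then show "norm (\<Sum>b\<in>Basis. (v \<bullet> b) *\<^sub>R pd b f x) \<le> (\<Sum>b\<in>Basis. C b) * norm v"
          by (simp add: sum_distrib_left mult.commute)
      qed
    qed auto
  qed
qed

text \<open>The Lipschitz bounds of the first partials are global, so the constant does not depend
  on the base point. This uniformity is what later allows differentiation under integrals by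
  integrating the remainder.\<close>

lemma schwartz_taylor:
  assumes "schwartz f"
  obtains C where "0 \<le> C"
    "\<And>x v. norm (f (x + v) - f x - (\<Sum>b\<in>Basis. (v \<bullet> b) *\<^sub>R pd b f x)) \<le> C * (norm v)\<^sup>2"
proof -
  have "\<forall>b\<in>Basis. \<exists>C\<ge>0. \<forall>x y. norm (pd b f x - pd b f y) \<le> C * norm (x - y)"
    using schwartz_lipschitz[OF schwartz_pd[OF assms]] by metis
  then obtain C where C: "\<And>b. b \<in> Basis \<Longrightarrow> 0 \<le> C b"
    "\<And>b x y. b \<in> Basis \<Longrightarrow> norm (pd b f x - pd b f y) \<le> C b * norm (x - y)"
    by metis
  show ?thesis
  proof (rule that)
    show "0 \<le> (\<Sum>b\<in>Basis. C b)" using C by (intro sum_nonneg) auto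
    fix x v :: 'a
    let ?D = "\<lambda>x v. \<Sum>b\<in>Basis. (v \<bullet> b) *\<^sub>R pd b f x"
    have "norm (f (x + v) - f x - ?D x (x + v - x)) \<le> norm (x + v - x) * ((\<Sum>b\<in>Basis. C b) * norm v)"
    proof (rule differentiable_bound_linearization[where a=x and b="x + v" and S="cball x (norm v)" and f=f and f'="?D" and ?x0.0=x])
      show "(f has_derivative ?D y) (at y within cball x (norm v))" for y
        by (rule has_derivative_at_withinI[OF has_derivative_pd[OF schwartz_differentiable[OF assms]]])
      show "x + t *\<^sub>R (x + v - x) \<in> cball x (norm v)" if "t \<in> {0..1}" for t
        using that mult_left_le_one_le[of "norm v" t] by (auto simp: dist_norm)
      show "onorm (?D y - ?D x) \<le> (\<Sum>b\<in>Basis. C b) * norm v" if y: "y \<in> cball x (norm v)" for y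
      proof (rule onorm_le)
        fix w
        have "(?D y - ?D x) w = (\<Sum>b\<in>Basis. (w \<bullet> b) *\<^sub>R (pd b f y - pd b f x))"
          by (simp add: sum_subtractf scaleR_diff_right)
        also have "norm \<dots> \<le> (\<Sum>b\<in>Basis. norm w * (C b * norm v))"
        proof (rule sum_norm_le)
          fix b :: 'a assume b: "b \<in> Basis"
          have "norm (pd b f y - pd b f x) \<le> C b * norm (y - x)" using C(2)[OF b] .
          also have "\<dots> \<le> C b * norm v"
            using y C(1)[OF b] by (intro mult_left_mono) (auto simp: dist_norm norm_minus_commute)
          finally show "norm ((w \<bullet> b) *\<^sub>R (pd b f y - pd b f x)) \<le> norm w * (C b * norm v)"
            using Basis_le_norm[OF b, of w] by (auto intro!: mult_mono)
        qed
        also have "\<dots> = (\<Sum>b\<in>Basis. C b) * norm v * norm w"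
          by (simp add: sum_distrib_right sum_distrib_left mult_ac)
        finally show "norm ((?D y - ?D x) w) \<le> (\<Sum>b\<in>Basis. C b) * norm v * norm w" .
      qed
    qed auto
    then show "norm (f (x + v) - f x - ?D x v) \<le> (\<Sum>b\<in>Basis. C b) * (norm v)\<^sup>2"
      by (simp add: power2_eq_square mult_ac)
  qed
qed

text \<open>Both mixed partials are the limit of the same second difference quotient.\<close>

lemma schwartz_pd_commute:
  fixes f :: "'a::euclidean_space \<Rightarrow> complex"
  assumes f: "schwartz f" and b: "b \<in> Basis" and c: "c \<in> Basis"
  shows "pd b (pd c f) = pd c (pd b f)"
proof
  fix x
  define \<Delta> where "\<Delta> s = f (x + s *\<^sub>R b + s *\<^sub>R c) - f (x + s *\<^sub>R b) - f (x + s *\<^sub>R c) + f x" for s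
  have half: "\<exists>K. \<forall>s>0. norm ((f (x + s *\<^sub>R b + s *\<^sub>R c) - f (x + s *\<^sub>R b) - f (x + s *\<^sub>R c) + f x) - s\<^sup>2 *\<^sub>R pd c (pd b f) x) \<le> K * s ^ 3"
    if b: "b \<in> Basis" and c: "c \<in> Basis" for b c
  proof -
    obtain A where A: "0 \<le> A" "\<And>x v. norm (pd b f (x + v) - pd b f x - (\<Sum>e\<in>Basis. (v \<bullet> e) *\<^sub>R pd e (pd b f) x)) \<le> A * (norm v)\<^sup>2"
      using schwartz_taylor[OF schwartz_pd[OF f b]] by metis
    obtain B where B: "0 \<le> B" "\<And>x y. norm (pd c (pd b f) x - pd c (pd b f) y) \<le> B * norm (x - y)"
      using schwartz_lipschitz[OF schwartz_pd[OF schwartz_pd[OF f b] c]] by metis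
    have "norm ((f (x + s *\<^sub>R b + s *\<^sub>R c) - f (x + s *\<^sub>R b) - f (x + s *\<^sub>R c) + f x) - s\<^sup>2 *\<^sub>R pd c (pd b f) x) \<le> (A + B) * s ^ 3"
      if s: "s > 0" for s
    proof -
      \<comment> \<open>\<open>q s - q 0\<close> is the second difference minus s^2 times the mixed
        partial at x. The mean value inequality bounds it through \<open>q'\<close>, to which the
        Taylor remainder in direction c and the Lipschitz bound each contribute order s^2.\<close>
      define q where "q t = f (x + s *\<^sub>R c + t *\<^sub>R b) - f (x + t *\<^sub>R b) - (t * s) *\<^sub>R pd c (pd b f) x" for t
      define q' where "q' t = pd b f (x + s *\<^sub>R c + t *\<^sub>R b) - pd b f (x + t *\<^sub>R b) - s *\<^sub>R pd c (pd b f) x" for t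
      have D: "(q has_vector_derivative q' t) (at t within {0..s})" for t
        unfolding q_def q'_def
        by (intro has_vector_derivative_diff has_vector_derivative_at_within[OF has_vector_derivative_line_Basis] schwartz_differentiable[OF f] b)
           (auto intro!: derivative_eq_intros)
      have q'_le: "norm (q' t) \<le> (A + B) * s\<^sup>2" if t: "t \<in> {0..s}" for t
      proof -
        have "norm (pd b f (x + t *\<^sub>R b + s *\<^sub>R c) - pd b f (x + t *\<^sub>R b) - s *\<^sub>R pd c (pd b f) (x + t *\<^sub>R b)) \<le> A * s\<^sup>2"
          using A(2)[of "x + t *\<^sub>R b" "s *\<^sub>R c"] c s
            sum_Basis_inner_scaleR[OF c, of "\<lambda>e. pd e (pd b f) (x + t *\<^sub>R b)"]
          by (simp add: scaleR_sum_right[symmetric] flip: scaleR_scaleR)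
        moreover have "norm (s *\<^sub>R (pd c (pd b f) (x + t *\<^sub>R b) - pd c (pd b f) x)) \<le> s * (B * s)"
        proof -
          have "norm (pd c (pd b f) (x + t *\<^sub>R b) - pd c (pd b f) x) \<le> B * \<bar>t\<bar>"
            using B(2)[of "x + t *\<^sub>R b" x] b by simp
          also have "\<dots> \<le> B * s" using t B(1) by (intro mult_left_mono) auto
          finally show ?thesis using s by simp
        qed
        ultimately have "norm ((pd b f (x + t *\<^sub>R b + s *\<^sub>R c) - pd b f (x + t *\<^sub>R b) - s *\<^sub>R pd c (pd b f) (x + t *\<^sub>R b)) + s *\<^sub>R (pd c (pd b f) (x + t *\<^sub>R b) - pd c (pd b f) x)) \<le> A * s\<^sup>2 + s * (B * s)"
          by (rule norm_triangle_mono)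
        then show ?thesis
          by (simp add: q'_def algebra_simps power2_eq_square)
      qed
      have "norm (q s - q 0) \<le> (A + B) * s\<^sup>2 * norm (s - 0)"
      proof (rule differentiable_bound[of "{0..s}" q "\<lambda>t h. h *\<^sub>R q' t"])
        show "(q has_derivative (\<lambda>h. h *\<^sub>R q' t)) (at t within {0..s})" for t
          using D by (simp add: has_vector_derivative_def)
        show "onorm (\<lambda>h. h *\<^sub>R q' t) \<le> (A + B) * s\<^sup>2" if "t \<in> {0..s}" for t
          using q'_le[OF that] by (simp add: onorm_scaleR_left onorm_id)
      qed (use s in auto)
      then show ?thesis using s by (simp add: q_def algebra_simps power2_eq_square power3_eq_cube)
    qed
    then show ?thesis by blast
  qed
  obtain K where K: "\<And>s. s > 0 \<Longrightarrow> norm (\<Delta> s - s\<^sup>2 *\<^sub>R pd c (pd b f) x) \<le> K * s ^ 3"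
    using half[OF b c] unfolding \<Delta>_def by blast
  obtain L where "\<And>s. s > 0 \<Longrightarrow> norm ((f (x + s *\<^sub>R c + s *\<^sub>R b) - f (x + s *\<^sub>R c) - f (x + s *\<^sub>R b) + f x) - s\<^sup>2 *\<^sub>R pd b (pd c f) x) \<le> L * s ^ 3"
    using half[OF c b] by blast
  then have L: "norm (\<Delta> s - s\<^sup>2 *\<^sub>R pd b (pd c f) x) \<le> L * s ^ 3" if "s > 0" for s
    using that by (simp add: \<Delta>_def algebra_simps)
  define D where "D = norm (pd b (pd c f) x - pd c (pd b f) x)"
  \<comment> \<open>Both mixed partials approximate the second difference up to order s^3, so after
    division by s^2 their distance is of order s.\<close>
  have *: "D \<le> (K + L) * s" if s: "s > 0" for s
  proof -
    have "s\<^sup>2 * D = norm ((\<Delta> s - s\<^sup>2 *\<^sub>R pd c (pd b f) x) - (\<Delta> s - s\<^sup>2 *\<^sub>R pd b (pd c f) x))"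
      using s by (simp add: D_def scaleR_diff_right[symmetric])
    also have "\<dots> \<le> K * s ^ 3 + L * s ^ 3"
      using K[OF s] L[OF s] by (intro norm_triangle_le_diff) auto
    also have "\<dots> = s\<^sup>2 * ((K + L) * s)" by (simp add: algebra_simps power2_eq_square power3_eq_cube)
    finally show ?thesis using s by simp
  qed
  have "((\<lambda>s. (K + L) * s) \<longlongrightarrow> (K + L) * 0) (at_right 0)" by (intro tendsto_intros)
  then have "D \<le> (K + L) * 0"
    by (rule tendsto_lowerbound) (auto simp: eventually_at_right_field intro!: exI[of _ 1] *)
  then show "pd b (pd c f) x = pd c (pd b f) x" by (simp add: D_def)
qed

section \<open>Test functions and the fundamental lemma\<close>

lemma test_functionsD:
  assumes "\<phi> \<in> test_functions U"
  shows "smooth \<phi>" "compact (closure {x. \<phi> x \<noteq> 0})" "closure {x. \<phi> x \<noteq> 0} \<subseteq> U"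
  using assms by (auto simp: test_functions_def)

lemma test_functionsI:
  assumes "smooth \<psi>" "\<phi> \<in> test_functions U" "closure {x. \<psi> x \<noteq> 0} \<subseteq> closure {x. \<phi> x \<noteq> 0}"
  shows "\<psi> \<in> test_functions U"
proof -
  have "closure {x. \<phi> x \<noteq> 0} \<inter> closure {x. \<psi> x \<noteq> 0} = closure {x. \<psi> x \<noteq> 0}" using assms(3) by blast
  then have "compact (closure {x. \<psi> x \<noteq> 0})"
    using compact_Int_closed[OF test_functionsD(2)[OF assms(2)] closed_closure] by metis
  then show ?thesis using assms test_functionsD[OF assms(2)] by (auto simp: test_functions_def)
qed

lemma test_functions_mult_left:
  assumes "smooth f" "\<phi> \<in> test_functions U"
  shows "(\<lambda>x. f x * \<phi> x) \<in> test_functions U"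
  using assms test_functionsD(1)[OF assms(2)]
  by (intro test_functionsI[OF _ assms(2)] smooth_mult closure_mono) auto

lemma test_functions_pd:
  assumes "\<phi> \<in> test_functions U" "b \<in> Basis"
  shows "pd b \<phi> \<in> test_functions U"
proof (rule test_functionsI[OF _ assms(1)])
  show "smooth (pd b \<phi>)" using assms test_functionsD(1) smooth_pd by blast
  let ?S = "closure {x. \<phi> x \<noteq> 0}"
  show "closure {x. pd b \<phi> x \<noteq> 0} \<subseteq> ?S"
  proof (rule closure_minimal)
    show "{x. pd b \<phi> x \<noteq> 0} \<subseteq> ?S"
    proof (rule ccontr)
      assume "\<not> ?thesis"
      then obtain x where x: "pd b \<phi> x \<noteq> 0" "x \<in> - ?S" by auto
      \<comment> \<open>Off the closed support the function vanishes on a whole neighbourhood, so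
        its derivative is 0 there.\<close>
      have "((\<lambda>_. 0) has_derivative (\<lambda>_. 0)) (at x)" by simp
      then have "(\<phi> has_derivative (\<lambda>_. 0)) (at x)"
        by (rule has_derivative_transform_within_open[of _ _ _ _ "- ?S"])
           (use x closure_subset[of "{x. \<phi> x \<noteq> 0}"] in \<open>auto simp del: closure_subset\<close>)
      then show False using pd_eqI x(1) by metis
    qed
  qed simp
qed

lemma test_functions_rapid:
  assumes "\<phi> \<in> test_functions U" shows "rapid \<phi>"
  unfolding rapid_def
proof
  fix N
  let ?S = "closure {x. \<phi> x \<noteq> 0}"
  let ?f = "\<lambda>x. norm (\<phi> x) * (1 + norm x) ^ N"
  have "continuous_on ?S ?f"
    by (intro continuous_intros continuous_on_smooth test_functionsD(1)[OF assms])
  then have "bounded (?f ` ?S)"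
    using test_functionsD(2)[OF assms] compact_continuous_image compact_imp_bounded by blast
  then obtain C where C: "\<And>x. x \<in> ?S \<Longrightarrow> norm (?f x) \<le> C" by (auto simp: bounded_iff)
  have "?f x \<le> max 0 C" for x
  proof (cases "\<phi> x = 0")
    case False
    then have "x \<in> {x. \<phi> x \<noteq> 0}" by simp
    from C[OF subsetD[OF closure_subset this]] show ?thesis by simp
  qed simp
  then show "\<exists>C. \<forall>x. ?f x \<le> C" by blast
qed

lemma test_functions_schwartz:
  assumes "\<phi> \<in> test_functions U" shows "schwartz \<phi>"
  by (rule schwartz_coinduct[of _ "test_functions U"])
     (use assms test_functionsD(1) smooth_differentiable test_functions_rapid test_functions_pd in blast)+

lemma iterated_partial_test_functions:
  "\<phi> \<in> test_functions U \<Longrightarrow> set bs \<subseteq> Basis \<Longrightarrow> iterated_partial bs \<phi> \<in> test_functions U"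
  by (rule iterated_partial_coinduct) (auto intro: test_functions_pd)

text \<open>In each coordinate the two factors vanish at the opposite faces of the box. The scale r
  steepens the slopes: \<open>bump 0 (r * t)\<close> tends to 1 for every t > 0, so the product
  tends to the indicator of the open box as r grows.\<close>

definition box_bump :: "real \<Rightarrow> 'a \<Rightarrow> 'a \<Rightarrow> 'a::euclidean_space \<Rightarrow> complex" where
  "box_bump r a b x = (\<Prod>i\<in>Basis. complex_of_real (bump 0 (r * ((x - a) \<bullet> i))) * complex_of_real (bump 0 (r * ((b - x) \<bullet> i))))"

lemma box_bump_eq_0: "r > 0 \<Longrightarrow> x \<notin> box a b \<Longrightarrow> box_bump r a b x = 0"
  by (auto simp: box_bump_def mem_box inner_diff_left bump_def not_less intro!: prod_zero mult_nonneg_nonpos)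

lemma bump_0_le_1: "bump 0 t \<le> 1"
  by (simp add: bump_def)

lemma norm_box_bump_le: "norm (box_bump r a b x) \<le> 1"
  unfolding box_bump_def
  by (auto simp: prod_norm[symmetric] norm_mult bump_nonneg intro!: prod_le_1 mult_le_one bump_0_le_1)

lemma box_bump_test_function:
  assumes "r > 0" shows "box_bump r a b \<in> test_functions UNIV"
proof -
  have "smooth (\<lambda>x. \<Prod>i\<in>Basis. complex_of_real (bump 0 (- r * (a \<bullet> i) + x \<bullet> (r *\<^sub>R i))) * complex_of_real (bump 0 (r * (b \<bullet> i) + x \<bullet> (- r *\<^sub>R i))))"
    by (intro smooth_prod smooth_mult smooth_bump_affine) auto
  also have "(\<lambda>x. \<Prod>i\<in>Basis. complex_of_real (bump 0 (- r * (a \<bullet> i) + x \<bullet> (r *\<^sub>R i))) * complex_of_real (bump 0 (r * (b \<bullet> i) + x \<bullet> (- r *\<^sub>R i)))) = box_bump r a b"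
    by (simp add: box_bump_def fun_eq_iff algebra_simps)
  finally have "smooth (box_bump r a b)" .
  moreover have sub: "closure {x. box_bump r a b x \<noteq> 0} \<subseteq> cbox a b"
  proof (rule closure_minimal)
    show "{x. box_bump r a b x \<noteq> 0} \<subseteq> cbox a b"
      using box_bump_eq_0[OF assms] box_subset_cbox by fast
  qed (rule closed_cbox)
  moreover have "compact (closure {x. box_bump r a b x \<noteq> 0})"
    using bounded_subset[OF bounded_cbox sub] by (simp add: compact_eq_bounded_closed)
  ultimately show ?thesis by (simp add: test_functions_def)
qed

lemma box_bump_tendsto: "(\<lambda>n. box_bump (real (Suc n)) a b x) \<longlonglongrightarrow> indicator (box a b) x"
proof (cases "x \<in> box a b")
  case False
  then show ?thesis by (simp add: box_bump_eq_0)
next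
  case True
  have *: "(\<lambda>n. complex_of_real (bump 0 (real (Suc n) * t))) \<longlonglongrightarrow> 1" if t: "t > 0" for t
  proof -
    have "(\<lambda>n. exp (- (1 / real (Suc n)) / t)) \<longlonglongrightarrow> exp (- 0 / t)"
      using LIMSEQ_inverse_real_of_nat t unfolding inverse_eq_divide by (intro tendsto_intros) auto
    moreover have "bump 0 (real (Suc n) * t) = exp (- (1 / real (Suc n)) / t)" for n
    proof -
      have "\<not> real (Suc n) * t \<le> 0" using t by (simp add: not_le)
      then show ?thesis by (simp add: bump_def del: of_nat_Suc)
    qed
    ultimately have "(\<lambda>n. bump 0 (real (Suc n) * t)) \<longlonglongrightarrow> 1" by simp
    from tendsto_of_real[OF this, where 'a=complex] show ?thesis by simp
  qed
  have "(\<lambda>n. box_bump (real (Suc n)) a b x) \<longlonglongrightarrow> (\<Prod>i\<in>(Basis::'a set). 1 * 1)"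
    unfolding box_bump_def
  proof (rule tendsto_prod)
    fix i :: 'a assume "i \<in> Basis"
    then have "0 < (x - a) \<bullet> i" "0 < (b - x) \<bullet> i"
      using True by (auto simp: mem_box inner_diff_left)
    from tendsto_mult[OF *[OF this(1)] *[OF this(2)]]
    show "(\<lambda>n. complex_of_real (bump 0 (real (Suc n) * ((x - a) \<bullet> i))) * complex_of_real (bump 0 (real (Suc n) * ((b - x) \<bullet> i)))) \<longlonglongrightarrow> 1 * 1" .
  qed
  then show ?thesis using True by simp
qed

text \<open>Indicators of boxes are dominated limits of test functions, so the integral of w over
  every box is 0. Boxes are closed under intersection and generate the Borel sets; a Dynkin argument
  extends this to all Borel subsets of a fixed box. The fixed box is there because w, being only
  square integrable, need not be integrable on the whole space.\<close>

lemma AE_eq_0_if_test_functions: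
  fixes w :: "'a::euclidean_space \<Rightarrow> complex"
  assumes w: "w \<in> L2" and 0: "\<And>\<psi>. \<psi> \<in> test_functions UNIV \<Longrightarrow> (LINT x|lborel. w x * \<psi> x) = 0"
  shows "AE x in lborel. w x = 0"
proof -
  have w_m[measurable]: "w \<in> borel_measurable borel" and w2: "integrable lborel (\<lambda>x. (norm (w x))\<^sup>2)"
    using w by (auto simp: L2_def)
  have int: "integrable lborel (\<lambda>x. indicat_real (box a b) x *\<^sub>R w x)" for a b
  proof (rule Bochner_Integration.integrable_bound)
    show "integrable lborel (\<lambda>x. indicat_real (box a b) x + (norm (w x))\<^sup>2)"
      using w2 by (intro Bochner_Integration.integrable_add integrable_real_indicator) (auto simp: emeasure_lborel_box_eq)
    \<comment> \<open>Makes a square integrable function integrable on sets of finite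
      measure.\<close>
    have "t \<le> 1 + t\<^sup>2" if "0 \<le> t" for t :: real
      using sum_squares_bound[of t 1] that by (simp add: power2_eq_square)
    then show "AE x in lborel. norm (indicat_real (box a b) x *\<^sub>R w x) \<le> norm (indicat_real (box a b) x + (norm (w x))\<^sup>2)"
      by (intro AE_I2) (auto simp: indicator_def)
  qed simp
  have box0: "(LINT x|lborel. indicat_real (box a b) x *\<^sub>R w x) = 0" for a b
  proof -
    have "(\<lambda>n. LINT x|lborel. w x * box_bump (real (Suc n)) a b x) \<longlonglongrightarrow> (LINT x|lborel. indicat_real (box a b) x *\<^sub>R w x)"
    proof (rule integral_dominated_convergence)
      show "integrable lborel (\<lambda>x. norm (indicat_real (box a b) x *\<^sub>R w x))"
        using int by (rule integrable_norm)
      show "AE x in lborel. (\<lambda>n. w x * box_bump (real (Suc n)) a b x) \<longlonglongrightarrow> indicat_real (box a b) x *\<^sub>R w x"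
      proof (rule AE_I2)
        fix x
        have "(\<lambda>n. w x * box_bump (real (Suc n)) a b x) \<longlonglongrightarrow> w x * indicator (box a b) x"
          by (intro tendsto_intros box_bump_tendsto)
        then show "(\<lambda>n. w x * box_bump (real (Suc n)) a b x) \<longlonglongrightarrow> indicat_real (box a b) x *\<^sub>R w x"
          by (cases "x \<in> box a b") (simp_all del: of_nat_Suc)
      qed
      show "AE x in lborel. norm (w x * box_bump (real (Suc n)) a b x) \<le> norm (indicat_real (box a b) x *\<^sub>R w x)" for n
        using norm_box_bump_le[of "real (Suc n)" a b]
        by (intro AE_I2) (auto simp: indicator_def norm_mult box_bump_eq_0 mult_left_le simp del: of_nat_Suc)
      show "(\<lambda>x. w x * box_bump (real (Suc n)) a b x) \<in> borel_measurable lborel" for n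
        using borel_measurable_smooth[OF test_functionsD(1)[OF box_bump_test_function[of "real (Suc n)" a b]]] by simp
    qed simp
    then show ?thesis
      using 0[OF box_bump_test_function[of "real (Suc _)"]] by (simp add: LIMSEQ_const_iff del: of_nat_Suc)
  qed
  have AE_box: "AE x in lborel. indicat_real (box a b) x *\<^sub>R w x = 0" for a b
  proof (rule sigma_finite_measure.density_zero[OF sigma_finite_lborel int])
    let ?W = "\<lambda>x. indicat_real (box a b) x *\<^sub>R w x"
    fix A :: "'a set" assume A: "A \<in> sets lborel"
    have "Int_stable (range (\<lambda>(a, b). box a b :: 'a set))"
      by (auto simp: Int_stable_def box_Int_box)
    moreover have "(range (\<lambda>(a, b). box a b :: 'a set)) \<subseteq> Pow UNIV" by auto
    moreover have "A \<in> sigma_sets UNIV (range (\<lambda>(a, b). box a b))"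
      using A unfolding sets_lborel borel_eq_box by simp
    ultimately show "set_lebesgue_integral lborel A ?W = 0"
    proof (induction rule: sigma_sets_induct_disjoint)
      case (basic A)
      then obtain a' b' where "A = box a' b'" by auto
      then obtain u v where uv: "box a b \<inter> A = box u v"
        using box_Int_box by blast
      have "(\<lambda>x. indicat_real A x *\<^sub>R ?W x) = (\<lambda>x. indicat_real (box u v) x *\<^sub>R w x)"
        unfolding uv[symmetric] by (auto simp: indicator_def)
      then show ?case using box0 unfolding set_lebesgue_integral_def by metis
    next
      case empty
      show ?case by (simp add: set_lebesgue_integral_def)
    next
      case (compl A)
      then have A[measurable]: "A \<in> sets borel" by (simp add: borel_eq_box)
      have "indicat_real (UNIV - A) x *\<^sub>R ?W x = ?W x - indicat_real A x *\<^sub>R ?W x" for x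
        by (auto simp: indicator_def)
      moreover have "integrable lborel (\<lambda>x. indicat_real A x *\<^sub>R ?W x)"
        using A by (intro integrable_mult_indicator int) auto
      ultimately show ?case
        using compl(2) box0[of a b] int[of a b] by (simp add: set_lebesgue_integral_def del: scaleR_scaleR)
    next
      case (union A)
      then have A[measurable]: "\<And>i. A i \<in> sets borel" by (simp add: borel_eq_box subset_eq)
      have "set_lebesgue_integral lborel (\<Union>i. A i) ?W = (\<Sum>i. set_lebesgue_integral lborel (A i) ?W)"
      proof (rule lebesgue_integral_countable_add)
        show "set_integrable lborel (\<Union>i. A i) ?W"
          unfolding set_integrable_def by (intro integrable_mult_indicator int) auto
        show "A i \<inter> A j = {}" if "i \<noteq> j" for i j using union(1) that by (auto simp: disjoint_family_on_def)
      qed auto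
      then show ?case using union(3) by simp
    qed
  qed
  have "AE x in lborel. \<forall>n. indicat_real (box (- (real n *\<^sub>R One)) (real n *\<^sub>R One)) x *\<^sub>R w x = 0"
    unfolding AE_all_countable using AE_box by blast
  then show ?thesis
  proof eventually_elim
    case (elim x)
    obtain n where "x \<in> box (- (real n *\<^sub>R One)) (real n *\<^sub>R One)"
      using UN_box_eq_UNIV[where 'a='a] by blast
    then show ?case using elim[rule_format, of n] by simp
  qed
qed

section \<open>The multiplier identity\<close>

text \<open>Here p stands for x . grad u, l for the Laplacian and G for |grad u|^2. They enter as
  independent numbers, so the identity is pure algebra at one point. On the right, the first two
  lines are nonnegative once m >= 1, Im k > 0 and G dominates the radial part; each of the five
  remaining lines is a divergence or the real part of a multiple of one, and integrates to
  0.\<close>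

lemma pointwise_multiplier_identity:
  fixes u p l k q :: complex and r G m d :: real
  assumes r: "r > 0" and d: "d = 2 * m + 1"
    and q: "q = p / r - \<i> * k * u + m * u / r"
  shows "Re ((- l - k\<^sup>2 * u) * cnj (r * q)) =
    (1/2 + Im k * r) * (cmod q)\<^sup>2 + (m\<^sup>2 - m) / 2 * (cmod u)\<^sup>2 / r\<^sup>2 + (m\<^sup>2 - m) * Im k * (cmod u)\<^sup>2 / r
    + (1/2 + Im k * r) * (G - (cmod p)\<^sup>2 / r\<^sup>2)
    - (Re (l * cnj (p + m * u)) + G / 2)
    - Re (\<i> * cnj k * (r * (l * cnj u) + cnj u * p / r + r * G))
    - (cmod k)\<^sup>2 / 2 * (2 * Re (cnj u * p) + d * (cmod u)\<^sup>2)
    - m / 2 * (2 * Re (cnj u * p) + (d - 2) * (cmod u)\<^sup>2) / r\<^sup>2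
    - Im k * m * (2 * Re (cnj u * p) + (d - 1) * (cmod u)\<^sup>2) / r"
proof -
  \<comment> \<open>Treating 1 / r as a separate variable with r s = 1 turns the claim into a
    polynomial identity between real and imaginary parts, which \<open>algebra\<close> can
    settle.\<close>
  define s where "s = 1 / r"
  have rs: "r * s = 1" "r = 1 / s" using r by (auto simp: s_def)
  obtain ua ub where u: "u = Complex ua ub" by (cases u)
  obtain pa pb where p: "p = Complex pa pb" by (cases p)
  obtain la lb where l: "l = Complex la lb" by (cases l)
  obtain ka kb where k: "k = Complex ka kb" by (cases k)
  have q': "q = p * s - \<i> * k * u + m * u * s"
    by (simp add: q s_def divide_inverse)
  define A where "A = pa * s + kb * ua + ka * ub + m * ua * s"
  define B where "B = pb * s + kb * ub - ka * ua + m * ub * s"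
  have qq: "q = Complex A B"
    unfolding q' u p k A_def B_def by (simp add: complex_eq_iff algebra_simps)
  have rq: "r * A = pa + r * (kb * ua + ka * ub) + m * ua" "r * B = pb + r * (kb * ub - ka * ua) + m * ub"
    using rs(1) unfolding A_def B_def by algebra+
  have div: "x / r\<^sup>2 = x * s\<^sup>2" "x / r = x * s" for x by (simp_all add: s_def power_divide)
  have divc: "z / complex_of_real r = z * complex_of_real s" for z by (simp add: s_def)
  have lhs: "Re ((- l - k\<^sup>2 * u) * cnj (r * q)) = (- la - ((ka\<^sup>2 - kb\<^sup>2) * ua - 2 * ka * kb * ub)) * (r * A) + (- lb - ((ka\<^sup>2 - kb\<^sup>2) * ub + 2 * ka * kb * ua)) * (r * B)"
    unfolding qq l k u by (simp add: power2_eq_square algebra_simps)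
  show ?thesis
    unfolding lhs rq unfolding div divc
    unfolding qq cmod_power2 u p l k
    apply (simp add: A_def B_def d)
    using rs(1) by algebra
qed

section \<open>Multipliers of rapidly decreasing functions, weighted integrability, derivatives
  along lines\<close>

definition moderate :: "('a::euclidean_space \<Rightarrow> complex) \<Rightarrow> bool" where
  "moderate f \<longleftrightarrow> (\<exists>C m. \<forall>x. norm (f x) \<le> C * (1 + norm x) ^ m)"

lemma moderateI: "(\<And>x. norm (f x) \<le> C * (1 + norm x) ^ m) \<Longrightarrow> moderate f"
  by (auto simp: moderate_def)

lemma moderateE:
  assumes "moderate f"
  obtains C m where "0 \<le> C" "\<And>x. norm (f x) \<le> C * (1 + norm x) ^ m"
proof -
  obtain C m where *: "\<And>x. norm (f x) \<le> C * (1 + norm x) ^ m" using assms by (auto simp: moderate_def)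
  from order_trans[OF norm_ge_zero *[of 0]] have "0 \<le> C" by simp
  with * that show ?thesis by blast
qed

lemma moderate_rapid: "rapid f \<Longrightarrow> moderate f"
  by (erule rapid_bounded) (rule moderateI[where m=0], simp)

lemma moderate_const: "moderate (\<lambda>_. c)"
  by (rule moderateI[of _ "norm c" 0]) simp

lemma moderate_norm: "moderate (\<lambda>x. complex_of_real (norm x))"
  by (rule moderateI[of _ 1 1]) simp

lemma moderate_inner: "moderate (\<lambda>x. complex_of_real (x \<bullet> v))"
proof (rule moderateI[of _ "norm v" 1])
  fix x :: 'a
  have "\<bar>x \<bullet> v\<bar> \<le> norm x * norm v" by (rule Cauchy_Schwarz_ineq2)
  also have "\<dots> \<le> norm v * (1 + norm x) ^ 1" by (simp add: algebra_simps)
  finally show "cmod (complex_of_real (x \<bullet> v)) \<le> norm v * (1 + norm x) ^ 1" by simp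
qed

lemma moderate_mult: assumes "moderate f" "moderate g" shows "moderate (\<lambda>x. f x * g x)"
proof -
  obtain C m where f: "0 \<le> C" "\<And>x. norm (f x) \<le> C * (1 + norm x) ^ m" using moderateE[OF assms(1)] by blast
  obtain D n where g: "0 \<le> D" "\<And>x. norm (g x) \<le> D * (1 + norm x) ^ n" using moderateE[OF assms(2)] by blast
  have "norm (f x * g x) \<le> (C * (1 + norm x) ^ m) * (D * (1 + norm x) ^ n)" for x
    unfolding norm_mult using f(1) f(2)[of x] g(2)[of x] by (intro mult_mono) auto
  then show ?thesis by (intro moderateI[of _ "C * D" "m + n"]) (simp add: power_add mult_ac)
qed

lemma rapid_mult: assumes "rapid f" "moderate g" shows "rapid (\<lambda>x. f x * g x)"
  unfolding rapid_def
proof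
  fix N
  obtain D n where g: "0 \<le> D" "\<And>x. norm (g x) \<le> D * (1 + norm x) ^ n" using moderateE[OF assms(2)] by blast
  obtain C where C: "\<And>x. norm (f x) * (1 + norm x) ^ (n + N) \<le> C" using assms(1) unfolding rapid_def by blast
  have "norm (f x * g x) * (1 + norm x) ^ N \<le> D * C" for x
  proof -
    have "norm (f x * g x) * (1 + norm x) ^ N \<le> norm (f x) * (D * (1 + norm x) ^ n) * (1 + norm x) ^ N"
      unfolding norm_mult using g(2)[of x] by (intro mult_right_mono mult_left_mono) auto
    also have "\<dots> = D * (norm (f x) * (1 + norm x) ^ (n + N))" by (simp add: power_add mult_ac)
    also have "\<dots> \<le> D * C" using C g(1) by (intro mult_left_mono)
    finally show ?thesis .
  qed
  then show "\<exists>C. \<forall>x. norm (f x * g x) * (1 + norm x) ^ N \<le> C" by blast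
qed

lemma rapid_mult_left: "moderate f \<Longrightarrow> rapid g \<Longrightarrow> rapid (\<lambda>x. f x * g x)"
  using rapid_mult[of g f] by (simp add: mult.commute)

lemma rapid_zero: "rapid (\<lambda>_. 0)"
  by (auto simp: rapid_def)

lemma rapid_add: assumes "rapid f" "rapid g" shows "rapid (\<lambda>x. f x + g x)"
  unfolding rapid_def
proof
  fix N
  obtain C D where C: "\<And>x. norm (f x) * (1 + norm x) ^ N \<le> C" and D: "\<And>x. norm (g x) * (1 + norm x) ^ N \<le> D"
    using assms unfolding rapid_def by metis
  have "norm (f x + g x) * (1 + norm x) ^ N \<le> (norm (f x) + norm (g x)) * (1 + norm x) ^ N" for x
    by (intro mult_right_mono norm_triangle_ineq) auto
  then have "norm (f x + g x) * (1 + norm x) ^ N \<le> C + D" for x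
    using C[of x] D[of x] by (smt (verit) distrib_right)
  then show "\<exists>C. \<forall>x. norm (f x + g x) * (1 + norm x) ^ N \<le> C" by blast
qed

lemma rapid_sum: "finite I \<Longrightarrow> (\<And>i. i \<in> I \<Longrightarrow> rapid (f i)) \<Longrightarrow> rapid (\<lambda>x. \<Sum>i\<in>I. f i x)"
  by (induction rule: finite_induct) (auto intro: rapid_add rapid_zero)

lemma rapid_cnj: "rapid f \<Longrightarrow> rapid (\<lambda>x. cnj (f x))"
  by (simp add: rapid_def)

lemma rapid_cmult: "rapid f \<Longrightarrow> rapid (\<lambda>x. c * f x)"
  by (rule rapid_mult_left[OF moderate_const])

lemma rapid_uminus: "rapid f \<Longrightarrow> rapid (\<lambda>x. - f x)"
  by (simp add: rapid_def)

lemma rapid_diff: "rapid f \<Longrightarrow> rapid g \<Longrightarrow> rapid (\<lambda>x. f x - g x)"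
  using rapid_add[OF _ rapid_uminus, of f g] by simp

lemmas rapid_intros = rapid_mult rapid_mult_left rapid_zero rapid_add rapid_diff rapid_sum rapid_cnj rapid_cmult rapid_uminus

lemma integrable_powi_rapid:
  fixes A :: "'a::euclidean_space \<Rightarrow> complex"
  assumes d: "DIM('a) \<ge> 3" and A: "rapid A" and [measurable]: "A \<in> borel_measurable borel" and j: "- 2 \<le> j"
  shows "integrable lborel (\<lambda>x. (norm x powi j) *\<^sub>R A x)"
proof -
  \<comment> \<open>Shifting the exponent by 2 leaves a nonnegative power, absorbed by the rapid
    decay, and the inverse-square singularity that d >= 3 tolerates.\<close>
  define n where "n = nat (j + 2)"
  have n: "norm x powi j = norm x ^ n / (norm x)\<^sup>2" if "x \<noteq> 0" for x :: 'a
  proof -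
    have "norm x ^ n / (norm x)\<^sup>2 = norm x powi (int n) / norm x powi (int 2)" by (simp only: power_int_of_nat)
    also have "\<dots> = norm x powi (int n - int 2)" using that by (intro power_int_diff[symmetric]) auto
    also have "int n - int 2 = j" using j by (simp add: n_def)
    finally show ?thesis ..
  qed
  obtain C where C: "0 \<le> C" "\<And>x. norm (A x) \<le> C / (1 + norm x) ^ (n + (DIM('a) + 2))"
    using rapid_bound[OF A] by metis
  show ?thesis
  proof (rule integrable_singular_decay[OF _ d, of _ C])
    fix x :: 'a assume x: "x \<noteq> 0"
    define R where "R = 1 + norm x"
    have R: "R > 0" "norm x \<le> R" by (auto simp: R_def add_pos_nonneg)
    have "norm ((norm x powi j) *\<^sub>R A x) = norm x ^ n * norm (A x) / (norm x)\<^sup>2"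
      using n[OF x] by simp
    also have "\<dots> \<le> R ^ n * (C / R ^ (n + (DIM('a) + 2))) / (norm x)\<^sup>2"
      using C(2)[of x] R by (intro divide_right_mono mult_mono power_mono) (auto simp: R_def)
    also have "\<dots> = C * (1 / (norm x)\<^sup>2) / R ^ (DIM('a) + 2)"
      using R by (simp add: power_add)
    also have "\<dots> \<le> C * (1 + 1 / (norm x)\<^sup>2) / R ^ (DIM('a) + 2)"
      using R C(1) by (intro divide_right_mono mult_left_mono) auto
    finally show "norm ((norm x powi j) *\<^sub>R A x) \<le> C * (1 + 1 / (norm x)\<^sup>2) / (1 + norm x) ^ (DIM('a) + 2)"
      by (simp add: R_def)
  qed (simp add: power_int_def)
qed

lemma integrable_rapid:
  fixes A :: "'a::euclidean_space \<Rightarrow> complex"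
  assumes "rapid A" "A \<in> borel_measurable borel" shows "integrable lborel A"
proof -
  obtain C where "\<And>x. norm (A x) \<le> C / (1 + norm x) ^ (DIM('a) + 2)"
    using rapid_bound[OF assms(1)] by metis
  then show ?thesis
    by (rule integrable_decay[rotated]) (use assms(2) in simp)
qed

text \<open>A derivative along one line at one point is all that the divergence theorem below asks
  for, and singular weights have it away from 0. Its rules produce derivatives in the form in which
  the fields \<open>h'\<close> are written later, so those proofs are mere rule
  applications.\<close>

definition line_deriv :: "'a::euclidean_space \<Rightarrow> ('a \<Rightarrow> complex) \<Rightarrow> 'a \<Rightarrow> complex \<Rightarrow> bool" where
  "line_deriv b f x D \<longleftrightarrow> ((\<lambda>t. f (x + t *\<^sub>R b)) has_vector_derivative D) (at 0)"

lemma line_deriv_pd: "schwartz f \<Longrightarrow> b \<in> Basis \<Longrightarrow> line_deriv b f x (pd b f x)"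
  unfolding line_deriv_def using has_vector_derivative_line_Basis[of f x 0 b] schwartz_differentiable by auto

lemma line_deriv_add: "line_deriv b f x D \<Longrightarrow> line_deriv b g x E \<Longrightarrow> line_deriv b (\<lambda>x. f x + g x) x (D + E)"
  unfolding line_deriv_def by (rule has_vector_derivative_add)

lemma line_deriv_diff: "line_deriv b f x D \<Longrightarrow> line_deriv b g x E \<Longrightarrow> line_deriv b (\<lambda>x. f x - g x) x (D - E)"
  unfolding line_deriv_def by (rule has_vector_derivative_diff)

lemma line_deriv_mult: "line_deriv b f x D \<Longrightarrow> line_deriv b g x E \<Longrightarrow> line_deriv b (\<lambda>x. f x * g x) x (f x * E + D * g x)"
  unfolding line_deriv_def using has_vector_derivative_mult[of "\<lambda>t. f (x + t *\<^sub>R b)" D 0 UNIV "\<lambda>t. g (x + t *\<^sub>R b)" E] by simp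

lemma line_deriv_cnj: "line_deriv b f x D \<Longrightarrow> line_deriv b (\<lambda>x. cnj (f x)) x (cnj D)"
  unfolding line_deriv_def by (rule has_vector_derivative_cnj)

lemma line_deriv_cmult: "line_deriv b f x D \<Longrightarrow> line_deriv b (\<lambda>x. c * f x) x (c * D)"
  unfolding line_deriv_def by (rule has_vector_derivative_mult_right)

lemma line_deriv_sum: "(\<And>i. i \<in> I \<Longrightarrow> line_deriv b (f i) x (D i)) \<Longrightarrow> line_deriv b (\<lambda>x. \<Sum>i\<in>I. f i x) x (\<Sum>i\<in>I. D i)"
  unfolding line_deriv_def by (rule has_vector_derivative_sum)

lemma line_deriv_inner: "line_deriv b (\<lambda>x. complex_of_real (x \<bullet> v)) x (complex_of_real (b \<bullet> v))"
  unfolding line_deriv_def by (rule has_vector_derivative_of_real) (auto intro!: derivative_eq_intros simp: inner_add_left)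

lemma line_deriv_norm_powi:
  assumes "x \<noteq> 0"
  shows "line_deriv b (\<lambda>x. complex_of_real (norm x powi j)) x (complex_of_real (of_int j * (x \<bullet> b) * norm x powi (j - 2)))"
proof -
  have "((\<lambda>t. x + t *\<^sub>R b) has_derivative (\<lambda>t. t *\<^sub>R b)) (at 0)" by (auto intro!: derivative_eq_intros)
  moreover have "(norm has_derivative (\<lambda>h. h \<bullet> sgn x)) (at (x + 0 *\<^sub>R b))"
    using has_derivative_norm[OF assms] by simp
  ultimately have "((\<lambda>t. norm (x + t *\<^sub>R b)) has_derivative (\<lambda>t. (t *\<^sub>R b) \<bullet> sgn x)) (at 0)"
    by (rule has_derivative_compose)
  then have *: "((\<lambda>t. norm (x + t *\<^sub>R b)) has_field_derivative ((x \<bullet> b) / norm x)) (at 0)"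
    unfolding has_field_derivative_def
    by (rule has_derivative_eq_rhs) (auto simp: sgn_div_norm inner_commute divide_inverse)
  have "((\<lambda>t. norm (x + t *\<^sub>R b) powi j) has_field_derivative (of_int j * norm x powi (j - 1) * ((x \<bullet> b) / norm x))) (at 0)"
    using DERIV_power_int[OF *, of j] assms by (simp add: mult_ac)
  also have "of_int j * norm x powi (j - 1) * ((x \<bullet> b) / norm x) = of_int j * (x \<bullet> b) * norm x powi (j - 2)"
  proof -
    have "norm x powi (j - 1) = norm x powi (j - 2) * norm x"
      using power_int_add[of "norm x" "j - 2" 1] assms by simp
    then show ?thesis using assms by simp
  qed
  finally show ?thesis
    unfolding line_deriv_def
    by (intro has_vector_derivative_of_real) (simp add: has_real_derivative_iff_has_vector_derivative)
qed

lemmas line_deriv_intros = line_deriv_pd line_deriv_add line_deriv_diff line_deriv_mult line_deriv_cnj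
  line_deriv_sum line_deriv_inner line_deriv_norm_powi

text \<open>One coordinate at a time, each summand integrates to 0. Agreement with the divergence is
  asked for only off the origin, a null set, because weights such as \<open>1 / norm x\<close> have
  default values there.\<close>

lemma integral_divergence_eq_0:
  fixes h h' :: "'a::euclidean_space \<Rightarrow> 'a \<Rightarrow> complex"
  assumes "DIM('a) \<ge> 2"
    and h: "\<And>b. b \<in> Basis \<Longrightarrow> integrable lborel (h b)"
    and h': "\<And>b. b \<in> Basis \<Longrightarrow> integrable lborel (h' b)"
    and D: "\<And>b x. b \<in> Basis \<Longrightarrow> x \<noteq> 0 \<Longrightarrow> line_deriv b (h b) x (h' b x)"
    and F: "\<And>x. x \<noteq> 0 \<Longrightarrow> F x = (\<Sum>b\<in>Basis. h' b x)" and F_m: "F \<in> borel_measurable borel"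
  shows "integrable lborel F \<and> (LINT x|lborel. F x) = 0"
proof
  have AE: "AE x in lborel. F x = (\<Sum>b\<in>Basis. h' b x)"
    using AE_lborel_singleton[of 0] by eventually_elim (use F in auto)
  have int: "integrable lborel (\<lambda>x. \<Sum>b\<in>Basis. h' b x)" using h' by auto
  have m: "(\<lambda>x. \<Sum>b\<in>Basis. h' b x) \<in> borel_measurable lborel" using int by auto
  show "integrable lborel F" using int by (subst integrable_cong_AE[OF _ m AE]) (use F_m in auto)
  have "(LINT x|lborel. F x) = (LINT x|lborel. (\<Sum>b\<in>Basis. h' b x))"
    by (rule integral_cong_AE[OF _ m AE]) (use F_m in auto)
  also have "\<dots> = (\<Sum>b\<in>Basis. (LINT x|lborel. h' b x))" using h' by (subst Bochner_Integration.integral_sum) auto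
  also have "\<dots> = 0"
  proof (rule sum.neutral, rule ballI)
    fix b :: 'a assume b: "b \<in> Basis"
    show "(LINT x|lborel. h' b x) = 0"
      using integral_line_derivative_eq_0[OF assms(1) b h[OF b] h'[OF b]] D[OF b]
      unfolding line_deriv_def by blast
  qed
  finally show "(LINT x|lborel. F x) = 0" .
qed

text \<open>This is r times the radial derivative. Leaving the division by r to the weights keeps it
  rapidly decreasing and regular at 0.\<close>

definition radial :: "('a::euclidean_space \<Rightarrow> complex) \<Rightarrow> 'a \<Rightarrow> complex" where
  "radial u x = (\<Sum>b\<in>Basis. complex_of_real (x \<bullet> b) * pd b u x)"

definition lap :: "('a::euclidean_space \<Rightarrow> complex) \<Rightarrow> 'a \<Rightarrow> complex" where
  "lap u x = (\<Sum>b\<in>Basis. pd b (pd b u) x)"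

definition grad_sq :: "('a::euclidean_space \<Rightarrow> complex) \<Rightarrow> 'a \<Rightarrow> real" where
  "grad_sq u x = (\<Sum>b\<in>Basis. (cmod (pd b u x))\<^sup>2)"

text \<open>Differentiating \<open>norm x powi j\<close> lowers the exponent by 2, possibly to -4.
  The square of the coordinate, at most the square of the norm, restores integrability.\<close>

lemma integrable_powi_rapid_inner:
  fixes A :: "'a::euclidean_space \<Rightarrow> complex"
  assumes d: "DIM('a) \<ge> 3" and A: "rapid A" and [measurable]: "A \<in> borel_measurable borel" and j: "- 2 \<le> j"
    and b: "b \<in> Basis"
  shows "integrable lborel (\<lambda>x. ((x \<bullet> b)\<^sup>2 * norm x powi (j - 2)) *\<^sub>R A x)"
proof (rule Bochner_Integration.integrable_bound)
  show "integrable lborel (\<lambda>x. (norm x powi j) *\<^sub>R A x)"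
    by (rule integrable_powi_rapid) (use assms in auto)
  show "AE x in lborel. norm (((x \<bullet> b)\<^sup>2 * norm x powi (j - 2)) *\<^sub>R A x) \<le> norm ((norm x powi j) *\<^sub>R A x)"
    using AE_lborel_singleton[of 0]
  proof eventually_elim
    fix x :: 'a assume x: "x \<noteq> 0"
    have "(x \<bullet> b)\<^sup>2 * norm x powi (j - 2) \<le> (norm x)\<^sup>2 * norm x powi (j - 2)"
      using Basis_le_norm[OF b, of x] by (intro mult_right_mono abs_le_square_iff[THEN iffD1]) auto
    also have "\<dots> = norm x powi j"
      using x power_int_diff[of "norm x" j 2] by simp
    finally show "norm (((x \<bullet> b)\<^sup>2 * norm x powi (j - 2)) *\<^sub>R A x) \<le> norm ((norm x powi j) *\<^sub>R A x)"
      by (auto simp: intro!: mult_right_mono)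
  qed
qed (simp add: power_int_def)

lemma sum_inner_square: "(\<Sum>b\<in>Basis. (x \<bullet> b)\<^sup>2) = (norm x)\<^sup>2"
  unfolding power2_norm_eq_inner euclidean_inner[of x x] by (simp add: power2_eq_square)

lemma borel_measurable_cnj [measurable (raw)]:
  "f \<in> borel_measurable M \<Longrightarrow> (\<lambda>x. cnj (f x)) \<in> borel_measurable M"
  by (rule measurable_compose[OF _ borel_measurable_continuous_onI[OF continuous_on_cnj[OF continuous_on_id]]])

text \<open>Cauchy-Schwarz. The slack is the angular part of the gradient, which the multiplier
  estimate discards as nonnegative.\<close>

lemma radial_square_le: "(cmod (radial u x))\<^sup>2 \<le> (norm x)\<^sup>2 * grad_sq u x"
proof -
  have "cmod (radial u x) \<le> (\<Sum>b\<in>Basis. \<bar>x \<bullet> b\<bar> * cmod (pd b u x))"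
    unfolding radial_def by (intro sum_norm_le) (simp add: norm_mult)
  then have "(cmod (radial u x))\<^sup>2 \<le> (\<Sum>b\<in>Basis. \<bar>x \<bullet> b\<bar> * cmod (pd b u x))\<^sup>2"
    by (intro power_mono) auto
  also have "\<dots> \<le> (\<Sum>b\<in>Basis. \<bar>x \<bullet> b\<bar>\<^sup>2) * (\<Sum>b\<in>Basis. (cmod (pd b u x))\<^sup>2)"
    by (rule Cauchy_Schwarz_ineq_sum)
  finally show ?thesis by (simp add: sum_inner_square grad_sq_def)
qed

lemma borel_measurable_power_int [measurable (raw)]:
  fixes f :: "'a \<Rightarrow> real"
  shows "f \<in> borel_measurable M \<Longrightarrow> (\<lambda>x. f x powi j) \<in> borel_measurable M"
  by (simp add: power_int_def)

section \<open>Divergence identities for a Schwartz function with radial weights\<close>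

context
  fixes u :: "'a::euclidean_space \<Rightarrow> complex"
  assumes u: "schwartz u" and d: "DIM('a) \<ge> 3"
begin

lemma borel_u [measurable]: "u \<in> borel_measurable borel"
  and borel_pd_u: "b \<in> Basis \<Longrightarrow> pd b u \<in> borel_measurable borel"
  and borel_pd_pd_u: "b \<in> Basis \<Longrightarrow> c \<in> Basis \<Longrightarrow> pd b (pd c u) \<in> borel_measurable borel"
  using u by (auto intro!: borel_measurable_schwartz schwartz_pd)

lemma rapid_u: "rapid u" "b \<in> Basis \<Longrightarrow> rapid (pd b u)" "b \<in> Basis \<Longrightarrow> c \<in> Basis \<Longrightarrow> rapid (pd b (pd c u))"
  using u by (auto intro!: schwartz_rapid schwartz_pd)

lemma moderate_u: "moderate (\<lambda>x. cnj (u x))" "b \<in> Basis \<Longrightarrow> moderate (\<lambda>x. cnj (pd b u x))"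
  by (auto intro!: moderate_rapid rapid_cnj rapid_u)

lemma borel_radial [measurable]: "radial u \<in> borel_measurable borel"
  unfolding radial_def by (intro borel_measurable_sum borel_measurable_times borel_pd_u) measurable

lemma borel_lap [measurable]: "lap u \<in> borel_measurable borel"
  unfolding lap_def by (intro borel_measurable_sum borel_pd_pd_u)

lemma borel_grad_sq [measurable]: "grad_sq u \<in> borel_measurable borel"
proof -
  note [measurable] = borel_pd_u
  show ?thesis unfolding grad_sq_def by measurable
qed

lemma rapid_radial: "rapid (radial u)"
  unfolding radial_def by (intro rapid_sum rapid_mult_left moderate_inner rapid_u) auto

lemma rapid_lap: "rapid (lap u)"
  unfolding lap_def by (intro rapid_sum rapid_u) auto

text \<open>\<open>F\<close> is the divergence of the field x |x|^j |u|^2 away from 0: the vector x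
  contributes the dimension and the weight contributes j. The exponents 0, -1 and -2 are used; the
  last one also yields the Hardy inequality.\<close>

lemma virial_norm_powi:
  assumes j: "- 2 \<le> j"
  defines "F \<equiv> \<lambda>x. norm x powi j * (2 * Re (cnj (u x) * radial u x) + (real DIM('a) + of_int j) * (cmod (u x))\<^sup>2)"
  shows "integrable lborel F" "(LINT x|lborel. F x) = 0"
proof -
  define h where "h b x = complex_of_real (x \<bullet> b) * (complex_of_real (norm x powi j) * (u x * cnj (u x)))" for b x
  define h' where "h' b x = complex_of_real (x \<bullet> b) * (complex_of_real (norm x powi j) * (u x * cnj (pd b u x) + pd b u x * cnj (u x))
      + complex_of_real (of_int j * (x \<bullet> b) * norm x powi (j - 2)) * (u x * cnj (u x)))
      + complex_of_real (b \<bullet> b) * (complex_of_real (norm x powi j) * (u x * cnj (u x)))" for b x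
  define H where "H x = complex_of_real (norm x powi j) *
     (cnj (u x) * radial u x + u x * cnj (radial u x) + (of_nat DIM('a) + of_int j) * (u x * cnj (u x)))" for x
  have ReH: "Re (H x) = F x" for x
  proof -
    have Re_scale: "Re (complex_of_real c * z) = c * Re z" for c z by simp
    show ?thesis
      unfolding H_def F_def Re_scale cmod_power2 by (simp add: algebra_simps cmod_power2 power2_eq_square)
  qed
  have *: "integrable lborel H \<and> (LINT x|lborel. H x) = 0"
  proof (rule integral_divergence_eq_0[of h h' H])
    show "integrable lborel (h b)" if b: "b \<in> Basis" for b
    proof -
      have "integrable lborel (\<lambda>x. (norm x powi j) *\<^sub>R (complex_of_real (x \<bullet> b) * (u x * cnj (u x))))"
        by (intro integrable_powi_rapid d j rapid_intros moderate_inner rapid_u moderate_u) measurable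
      then show ?thesis unfolding h_def by (simp add: scaleR_conv_of_real mult_ac)
    qed
    show "integrable lborel (h' b)" if b: "b \<in> Basis" for b
    proof -
      note [measurable] = borel_pd_u[OF b]
      have 1: "integrable lborel (\<lambda>x. (norm x powi j) *\<^sub>R (complex_of_real (x \<bullet> b) * (u x * cnj (pd b u x) + pd b u x * cnj (u x))))"
        by (intro integrable_powi_rapid d j rapid_mult_left rapid_add rapid_mult[OF _ moderate_u(2)] rapid_mult[OF _ moderate_u(1)] moderate_inner rapid_u b) measurable
      have 2: "integrable lborel (\<lambda>x. ((x \<bullet> b)\<^sup>2 * norm x powi (j - 2)) *\<^sub>R (of_int j * (u x * cnj (u x))))"
        by (intro integrable_powi_rapid_inner d j rapid_cmult rapid_mult[OF _ moderate_u(1)] rapid_u b) measurable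
      have 3: "integrable lborel (\<lambda>x. (norm x powi j) *\<^sub>R (complex_of_real (b \<bullet> b) * (u x * cnj (u x))))"
        by (intro integrable_powi_rapid d j rapid_cmult rapid_mult[OF _ moderate_u(1)] rapid_u b) measurable
      show ?thesis
        using Bochner_Integration.integrable_add[OF Bochner_Integration.integrable_add[OF 1 2] 3]
        unfolding h'_def by (simp add: scaleR_conv_of_real algebra_simps power2_eq_square)
    qed
    show "line_deriv b (h b) x (h' b x)" if "b \<in> Basis" "x \<noteq> 0" for b x
      unfolding h_def h'_def by (intro line_deriv_intros that u)
    show "H x = (\<Sum>b\<in>Basis. h' b x)" if x: "x \<noteq> 0" for x
    proof -
      define \<rho> where "\<rho> = complex_of_real (norm x powi j)"
      define \<sigma> where "\<sigma> = complex_of_real (norm x powi (j - 2))"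
      have \<rho>: "complex_of_real ((norm x)\<^sup>2) * \<sigma> = \<rho>"
        using x power_int_diff[of "norm x" j 2] by (simp add: \<rho>_def \<sigma>_def)
      have "(\<Sum>b\<in>Basis. h' b x) = (\<Sum>b\<in>Basis. \<rho> * u x * cnj (complex_of_real (x \<bullet> b) * pd b u x)
          + \<rho> * cnj (u x) * (complex_of_real (x \<bullet> b) * pd b u x)
          + of_int j * \<sigma> * (u x * cnj (u x)) * complex_of_real ((x \<bullet> b)\<^sup>2) + \<rho> * (u x * cnj (u x)))"
        unfolding h'_def \<rho>_def[symmetric]
        by (intro sum.cong) (auto simp: \<sigma>_def algebra_simps power2_eq_square)
      also have "\<dots> = \<rho> * u x * cnj (radial u x) + \<rho> * cnj (u x) * radial u x
          + of_int j * \<sigma> * (u x * cnj (u x)) * complex_of_real ((norm x)\<^sup>2) + of_nat DIM('a) * (\<rho> * (u x * cnj (u x)))"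
        unfolding radial_def sum.distrib sum_inner_square[symmetric]
        by (simp add: sum_distrib_left)
      also have "\<dots> = H x" unfolding H_def \<rho>_def[symmetric] \<rho>[symmetric] by (simp add: algebra_simps)
      finally show ?thesis ..
    qed
    show "H \<in> borel_measurable borel"
      unfolding H_def by measurable
  qed (use d in auto)
  have "F = (\<lambda>x. Re (H x))" using ReH by auto
  then show "integrable lborel F" "(LINT x|lborel. F x) = 0"
    using * integral_Re[of lborel H] integrable_Re[of lborel H] by auto
qed

text \<open>The divergence of |x| cnj u grad u, which corresponds to testing the equation with r u.
  The complex value is kept, because the multiplier identity multiplies it by
  \<open>\<i> * cnj k\<close> before taking real parts.\<close>

lemma green_norm:
  defines "H \<equiv> \<lambda>x. complex_of_real (norm x) * (lap u x * cnj (u x)) + cnj (u x) * radial u x / complex_of_real (norm x)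
     + complex_of_real (norm x) * complex_of_real (grad_sq u x)"
  shows "integrable lborel H" "(LINT x|lborel. H x) = 0"
proof -
  define h where "h b x = complex_of_real (norm x powi 1) * (pd b u x * cnj (u x))" for b x
  define h' where "h' b x = complex_of_real (norm x powi 1) * (pd b u x * cnj (pd b u x) + pd b (pd b u) x * cnj (u x))
     + complex_of_real (of_int 1 * (x \<bullet> b) * norm x powi (1 - 2)) * (pd b u x * cnj (u x))" for b x
  have "integrable lborel H \<and> (LINT x|lborel. H x) = 0"
  proof (rule integral_divergence_eq_0[of h h' H])
    show "integrable lborel (h b)" if b: "b \<in> Basis" for b
    proof -
      note [measurable] = borel_pd_u[OF b]
      have "integrable lborel (\<lambda>x. (norm x powi 1) *\<^sub>R (pd b u x * cnj (u x)))"
        by (intro integrable_powi_rapid d rapid_intros moderate_inner rapid_u moderate_u b) (auto, measurable)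
      then show ?thesis unfolding h_def by (simp add: scaleR_conv_of_real mult_ac)
    qed
    show "integrable lborel (h' b)" if b: "b \<in> Basis" for b
    proof -
      note [measurable] = borel_pd_u[OF b] borel_pd_pd_u[OF b b]
      have 1: "integrable lborel (\<lambda>x. (norm x powi 1) *\<^sub>R (pd b u x * cnj (pd b u x) + pd b (pd b u) x * cnj (u x)))"
        by (intro integrable_powi_rapid d rapid_add rapid_mult[OF _ moderate_u(2)] rapid_mult[OF _ moderate_u(1)] rapid_u b) (auto, measurable)
      have 2: "integrable lborel (\<lambda>x. (norm x powi (-1)) *\<^sub>R (complex_of_real (x \<bullet> b) * (pd b u x * cnj (u x))))"
        by (intro integrable_powi_rapid d rapid_mult_left[OF moderate_inner] rapid_mult[OF _ moderate_u(1)] rapid_u b) (auto, measurable)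
      show ?thesis
        using Bochner_Integration.integrable_add[OF 1 2]
        unfolding h'_def by (simp add: scaleR_conv_of_real mult_ac)
    qed
    show "line_deriv b (h b) x (h' b x)" if "b \<in> Basis" "x \<noteq> 0" for b x
      unfolding h_def h'_def by (intro line_deriv_intros that u schwartz_pd)
    show "H x = (\<Sum>b\<in>Basis. h' b x)" if x: "x \<noteq> 0" for x
    proof -
      have "(\<Sum>b\<in>Basis. h' b x) = (\<Sum>b\<in>Basis. complex_of_real (norm x) * complex_of_real ((cmod (pd b u x))\<^sup>2)
          + complex_of_real (norm x) * (pd b (pd b u) x * cnj (u x))
          + cnj (u x) * (complex_of_real (x \<bullet> b) * pd b u x) / complex_of_real (norm x))"
        unfolding h'_def
        by (intro sum.cong) (simp_all add: complex_norm_square divide_inverse algebra_simps del: of_real_power)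
      also have "\<dots> = H x"
        unfolding H_def radial_def lap_def grad_sq_def sum.distrib
        by (simp add: sum_distrib_left sum_distrib_right sum_divide_distrib)
      finally show ?thesis ..
    qed
    show "H \<in> borel_measurable borel" unfolding H_def by measurable
  qed (use d in auto)
  then show "integrable lborel H" "(LINT x|lborel. H x) = 0" by auto
qed

text \<open>A Rellich identity: the real part of the divergence of cnj (x . grad u + m u) grad u - x
  |grad u|^2 / 2. The coefficient of |grad u|^2 comes out as 1 + m - d / 2, which is 1 / 2 for this
  m.\<close>

lemma green_dilation:
  defines "m \<equiv> (real DIM('a) - 1) / 2"
  defines "F \<equiv> \<lambda>x. Re (lap u x * cnj (radial u x + complex_of_real m * u x)) + grad_sq u x / 2"
  shows "integrable lborel F" "(LINT x|lborel. F x) = 0"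
proof -
  let ?m = "complex_of_real m"
  define h where "h b x = pd b u x * cnj (\<Sum>c\<in>Basis. complex_of_real (x \<bullet> c) * pd c u x) + pd b u x * (?m * cnj (u x))
      - complex_of_real (x \<bullet> b) * (1/2 * (\<Sum>c\<in>Basis. pd c u x * cnj (pd c u x)))" for b x
  define h' where "h' b x = (pd b u x * cnj (\<Sum>c\<in>Basis. complex_of_real (x \<bullet> c) * pd b (pd c u) x + complex_of_real (b \<bullet> c) * pd c u x)
      + pd b (pd b u) x * cnj (\<Sum>c\<in>Basis. complex_of_real (x \<bullet> c) * pd c u x))
      + (pd b u x * (?m * cnj (pd b u x)) + pd b (pd b u) x * (?m * cnj (u x)))
      - (complex_of_real (x \<bullet> b) * (1/2 * (\<Sum>c\<in>Basis. pd c u x * cnj (pd b (pd c u) x) + pd b (pd c u) x * cnj (pd c u x)))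
         + complex_of_real (b \<bullet> b) * (1/2 * (\<Sum>c\<in>Basis. pd c u x * cnj (pd c u x))))" for b x
  define H where "H x = (\<Sum>b\<in>Basis. h' b x)" for x
  have mr: "moderate (\<lambda>x. cnj (\<Sum>c\<in>Basis. complex_of_real (x \<bullet> c) * pd c u x))"
    using moderate_rapid[OF rapid_cnj[OF rapid_radial]] unfolding radial_def .
  have mc: "moderate (\<lambda>x. c * cnj (u x))" for c by (rule moderate_mult[OF moderate_const moderate_u(1)])
  have mc': "b \<in> Basis \<Longrightarrow> moderate (\<lambda>x. c * cnj (pd b u x))" for b c
    by (rule moderate_mult[OF moderate_const moderate_u(2)])
  have m2: "moderate (\<lambda>x. cnj (\<Sum>c\<in>Basis. complex_of_real (x \<bullet> c) * pd b (pd c u) x + complex_of_real (b \<bullet> c) * pd c u x))"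
    if "b \<in> Basis" for b
    using that by (intro moderate_rapid rapid_cnj rapid_sum rapid_add rapid_mult_left[OF moderate_inner] rapid_cmult rapid_u) auto
  have m3: "moderate (\<lambda>x. cnj (pd b (pd c u) x))" if "b \<in> Basis" "c \<in> Basis" for b c
    using that by (intro moderate_rapid rapid_cnj rapid_u)
  have *: "integrable lborel H \<and> (LINT x|lborel. H x) = 0"
  proof (rule integral_divergence_eq_0[of h h' H])
    note [measurable] = borel_pd_u borel_pd_pd_u
    show "integrable lborel (h b)" if b: "b \<in> Basis" for b
    proof (rule integrable_rapid)
      show "rapid (h b)" unfolding h_def
        by (intro rapid_add rapid_diff rapid_mult[OF _ mr] rapid_mult[OF _ mc] rapid_mult_left[OF moderate_inner]
            rapid_cmult rapid_sum rapid_mult[OF _ moderate_u(2)] rapid_u b) auto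
      show "h b \<in> borel_measurable borel" unfolding h_def using b by measurable
    qed
    show "integrable lborel (h' b)" if b: "b \<in> Basis" for b
    proof (rule integrable_rapid)
      show "rapid (h' b)" unfolding h'_def
        by (intro rapid_add rapid_diff rapid_mult[OF _ mr] rapid_mult[OF _ m2[OF b]] rapid_mult[OF _ mc]
            rapid_mult[OF _ mc'[OF b]] rapid_mult_left[OF moderate_inner] rapid_cmult rapid_sum
            rapid_mult[OF _ moderate_u(2)] rapid_mult[OF _ m3[OF b]] rapid_u b) auto
      show "h' b \<in> borel_measurable borel" unfolding h'_def using b by measurable
    qed
    show "line_deriv b (h b) x (h' b x)" if "b \<in> Basis" "x \<noteq> 0" for b x
      unfolding h_def h'_def
      by (intro line_deriv_add line_deriv_diff line_deriv_mult line_deriv_cmult line_deriv_cnj line_deriv_sum line_deriv_inner line_deriv_pd schwartz_pd that u)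
    show "H \<in> borel_measurable borel"
      unfolding H_def h'_def by measurable
  qed (use d in \<open>auto simp: H_def\<close>)
  have ReH: "Re (H x) = F x" for x
  proof -
    \<comment> \<open>The second-order terms: \<open>f\<close> from the derivative of x . grad u,
      \<open>g\<close> from that of |grad u|^2 / 2. After exchanging the indices, symmetry of mixed
      partials makes their double sums equal, so they cancel.\<close>
    define f where "f b c = (x \<bullet> c) * Re (pd b u x * cnj (pd b (pd c u) x))" for b c
    define g where "g b c = (x \<bullet> b) * Re (pd c u x * cnj (pd b (pd c u) x))" for b c
    have Dcomm: "pd b (pd c u) x = pd c (pd b u) x" if "b \<in> Basis" "c \<in> Basis" for b c
      using schwartz_pd_commute[OF u that] by simp
    have 1: "(\<Sum>b\<in>Basis. \<Sum>c\<in>Basis. g b c) = (\<Sum>b\<in>Basis. \<Sum>c\<in>Basis. f b c)"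
      by (subst sum.swap) (auto intro!: sum.cong simp: f_def g_def Dcomm)
    have Re_h': "Re (h' b x) = (\<Sum>c\<in>Basis. f b c)
       + (cmod (pd b u x))\<^sup>2 + Re (pd b (pd b u) x * cnj (radial u x)) + m * (cmod (pd b u x))\<^sup>2
       + m * Re (pd b (pd b u) x * cnj (u x))
       - (\<Sum>c\<in>Basis. g b c) - grad_sq u x / 2"
      if b: "b \<in> Basis" for b
    proof -
      have s: "(\<Sum>c\<in>Basis. complex_of_real (b \<bullet> c) * pd c u x) = pd b u x"
        using sum_Basis_inner_scaleR[OF b, of "\<lambda>c. pd c u x"] by (simp add: scaleR_conv_of_real)
      have e1: "Re (pd b u x * cnj (\<Sum>c\<in>Basis. complex_of_real (x \<bullet> c) * pd b (pd c u) x + complex_of_real (b \<bullet> c) * pd c u x))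
         = (\<Sum>c\<in>Basis. f b c) + (cmod (pd b u x))\<^sup>2"
        unfolding sum.distrib s cmod_power2 f_def
        by (simp add: distrib_left sum_distrib_left power2_eq_square sum.distrib[symmetric] algebra_simps)
      have e2: "Re (complex_of_real (x \<bullet> b) * (1/2 * (\<Sum>c\<in>Basis. pd c u x * cnj (pd b (pd c u) x) + pd b (pd c u) x * cnj (pd c u x))))
         = (\<Sum>c\<in>Basis. g b c)"
        unfolding g_def by (simp add: sum_distrib_left) (auto intro!: sum.cong simp: algebra_simps)
      have e3: "Re (complex_of_real (b \<bullet> b) * (1/2 * (\<Sum>c\<in>Basis. pd c u x * cnj (pd c u x)))) = grad_sq u x / 2"
        using b unfolding grad_sq_def cmod_power2 by (simp add: power2_eq_square)
      have e4: "Re (pd b u x * (?m * cnj (pd b u x)) + pd b (pd b u) x * (?m * cnj (u x)))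
         = m * (cmod (pd b u x))\<^sup>2 + m * Re (pd b (pd b u) x * cnj (u x))"
        unfolding cmod_power2 by (simp add: power2_eq_square algebra_simps)
      show ?thesis
        unfolding h'_def radial_def plus_complex.sel(1) minus_complex.sel(1) e1 e2 e3
        using e4 by simp
    qed
    have "Re (H x) = (\<Sum>b\<in>Basis. Re (h' b x))" by (simp add: H_def)
    also have "\<dots> = (\<Sum>b\<in>Basis. \<Sum>c\<in>Basis. f b c) + grad_sq u x + Re (lap u x * cnj (radial u x)) + m * grad_sq u x + m * Re (lap u x * cnj (u x)) - (\<Sum>b\<in>Basis. \<Sum>c\<in>Basis. f b c) - real DIM('a) * (grad_sq u x / 2)"
      by (simp add: Re_h' sum.distrib sum_subtractf 1 grad_sq_def[of u x] lap_def sum_distrib_left[symmetric] sum_distrib_right[symmetric] cong: sum.cong)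
    also have "\<dots> = F x" by (simp add: F_def m_def field_simps)
    finally show ?thesis .
  qed
  have "F = (\<lambda>x. Re (H x))" using ReH by auto
  then show "integrable lborel F" "(LINT x|lborel. F x) = 0"
    using * integral_Re[of lborel H] integrable_Re[of lborel H] by auto
qed

end

declare borel_u [measurable del] borel_radial [measurable del] borel_lap [measurable del] borel_grad_sq [measurable del]

text \<open>With f = r g this is the operator bound with constant 1 / sqrt K, which explains K: 1/16
  is 1/4^2, and (d - 1) (d - 3) / 4 is m^2 - m. The assumption on k serves to fix signs, so K does
  not depend on k.\<close>

lemma weighted_resolvent_estimate:
  fixes u g :: "'a::euclidean_space \<Rightarrow> complex"
  assumes u: "schwartz u" and d: "DIM('a) \<ge> 3" and k: "Im k > 0"
    and g: "\<And>x. g x = - lap u x - k\<^sup>2 * u x"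
  defines "K \<equiv> if DIM('a) = 3 then 1 / 16 else (real DIM('a) - 1) * (real DIM('a) - 3) / 4"
  shows "integrable lborel (\<lambda>x. (cmod (u x))\<^sup>2 / (norm x)\<^sup>2)"
    and "K * (LINT x|lborel. (cmod (u x))\<^sup>2 / (norm x)\<^sup>2) \<le> (LINT x|lborel. (norm x)\<^sup>2 * (cmod (g x))\<^sup>2)"
proof -
  define m where "m = (real DIM('a) - 1) / 2"
  have d': "real DIM('a) = 2 * m + 1" by (simp add: m_def field_simps)
  have m: "1 \<le> m" using d by (simp add: m_def)
  note [measurable] = borel_u[OF u d] borel_lap[OF u d] borel_radial[OF u d]
  have g_eq: "g = (\<lambda>x. - lap u x - k\<^sup>2 * u x)" using g by auto
  have g_m[measurable]: "g \<in> borel_measurable borel" unfolding g_eq by measurable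
  have g_rapid: "rapid g" unfolding g_eq
    by (intro rapid_diff rapid_uminus rapid_cmult rapid_lap[OF u d] rapid_u[OF u d])
  show int_u: "integrable lborel (\<lambda>x. (cmod (u x))\<^sup>2 / (norm x)\<^sup>2)"
  proof -
    have "integrable lborel (\<lambda>x. (norm x powi (-2)) *\<^sub>R (u x * cnj (u x)))"
      by (intro integrable_powi_rapid d rapid_mult rapid_u[OF u d] moderate_u[OF u d]) auto
    then have "integrable lborel (\<lambda>x. Re ((norm x powi (-2)) *\<^sub>R (u x * cnj (u x))))" by (rule integrable_Re)
    also have "(\<lambda>x. Re ((norm x powi (-2)) *\<^sub>R (u x * cnj (u x)))) = (\<lambda>x. (cmod (u x))\<^sup>2 / (norm x)\<^sup>2)"
      unfolding cmod_power2 by (auto simp: power_int_minus divide_inverse power2_eq_square)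
    finally show ?thesis .
  qed
  have int_g: "integrable lborel (\<lambda>x. (norm x)\<^sup>2 * (cmod (g x))\<^sup>2)"
  proof -
    have "integrable lborel (\<lambda>x. complex_of_real (norm x) * (complex_of_real (norm x) * (g x * cnj (g x))))"
      by (intro integrable_rapid rapid_mult_left[OF moderate_norm] rapid_mult[OF g_rapid] moderate_rapid rapid_cnj g_rapid) measurable
    then have "integrable lborel (\<lambda>x. Re (complex_of_real (norm x) * (complex_of_real (norm x) * (g x * cnj (g x)))))" by (rule integrable_Re)
    also have "(\<lambda>x. Re (complex_of_real (norm x) * (complex_of_real (norm x) * (g x * cnj (g x))))) = (\<lambda>x. (norm x)\<^sup>2 * (cmod (g x))\<^sup>2)"
      unfolding cmod_power2 by (auto simp: power2_eq_square algebra_simps)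
    finally show ?thesis .
  qed
  define F where "F x = Re (lap u x * cnj (radial u x + complex_of_real m * u x)) + grad_sq u x / 2" for x
  define H where "H x = complex_of_real (norm x) * (lap u x * cnj (u x)) + cnj (u x) * radial u x / complex_of_real (norm x)
     + complex_of_real (norm x) * complex_of_real (grad_sq u x)" for x
  define V where "V j x = norm x powi j * (2 * Re (cnj (u x) * radial u x) + (real DIM('a) + of_int j) * (cmod (u x))\<^sup>2)" for j :: int and x
  have F: "integrable lborel F" "(LINT x|lborel. F x) = 0"
    using green_dilation[OF u d] unfolding F_def m_def by auto
  have H: "integrable lborel H" "(LINT x|lborel. H x) = 0"
    using green_norm[OF u d] unfolding H_def by auto
  have V: "integrable lborel (V j)" "(LINT x|lborel. V j x) = 0" if "- 2 \<le> j" for j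
    using virial_norm_powi[OF u d that] unfolding V_def by auto
  \<comment> \<open>Collects the divergence terms of the pointwise identity, so that only its signed
    terms survive integration.\<close>
  define Z where "Z x = - F x - Re (\<i> * cnj k * H x) - (cmod k)\<^sup>2 / 2 * V 0 x - m / 2 * V (-2) x - Im k * m * V (-1) x" for x
  have Z: "integrable lborel Z" "(LINT x|lborel. Z x) = 0"
  proof -
    have 1: "integrable lborel (\<lambda>x. Re (\<i> * cnj k * H x))" "(LINT x|lborel. Re (\<i> * cnj k * H x)) = 0"
      using H integral_Re[of lborel "\<lambda>x. \<i> * cnj k * H x"] integrable_Re[of lborel "\<lambda>x. \<i> * cnj k * H x"] by auto
    show "integrable lborel Z" unfolding Z_def using F 1 V by auto
    show "(LINT x|lborel. Z x) = 0" unfolding Z_def using F 1 V by simp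
  qed
  define q where "q x = radial u x / complex_of_real (norm x) - \<i> * k * u x + complex_of_real m * u x / complex_of_real (norm x)" for x
  have main: "(cmod (q x))\<^sup>2 / 2 + (m\<^sup>2 - m) / 2 * (cmod (u x))\<^sup>2 / (norm x)\<^sup>2 + Z x \<le> norm x * (cmod (g x) * cmod (q x))"
    if x: "x \<noteq> 0" for x
  proof -
    have r: "norm x > 0" using x by simp
    have "Re (g x * cnj (complex_of_real (norm x) * q x)) =
       (1/2 + Im k * norm x) * (cmod (q x))\<^sup>2 + (m\<^sup>2 - m) / 2 * (cmod (u x))\<^sup>2 / (norm x)\<^sup>2 + (m\<^sup>2 - m) * Im k * (cmod (u x))\<^sup>2 / norm x
       + (1/2 + Im k * norm x) * (grad_sq u x - (cmod (radial u x))\<^sup>2 / (norm x)\<^sup>2) + Z x"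
    proof -
      have V0: "V 0 x = 2 * Re (cnj (u x) * radial u x) + real DIM('a) * (cmod (u x))\<^sup>2"
        by (simp add: V_def)
      have V1: "V (-1) x = (2 * Re (cnj (u x) * radial u x) + (real DIM('a) - 1) * (cmod (u x))\<^sup>2) / norm x"
        by (simp add: V_def power_int_minus divide_inverse mult.commute)
      have V2: "V (-2) x = (2 * Re (cnj (u x) * radial u x) + (real DIM('a) - 2) * (cmod (u x))\<^sup>2) / (norm x)\<^sup>2"
        by (simp add: V_def power_int_minus divide_inverse mult.commute)
      have H': "complex_of_real (norm x) * (lap u x * cnj (u x)) + cnj (u x) * radial u x / complex_of_real (norm x)
          + complex_of_real (norm x * grad_sq u x) = H x" by (simp add: H_def)
      note id = pointwise_multiplier_identity[OF r d' q_def[of x], of "lap u x" "grad_sq u x", folded g]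
      show ?thesis
        unfolding id Z_def V0 V1 V2 F_def H' times_divide_eq_right by linarith
    qed
    \<comment> \<open>Three nonnegative quantities are dropped from here on: the angular part of the
      gradient, the term with (m^2 - m) Im k, and the surplus Im k r |q|^2. Their signs come from m
      >= 1 and Im k > 0.\<close>
    moreover have "(cmod (radial u x))\<^sup>2 / (norm x)\<^sup>2 \<le> grad_sq u x"
      using radial_square_le[of u x] r by (simp add: divide_le_eq mult.commute)
    then have "0 \<le> (1/2 + Im k * norm x) * (grad_sq u x - (cmod (radial u x))\<^sup>2 / (norm x)\<^sup>2)"
      using k by (intro mult_nonneg_nonneg) auto
    moreover have "0 \<le> (m\<^sup>2 - m) * Im k * (cmod (u x))\<^sup>2 / norm x"
      using k m by (intro divide_nonneg_nonneg mult_nonneg_nonneg) (auto simp: power2_eq_square)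
    moreover have "(cmod (q x))\<^sup>2 / 2 \<le> (1/2 + Im k * norm x) * (cmod (q x))\<^sup>2"
      using k mult_right_mono[of "1/2" "1/2 + Im k * norm x" "(cmod (q x))\<^sup>2"] by simp
    moreover have "Re (g x * cnj (complex_of_real (norm x) * q x)) \<le> norm x * (cmod (g x) * cmod (q x))"
      using complex_Re_le_cmod[of "g x * cnj (complex_of_real (norm x) * q x)"] by (simp add: norm_mult mult_ac)
    ultimately show ?thesis by linarith
  qed
  \<comment> \<open>Both cases end in a pointwise inequality off the origin, up to a function of
    integral 0. Only the correction and the way to reach the inequality differ.\<close>
  have "\<exists>Y. integrable lborel Y \<and> (LINT x|lborel. Y x) = 0 \<and>
     (\<forall>x. x \<noteq> 0 \<longrightarrow> K * ((cmod (u x))\<^sup>2 / (norm x)\<^sup>2) + Y x \<le> (norm x)\<^sup>2 * (cmod (g x))\<^sup>2)"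
  proof (cases "DIM('a) = 3")
    case False
    have K: "K = m\<^sup>2 - m" using False by (simp add: K_def m_def power2_eq_square field_simps)
    have "K * ((cmod (u x))\<^sup>2 / (norm x)\<^sup>2) + 2 * Z x \<le> (norm x)\<^sup>2 * (cmod (g x))\<^sup>2" if "x \<noteq> 0" for x
    proof -
      have "(m\<^sup>2 - m) / 2 * (cmod (u x))\<^sup>2 / (norm x)\<^sup>2 = K * ((cmod (u x))\<^sup>2 / (norm x)\<^sup>2) / 2"
        by (simp add: K)
      moreover have "2 * (norm x * (cmod (g x) * cmod (q x))) \<le> (norm x)\<^sup>2 * (cmod (g x))\<^sup>2 + (cmod (q x))\<^sup>2"
        using sum_squares_bound[of "norm x * cmod (g x)" "cmod (q x)"] by (simp add: power_mult_distrib mult.assoc)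
      moreover have "c + 2 * z \<le> w" if "a = c / 2" "2 * p \<le> w + q" "q / 2 + a + z \<le> p" for a c p q w z :: real
        using that by linarith
      ultimately show ?thesis using main[OF that] by blast
    qed
    then show ?thesis using Z by (intro exI[of _ "\<lambda>x. 2 * Z x"]) auto
  next
    case True
    have m1: "m = 1" using True by (simp add: m_def)
    \<comment> \<open>Young's inequality twice: r |g| |q| <= r^2 |g|^2 + |q|^2 / 4 leaves |q|^2 / 4
      on the left, and s |q| <= |q|^2 + s^2 / 4 turns the Hardy step into s^2 / 4 <= |q|^2 up to a
      divergence. A quarter of the latter inserted into the former gives the 1/16.\<close>
    have "K * ((cmod (u x))\<^sup>2 / (norm x)\<^sup>2) + (Z x + 1/8 * V (-2) x) \<le> (norm x)\<^sup>2 * (cmod (g x))\<^sup>2" if x: "x \<noteq> 0" for x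
    proof -
      define s where "s = cmod (u x) / norm x"
      have r: "norm x > 0" using x by simp
      have "norm x * (cmod (g x) * cmod (q x)) \<le> (norm x)\<^sup>2 * (cmod (g x))\<^sup>2 + (cmod (q x))\<^sup>2 / 4"
        using sum_squares_bound[of "norm x * cmod (g x)" "cmod (q x) / 2"] by (simp add: power_mult_distrib power_divide)
      then have 1: "(cmod (q x))\<^sup>2 / 4 + Z x \<le> (norm x)\<^sup>2 * (cmod (g x))\<^sup>2"
        using main[OF x] m1 by simp
      \<comment> \<open>Hardy by testing q with u / r: the radial derivative contributes half of
        \<open>V (-2)\<close> minus half of s^2, and the term with m = 1 contributes the full s^2.
        The surplus s^2 / 2 is what remains after integration, together with a nonnegative term in
        Im k.\<close>
      have "Re (cnj (u x) * q x) / norm x = Re (cnj (u x) * radial u x) / (norm x)\<^sup>2 + Im k * (cmod (u x))\<^sup>2 / norm x + (cmod (u x))\<^sup>2 / (norm x)\<^sup>2"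
      proof -
        have "Re (cnj (u x) * q x) = Re (cnj (u x) * radial u x) / norm x + Im k * (cmod (u x))\<^sup>2 + (cmod (u x))\<^sup>2 / norm x"
          unfolding q_def m1 cmod_power2 using r
          by (simp add: field_simps power2_eq_square)
        then show ?thesis using r by (simp add: field_simps power2_eq_square)
      qed
      also have "\<dots> = 1/2 * s\<^sup>2 + 1/2 * V (-2) x + Im k * (cmod (u x))\<^sup>2 / norm x"
        unfolding V_def True s_def using r by (simp add: power_int_minus power_divide field_simps)
      finally have "1/2 * s\<^sup>2 + 1/2 * V (-2) x \<le> Re (cnj (u x) * q x) / norm x"
        using k r by simp
      also have "\<dots> \<le> cmod (cnj (u x) * q x) / norm x"
        by (intro divide_right_mono complex_Re_le_cmod) auto
      also have "\<dots> = s * cmod (q x)" by (simp add: s_def norm_mult)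
      also have "\<dots> \<le> (cmod (q x))\<^sup>2 + s\<^sup>2 / 4"
        using sum_squares_bound[of "cmod (q x)" "s / 2"] by (simp add: power_divide mult.commute)
      finally have "1/16 * s\<^sup>2 + 1/8 * V (-2) x \<le> (cmod (q x))\<^sup>2 / 4" by simp
      with 1 have "1/16 * s\<^sup>2 + (Z x + 1/8 * V (-2) x) \<le> (norm x)\<^sup>2 * (cmod (g x))\<^sup>2" by linarith
      then show ?thesis using True by (simp add: K_def s_def power_divide)
    qed
    then show ?thesis using Z V[of "-2"] by (intro exI[of _ "\<lambda>x. Z x + 1/8 * V (-2) x"]) auto
  qed
  then obtain Y where Y: "integrable lborel Y" "(LINT x|lborel. Y x) = 0"
     "\<And>x. x \<noteq> 0 \<Longrightarrow> K * ((cmod (u x))\<^sup>2 / (norm x)\<^sup>2) + Y x \<le> (norm x)\<^sup>2 * (cmod (g x))\<^sup>2" by blast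
  have "K * (LINT x|lborel. (cmod (u x))\<^sup>2 / (norm x)\<^sup>2) = (LINT x|lborel. K * ((cmod (u x))\<^sup>2 / (norm x)\<^sup>2) + Y x)"
    using Y(2) Bochner_Integration.integral_add[OF integrable_mult_right[OF int_u, of K] Y(1)]
    by (simp del: times_divide_eq_right)
  also have "\<dots> \<le> (LINT x|lborel. (norm x)\<^sup>2 * (cmod (g x))\<^sup>2)"
  proof (rule integral_mono_AE)
    show "AE x in lborel. K * ((cmod (u x))\<^sup>2 / (norm x)\<^sup>2) + Y x \<le> (norm x)\<^sup>2 * (cmod (g x))\<^sup>2"
      using AE_lborel_singleton[of 0] by eventually_elim (rule Y(3))
  qed (intro Bochner_Integration.integrable_add integrable_mult_right int_u Y(1) int_g)+
  finally show "K * (LINT x|lborel. (cmod (u x))\<^sup>2 / (norm x)\<^sup>2) \<le> (LINT x|lborel. (norm x)\<^sup>2 * (cmod (g x))\<^sup>2)" .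
qed

section \<open>The resolvent through complex heat kernels\<close>

text \<open>A quadratic remainder bound can be integrated directly, so every differentiation under
  the integral sign below goes through this criterion. The set \<open>S\<close> permits a bound that
  holds only near x.\<close>

lemma has_derivative_quadratic_error:
  fixes f :: "'a::real_normed_vector \<Rightarrow> 'b::real_normed_vector"
  assumes "bounded_linear D" and err: "\<And>v. x + v \<in> S \<Longrightarrow> norm (f (x + v) - f x - D v) \<le> C * (norm v)\<^sup>2"
  shows "(f has_derivative D) (at x within S)"
  unfolding has_derivative_iff_norm
proof (intro conjI assms(1))
  show "((\<lambda>y. norm (f y - f x - D (y - x)) / norm (y - x)) \<longlongrightarrow> 0) (at x within S)"
  proof (rule Lim_null_comparison)
    have "norm (norm (f y - f x - D (y - x)) / norm (y - x)) \<le> C * norm (y - x)" if y: "y \<in> S" "y \<noteq> x" for y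
    proof -
      have "norm (f y - f x - D (y - x)) \<le> C * (norm (y - x))\<^sup>2" using err[of "y - x"] y by simp
      then show ?thesis using y by (simp add: divide_le_eq power2_eq_square mult.assoc)
    qed
    then show "\<forall>\<^sub>F y in at x within S. norm (norm (f y - f x - D (y - x)) / norm (y - x)) \<le> C * norm (y - x)"
      by (auto simp: eventually_at_filter)
    have "((\<lambda>y. C * norm (y - x)) \<longlongrightarrow> C * norm (x - x)) (at x within S)" by (intro tendsto_intros)
    then show "((\<lambda>y. C * norm (y - x)) \<longlongrightarrow> 0) (at x within S)" by simp
  qed
qed

section \<open>Gaussian decay and the kernel of the transform\<close>

lemma exp_neg_square_decay:
  assumes "0 < (c::real)"
  obtains C where "0 \<le> C" "\<And>t. 0 \<le> t \<Longrightarrow> exp (- c * t\<^sup>2) \<le> C / (1 + t) ^ N"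
proof
  define n where "n = Suc N"
  \<comment> \<open>Large enough that 2 + t^2 <= A (1 + c t^2 / n); the n-th power of the bracket is
    at most exp (c t^2). Taking n one larger than N keeps it positive.\<close>
  define A where "A = max 2 (real n / c)"
  have A: "0 < A" "2 \<le> A" "real n / c \<le> A" by (auto simp: A_def)
  show "0 \<le> A ^ n" using A by simp
  fix t :: real assume t: "0 \<le> t"
  have n: "real n > 0" by (simp add: n_def)
  have "t \<le> 1 + t\<^sup>2" using sum_squares_bound[of t 1] t by (simp add: power2_eq_square)
  then have "1 + t \<le> 2 + t\<^sup>2" by simp
  also have "\<dots> \<le> A * (1 + c * t\<^sup>2 / real n)"
  proof -
    have "1 \<le> A * c / real n" using A(3) assms n by (simp add: field_simps)
    then have "1 * t\<^sup>2 \<le> A * c / real n * t\<^sup>2" by (intro mult_right_mono) auto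
    then show ?thesis using A(2) by (simp add: algebra_simps)
  qed
  finally have "(1 + t) ^ n \<le> (A * (1 + c * t\<^sup>2 / real n)) ^ n" using t by (intro power_mono) auto
  also have "\<dots> = A ^ n * (1 + c * t\<^sup>2 / real n) ^ n" by (simp add: power_mult_distrib)
  also have "\<dots> \<le> A ^ n * exp (c * t\<^sup>2)"
    using assms A n order_trans[of "- real n" 0 "c * t\<^sup>2"]
    by (intro mult_left_mono exp_ge_one_plus_x_over_n_power_n) (auto simp: n_def)
  finally have "(1 + t) ^ n \<le> A ^ n * exp (c * t\<^sup>2)" .
  moreover have "(1 + t) ^ N \<le> (1 + t) ^ n" using t by (intro power_increasing) (auto simp: n_def)
  ultimately have "(1 + t) ^ N \<le> A ^ n * exp (c * t\<^sup>2)" by linarith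
  moreover have "(1 + t) ^ N > 0" using t by simp
  ultimately show "exp (- c * t\<^sup>2) \<le> A ^ n / (1 + t) ^ N"
    by (simp add: exp_minus field_simps)
qed

text \<open>The heat kernel exp (-|y|^2 / (4 tau)) at the complex time tau = i / k, without its
  normalising factor. Its modulus decays exactly when Im k > 0.\<close>

definition gauss :: "complex \<Rightarrow> 'a::euclidean_space \<Rightarrow> complex" where
  "gauss k y = exp (\<i> * k * complex_of_real ((norm y)\<^sup>2) / 4)"

lemma norm_gauss: "norm (gauss k y) = exp (- (Im k / 4) * (norm y)\<^sup>2)"
  by (simp add: gauss_def)

lemma borel_measurable_gauss [measurable]: "gauss k \<in> borel_measurable borel"
  unfolding gauss_def by (intro borel_measurable_continuous_onI continuous_intros) auto

lemma integrable_gauss_weight: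
  assumes "Im k > 0"
  shows "integrable lborel (\<lambda>y::'a::euclidean_space. norm (gauss k y) * (1 + norm y) ^ N)"
proof -
  obtain C where C: "\<And>t. 0 \<le> t \<Longrightarrow> exp (- (Im k / 4) * t\<^sup>2) \<le> C / (1 + t) ^ (N + (DIM('a) + 2))"
    using exp_neg_square_decay[of "Im k / 4" "N + (DIM('a) + 2)"] assms by auto
  show ?thesis
  proof (rule integrable_decay[of _ C])
    fix y :: 'a
    have p: "1 + norm y > 0" by (simp add: add_pos_nonneg)
    have "norm (gauss k y) * (1 + norm y) ^ N \<le> C / (1 + norm y) ^ (N + (DIM('a) + 2)) * (1 + norm y) ^ N"
      unfolding norm_gauss by (intro mult_right_mono C) auto
    also have "\<dots> = C / (1 + norm y) ^ (DIM('a) + 2)" using p by (simp add: power_add)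
    finally show "norm (norm (gauss k y) * (1 + norm y) ^ N) \<le> C / (1 + norm y) ^ (DIM('a) + 2)" by simp
  qed measurable
qed

lemma integrable_gauss_bounded:
  fixes f :: "'a::euclidean_space \<Rightarrow> complex"
  assumes "Im k > 0" and [measurable]: "f \<in> borel_measurable borel" and f: "\<And>y. norm (f y) \<le> C * (1 + norm y) ^ N"
  shows "integrable lborel (\<lambda>y. gauss k y * f y)"
proof (rule Bochner_Integration.integrable_bound)
  show "integrable lborel (\<lambda>y::'a. C * (norm (gauss k y) * (1 + norm y) ^ N))"
    by (intro integrable_mult_right integrable_gauss_weight assms)
  show "AE y in lborel. norm (gauss k y * f y) \<le> norm (C * (norm (gauss k y) * (1 + norm y) ^ N))"
  proof (rule AE_I2)
    fix y :: 'a
    have "norm (gauss k y * f y) \<le> norm (gauss k y) * (C * (1 + norm y) ^ N)"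
      unfolding norm_mult by (intro mult_left_mono f) auto
    also have "\<dots> \<le> norm (C * (norm (gauss k y) * (1 + norm y) ^ N))" by (simp add: mult_ac abs_ge_self flip: abs_mult)
    finally show "norm (gauss k y * f y) \<le> norm (C * (norm (gauss k y) * (1 + norm y) ^ N))" .
  qed
qed measurable

lemma line_deriv_gauss:
  assumes "b \<in> Basis"
  shows "line_deriv b (gauss k) y (\<i> * k / 2 * complex_of_real (y \<bullet> b) * gauss k y)"
proof -
  have eq: "gauss k (y + t *\<^sub>R b) = exp (\<i> * k * complex_of_real ((norm y)\<^sup>2 + 2 * t * (y \<bullet> b) + t\<^sup>2) / 4)" for t
    using assms unfolding gauss_def power2_norm_eq_inner
    by (simp add: inner_add inner_commute power2_eq_square algebra_simps)
  have "((\<lambda>t. (norm y)\<^sup>2 + 2 * t * (y \<bullet> b) + t\<^sup>2) has_field_derivative 2 * (y \<bullet> b)) (at 0)"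
    by (auto intro!: derivative_eq_intros)
  then have "((\<lambda>t. complex_of_real ((norm y)\<^sup>2 + 2 * t * (y \<bullet> b) + t\<^sup>2)) has_vector_derivative complex_of_real (2 * (y \<bullet> b))) (at 0)"
    by (intro has_vector_derivative_of_real) (simp add: has_real_derivative_iff_has_vector_derivative)
  from has_vector_derivative_mult_right[OF this, of "\<i> * k / 4"]
  have D: "((\<lambda>t. \<i> * k * complex_of_real ((norm y)\<^sup>2 + 2 * t * (y \<bullet> b) + t\<^sup>2) / 4) has_vector_derivative
      \<i> * k / 4 * complex_of_real (2 * (y \<bullet> b))) (at 0)"
    by (simp add: mult_ac)
  from field_vector_diff_chain_at[OF D DERIV_exp]
  show ?thesis unfolding line_deriv_def eq by (simp add: o_def gauss_def mult_ac)
qed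

text \<open>Up to the constant i / k, this is exp (k^2 tau) times the derivative of tau = (i / k)
  l^2. The quadratic parametrisation gives Gaussian decay in l and lets the heat kernel at time tau
  become \<open>gauss k\<close> in the variable rescaled by l.\<close>

definition radial_weight :: "complex \<Rightarrow> real \<Rightarrow> complex" where
  "radial_weight k l = indicat_real {0<..} l *\<^sub>R (complex_of_real (2 * l) * exp (\<i> * k * complex_of_real (l\<^sup>2)))"

lemma borel_measurable_radial_weight [measurable]: "radial_weight k \<in> borel_measurable borel"
proof -
  have "(\<lambda>l. complex_of_real (2 * l) * exp (\<i> * k * complex_of_real (l\<^sup>2))) \<in> borel_measurable borel"
    by (intro borel_measurable_continuous_onI continuous_intros)
  then show ?thesis unfolding radial_weight_def by measurable
qed

lemma integrable_radial_weight:
  assumes k: "Im k > 0"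
  shows "integrable lborel (\<lambda>l. norm (radial_weight k l) * (1 + norm l) ^ N)"
proof -
  obtain C where C: "0 \<le> C" "\<And>t. 0 \<le> t \<Longrightarrow> exp (- Im k * t\<^sup>2) \<le> C / (1 + t) ^ (N + 1 + (DIM(real) + 2))"
    using exp_neg_square_decay[OF k, of "N + 1 + (DIM(real) + 2)"] by metis
  show ?thesis
  proof (rule integrable_decay[of _ "2 * C"])
    fix l :: real
    have p: "1 + norm l > 0" by (simp add: add_pos_nonneg)
    have "norm (radial_weight k l) \<le> 2 * (1 + norm l) * exp (- Im k * (norm l)\<^sup>2)"
      unfolding radial_weight_def by (auto simp: indicator_def norm_mult intro!: mult_right_mono)
    also have "\<dots> \<le> 2 * (1 + norm l) * (C / (1 + norm l) ^ (N + 1 + (DIM(real) + 2)))"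
      by (intro mult_left_mono C) auto
    finally have "norm (radial_weight k l) * (1 + norm l) ^ N \<le> 2 * (1 + norm l) * (C / (1 + norm l) ^ (N + 1 + (DIM(real) + 2))) * (1 + norm l) ^ N"
      by (intro mult_right_mono) auto
    also have "\<dots> = 2 * C / (1 + norm l) ^ (DIM(real) + 2)"
      using p by (simp only: power_add power_one_right) (simp add: divide_simps)
    finally show "norm (norm (radial_weight k l) * (1 + norm l) ^ N) \<le> 2 * C / (1 + norm l) ^ (DIM(real) + 2)" by simp
  qed measurable
qed

lemma integrable_lborel_pair_times:
  fixes a :: "'a::euclidean_space \<Rightarrow> real" and b :: "'b::euclidean_space \<Rightarrow> real"
  assumes a: "integrable lborel a" and b: "integrable lborel b"
  shows "integrable (lborel \<Otimes>\<^sub>M lborel) (\<lambda>p. a (fst p) * b (snd p))"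
proof (rule lborel_pair.Fubini_integrable)
  have [measurable]: "a \<in> borel_measurable borel" "b \<in> borel_measurable borel" using a b by auto
  show "(\<lambda>p. a (fst p) * b (snd p)) \<in> borel_measurable (lborel \<Otimes>\<^sub>M lborel)" by measurable
  have "(\<lambda>x. LINT y|lborel. norm (a (fst (x, y)) * b (snd (x, y)))) = (\<lambda>x. norm (a x) * (LINT y|lborel. norm (b y)))"
    by (simp add: abs_mult)
  then show "integrable lborel (\<lambda>x. LINT y|lborel. norm (a (fst (x, y)) * b (snd (x, y))))"
    using a by simp
  show "AE x in lborel. integrable lborel (\<lambda>y. a (fst (x, y)) * b (snd (x, y)))" using b by simp
qed

text \<open>A Peetre-type inequality: decay of a function at x - l y becomes decay at x, at the
  price of polynomial factors in l and y that the Gaussian weights absorb.\<close>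

lemma one_plus_norm_le: "1 + norm x \<le> (1 + norm (x - l *\<^sub>R y)) * ((1 + norm l) * (1 + norm y))"
  for l :: real and x y :: "'a::real_normed_vector"
proof -
  have "norm x \<le> norm (x - l *\<^sub>R y) + norm l * norm y"
    using norm_triangle_ineq[of "x - l *\<^sub>R y" "l *\<^sub>R y"] by simp
  moreover have "1 + n \<le> (1 + a) * ((1 + c) * (1 + d))" if "n \<le> a + c * d" "0 \<le> a" "0 \<le> c" "0 \<le> d" for n a c d :: real
  proof -
    have "0 \<le> a * (c + d + c * d)" using that by (intro mult_nonneg_nonneg add_nonneg_nonneg) auto
    then have "n \<le> (a + c * d) + c + d + a * (c + d + c * d)" using that by linarith
    then show ?thesis by (simp add: algebra_simps)
  qed
  ultimately show ?thesis by simp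
qed

text \<open>
  For \<open>Im k > 0\<close> this is a multiple of the resolvent at \<open>k\<^sup>2\<close>: it is the Laplace transform of the heat
  semigroup along the ray \<open>\<tau> = (\<i> / k) l\<^sup>2\<close>, on which both \<open>exp (k\<^sup>2 \<tau>)\<close> and the heat kernel decay.
  The heat kernel at time \<open>\<tau>\<close> is rescaled to \<open>\<tau> = \<i> / k\<close>.
\<close>

definition heat_transform :: "complex \<Rightarrow> ('a::euclidean_space \<Rightarrow> complex) \<Rightarrow> 'a \<Rightarrow> complex" where
  "heat_transform k h x = (LINT p|(lborel \<Otimes>\<^sub>M lborel). radial_weight k (fst p) * gauss k (snd p) * h (x - fst p *\<^sub>R snd p))"

context
  fixes k :: complex
  assumes k: "Im k > 0"
begin

text \<open>The modulus of the kernel with polynomial factors attached, an integrable majorant for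
  integrands of polynomial growth in both variables.\<close>

definition weight :: "nat \<Rightarrow> real \<times> 'a::euclidean_space \<Rightarrow> real" where
  "weight N p = (norm (radial_weight k (fst p)) * (1 + norm (fst p)) ^ N) * (norm (gauss k (snd p)) * (1 + norm (snd p)) ^ N)"

lemma integrable_weight: "integrable (lborel \<Otimes>\<^sub>M lborel) (weight N)"
  unfolding weight_def
  by (rule integrable_lborel_pair_times[OF integrable_radial_weight[OF k] integrable_gauss_weight[OF k]])

text \<open>The second bound is linear in C. Whatever smallness C carries, decay in x or the square
  of an increment, therefore passes unchanged to the transform.\<close>

lemma integrable_heat_kernel:
  fixes f :: "real \<times> 'a::euclidean_space \<Rightarrow> complex"
  assumes f[measurable]: "f \<in> borel_measurable (lborel \<Otimes>\<^sub>M lborel)"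
    and bd: "\<And>p. norm (f p) \<le> C * ((1 + norm (fst p)) * (1 + norm (snd p))) ^ N"
  shows "integrable (lborel \<Otimes>\<^sub>M lborel) (\<lambda>p. radial_weight k (fst p) * gauss k (snd p) * f p)" (is ?I)
    and "norm (LINT p|(lborel \<Otimes>\<^sub>M lborel). radial_weight k (fst p) * gauss k (snd p) * f p) \<le> C * integral\<^sup>L (lborel \<Otimes>\<^sub>M lborel) (weight N :: real \<times> 'a \<Rightarrow> real)"
proof -
  have le: "norm (radial_weight k (fst p) * gauss k (snd p) * f p) \<le> C * weight N p" for p
  proof -
    have "norm (radial_weight k (fst p) * gauss k (snd p) * f p) \<le> norm (radial_weight k (fst p) * gauss k (snd p)) * (C * ((1 + norm (fst p)) * (1 + norm (snd p))) ^ N)"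
      unfolding norm_mult[of _ "f p"] by (intro mult_left_mono bd) auto
    also have "\<dots> = C * weight N p" by (simp add: weight_def norm_mult power_mult_distrib mult_ac)
    finally show ?thesis .
  qed
  have int: "integrable (lborel \<Otimes>\<^sub>M lborel) (\<lambda>p. C * weight N p)" by (intro integrable_mult_right integrable_weight)
  have [measurable]: "radial_weight k \<in> borel_measurable lborel" "gauss k \<in> borel_measurable lborel" by simp_all
  show ?I
  proof (rule Bochner_Integration.integrable_bound[OF int])
    show "AE p in lborel \<Otimes>\<^sub>M lborel. norm (radial_weight k (fst p) * gauss k (snd p) * f p) \<le> norm (C * weight N p)"
      unfolding real_norm_def by (intro AE_I2 order_trans[OF le abs_ge_self])
  qed measurable
  have "norm (LINT p|(lborel \<Otimes>\<^sub>M lborel). radial_weight k (fst p) * gauss k (snd p) * f p) \<le> (LINT p|(lborel \<Otimes>\<^sub>M lborel). C * (weight N :: real \<times> 'a \<Rightarrow> real) p)"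
    by (rule Bochner_Integration.integral_norm_bound_integral[OF \<open>?I\<close> int]) (rule le)
  also have "\<dots> = C * integral\<^sup>L (lborel \<Otimes>\<^sub>M lborel) (weight N :: real \<times> 'a \<Rightarrow> real)" by simp
  finally show "norm (LINT p|(lborel \<Otimes>\<^sub>M lborel). radial_weight k (fst p) * gauss k (snd p) * f p) \<le> C * integral\<^sup>L (lborel \<Otimes>\<^sub>M lborel) (weight N :: real \<times> 'a \<Rightarrow> real)" .
qed

lemma measurable_shift:
  assumes "h \<in> borel_measurable borel"
  shows "(\<lambda>p. h (x - fst p *\<^sub>R snd p)) \<in> borel_measurable (lborel \<Otimes>\<^sub>M (lborel :: 'a::euclidean_space measure))"
  using assms by measurable

lemma integrable_heat_transform:
  fixes h :: "'a::euclidean_space \<Rightarrow> complex"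
  assumes h: "schwartz h"
  shows "integrable (lborel \<Otimes>\<^sub>M lborel) (\<lambda>p. radial_weight k (fst p) * gauss k (snd p) * h (x - fst p *\<^sub>R snd p))"
proof -
  obtain C where C: "\<And>x. norm (h x) \<le> C" using rapid_bounded[OF schwartz_rapid[OF h]] by metis
  show ?thesis
    by (rule integrable_heat_kernel[where C=C and N=0]) (use C measurable_shift[OF borel_measurable_schwartz[OF h]] in auto)
qed

lemma rapid_heat_transform:
  fixes h :: "'a::euclidean_space \<Rightarrow> complex"
  assumes h: "schwartz h" shows "rapid (heat_transform k h)"
  unfolding rapid_def
proof
  fix N
  obtain C where C: "0 \<le> C" "\<And>x. norm (h x) \<le> C / (1 + norm x) ^ N" using rapid_bound[OF schwartz_rapid[OF h]] by metis
  have "norm (heat_transform k h x) * (1 + norm x) ^ N \<le> C * integral\<^sup>L (lborel \<Otimes>\<^sub>M lborel) (weight N :: real \<times> 'a \<Rightarrow> real)" for x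
  proof -
    have p: "0 < (1 + norm x) ^ N" by (intro zero_less_power add_pos_nonneg) auto
    have "norm (heat_transform k h x) \<le> C / (1 + norm x) ^ N * integral\<^sup>L (lborel \<Otimes>\<^sub>M lborel) (weight N :: real \<times> 'a \<Rightarrow> real)"
      unfolding heat_transform_def
    proof (rule integrable_heat_kernel(2))
      fix p :: "real \<times> 'a"
      let ?y = "x - fst p *\<^sub>R snd p"
      have q: "0 < (1 + norm ?y) ^ N" by (intro zero_less_power add_pos_nonneg) auto
      have "(1 + norm x) ^ N \<le> ((1 + norm ?y) * ((1 + norm (fst p)) * (1 + norm (snd p)))) ^ N"
        by (intro power_mono one_plus_norm_le) auto
      then have "1 / (1 + norm ?y) ^ N \<le> ((1 + norm (fst p)) * (1 + norm (snd p))) ^ N / (1 + norm x) ^ N"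
        using p q by (simp add: power_mult_distrib divide_le_eq le_divide_eq mult_ac)
      then have "C * (1 / (1 + norm ?y) ^ N) \<le> C * (((1 + norm (fst p)) * (1 + norm (snd p))) ^ N / (1 + norm x) ^ N)"
        using C(1) by (rule mult_left_mono)
      then show "norm (h ?y) \<le> C / (1 + norm x) ^ N * ((1 + norm (fst p)) * (1 + norm (snd p))) ^ N"
        using C(2)[of ?y] by simp
    qed (rule measurable_shift[OF borel_measurable_schwartz[OF h]])
    then show ?thesis using p by (simp add: field_simps)
  qed
  then show "\<exists>C. \<forall>x. norm (heat_transform k h x) * (1 + norm x) ^ N \<le> C" by blast
qed

text \<open>The Taylor remainder of \<open>h\<close> is quadratic uniformly in the base point x - l
  y, hence still quadratic after integration against the kernel.\<close>

lemma has_derivative_heat_transform: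
  fixes h :: "'a::euclidean_space \<Rightarrow> complex"
  assumes h: "schwartz h"
  shows "(heat_transform k h has_derivative (\<lambda>v. \<Sum>b\<in>Basis. (v \<bullet> b) *\<^sub>R heat_transform k (pd b h) x)) (at x)"
proof -
  obtain C where C: "\<And>x v. norm (h (x + v) - h x - (\<Sum>b\<in>Basis. (v \<bullet> b) *\<^sub>R pd b h x)) \<le> C * (norm v)\<^sup>2"
    using schwartz_taylor[OF h] by metis
  show ?thesis
  proof (rule has_derivative_quadratic_error[where C = "C * integral\<^sup>L (lborel \<Otimes>\<^sub>M lborel) (weight 0 :: real \<times> 'a \<Rightarrow> real)"])
    show "bounded_linear (\<lambda>v. \<Sum>b\<in>Basis. (v \<bullet> b) *\<^sub>R heat_transform k (pd b h) x)"
      by (intro bounded_linear_sum bounded_linear_scaleR_const bounded_linear_inner_left)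
    fix v :: 'a
    let ?K = "\<lambda>p. radial_weight k (fst p) * gauss k (snd p)"
    let ?err = "\<lambda>x. h (x + v) - h x - (\<Sum>b\<in>Basis. (v \<bullet> b) *\<^sub>R pd b h x)"
    note int = integrable_heat_transform
    have intb: "integrable (lborel \<Otimes>\<^sub>M lborel) (\<lambda>p. (v \<bullet> b) *\<^sub>R (?K p * pd b h (x - fst p *\<^sub>R snd p)))" if "b \<in> Basis" for b
      using int[OF schwartz_pd[OF h that]] by (intro integrable_scaleR_right)
    have "heat_transform k h (x + v) - heat_transform k h x - (\<Sum>b\<in>Basis. (v \<bullet> b) *\<^sub>R heat_transform k (pd b h) x)
       = (LINT p|(lborel \<Otimes>\<^sub>M lborel). ?K p * h (x + v - fst p *\<^sub>R snd p) - ?K p * h (x - fst p *\<^sub>R snd p)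
           - (\<Sum>b\<in>Basis. (v \<bullet> b) *\<^sub>R (?K p * pd b h (x - fst p *\<^sub>R snd p))))"
      unfolding heat_transform_def using int[OF h] intb
      by (subst Bochner_Integration.integral_diff Bochner_Integration.integral_sum integral_scaleR_right | simp)+
    also have "\<dots> = (LINT p|(lborel \<Otimes>\<^sub>M lborel). ?K p * ?err (x - fst p *\<^sub>R snd p))"
      by (intro Bochner_Integration.integral_cong refl) (simp add: right_diff_distrib sum_distrib_left add_diff_eq algebra_simps)
    also have "norm \<dots> \<le> C * (norm v)\<^sup>2 * integral\<^sup>L (lborel \<Otimes>\<^sub>M lborel) (weight 0 :: real \<times> 'a \<Rightarrow> real)"
    proof (rule integrable_heat_kernel(2))
      have "?err \<in> borel_measurable borel"
      proof -
        have [measurable]: "h \<in> borel_measurable borel" "b \<in> Basis \<Longrightarrow> pd b h \<in> borel_measurable borel" for b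
          using h by (auto intro!: borel_measurable_schwartz schwartz_pd)
        show ?thesis by measurable
      qed
      then show "(\<lambda>p. ?err (x - fst p *\<^sub>R snd p)) \<in> borel_measurable (lborel \<Otimes>\<^sub>M lborel)"
        by (rule measurable_shift)
    qed (use C in auto)
    finally show "norm (heat_transform k h (x + v) - heat_transform k h x - (\<Sum>b\<in>Basis. (v \<bullet> b) *\<^sub>R heat_transform k (pd b h) x))
      \<le> C * integral\<^sup>L (lborel \<Otimes>\<^sub>M lborel) (weight 0 :: real \<times> 'a \<Rightarrow> real) * (norm v)\<^sup>2" by (simp add: mult_ac)
  qed
qed

lemma pd_heat_transform:
  assumes "schwartz h" "b \<in> Basis"
  shows "pd b (heat_transform k h) = heat_transform k (pd b h)"
proof
  fix x
  show "pd b (heat_transform k h) x = heat_transform k (pd b h) x"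
    using pd_eqI[OF has_derivative_heat_transform[OF assms(1)], of b x] sum_Basis_inner_scaleR[OF assms(2), of "\<lambda>b. heat_transform k (pd b h) x"]
    by simp
qed

text \<open>Derivatives fall on \<open>h\<close>, so the transforms of Schwartz functions form a
  class that differentiation does not leave.\<close>

lemma schwartz_heat_transform: assumes "schwartz h" shows "schwartz (heat_transform k h)"
proof (rule schwartz_coinduct[of _ "heat_transform k ` Collect schwartz"])
  show "heat_transform k h \<in> heat_transform k ` Collect schwartz" using assms by simp
  show "f differentiable (at x)" if "f \<in> heat_transform k ` Collect schwartz" for f x
    using that has_derivative_heat_transform by (auto simp: differentiable_def)
  show "rapid f" if "f \<in> heat_transform k ` Collect schwartz" for f
    using that rapid_heat_transform by auto
  show "pd b f \<in> heat_transform k ` Collect schwartz" if "f \<in> heat_transform k ` Collect schwartz" "b \<in> Basis" for f b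
    using that(1)
  proof
    fix g assume g: "f = heat_transform k g" "g \<in> Collect schwartz"
    then show ?thesis using pd_heat_transform[of g b] schwartz_pd[of g b] that(2) by simp
  qed
qed

end

section \<open>Linear operations on Schwartz functions\<close>

lemma schwartz_cmult: assumes "schwartz f" shows "schwartz (\<lambda>x. c * f x)"
proof (rule schwartz_coinduct[of _ "(\<lambda>f x. c * f x) ` Collect schwartz"])
  show "(\<lambda>x. c * f x) \<in> (\<lambda>f x. c * f x) ` Collect schwartz" using assms by auto
  show "g differentiable (at x)" if "g \<in> (\<lambda>f x. c * f x) ` Collect schwartz" for g x
    using that by (elim imageE) (simp add: differentiable_mult schwartz_differentiable)
  show "rapid g" if "g \<in> (\<lambda>f x. c * f x) ` Collect schwartz" for g
    using that by (elim imageE) (simp add: rapid_cmult schwartz_rapid)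
  show "pd b g \<in> (\<lambda>f x. c * f x) ` Collect schwartz" if g: "g \<in> (\<lambda>f x. c * f x) ` Collect schwartz" and b: "b \<in> Basis" for g b
  proof -
    obtain f where f: "g = (\<lambda>x. c * f x)" "schwartz f" using g by auto
    then have "pd b g = (\<lambda>x. c * pd b f x)" by (auto simp: pd_cmult schwartz_differentiable)
    then show ?thesis using schwartz_pd[OF f(2) b] by blast
  qed
qed

lemma pd_schwartz_cmult: "schwartz f \<Longrightarrow> pd b (\<lambda>x. c * f x) = (\<lambda>x. c * pd b f x)"
  by (auto simp: pd_cmult schwartz_differentiable)

lemma pd_schwartz_add: "schwartz f \<Longrightarrow> schwartz g \<Longrightarrow> pd b (\<lambda>x. f x + g x) = (\<lambda>x. pd b f x + pd b g x)"
  by (auto simp: pd_add schwartz_differentiable)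

lemma schwartz_add: assumes "schwartz f" "schwartz g" shows "schwartz (\<lambda>x. f x + g x)"
proof (rule schwartz_coinduct[of _ "{\<lambda>x. f x + g x |f g. schwartz f \<and> schwartz g}"])
  let ?F = "{\<lambda>x. f x + g x |f g. schwartz f \<and> schwartz g} :: ('a \<Rightarrow> complex) set"
  show "(\<lambda>x. f x + g x) \<in> ?F" using assms by blast
  show "h differentiable (at x)" if "h \<in> ?F" for h x
    using that by (elim CollectE exE conjE) (simp add: differentiable_add schwartz_differentiable)
  show "rapid h" if "h \<in> ?F" for h
    using that by (elim CollectE exE conjE) (simp add: rapid_add schwartz_rapid)
  show "pd b h \<in> ?F" if h: "h \<in> ?F" and b: "b \<in> Basis" for h b
  proof -
    obtain f g where f: "h = (\<lambda>x. f x + g x)" "schwartz f" "schwartz g" using h by blast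
    then have "pd b h = (\<lambda>x. pd b f x + pd b g x)" by (simp add: pd_schwartz_add)
    then show ?thesis using schwartz_pd[OF f(2) b] schwartz_pd[OF f(3) b] by blast
  qed
qed

lemma schwartz_zero: "schwartz (\<lambda>_. 0)"
  by (rule schwartz_coinduct[of _ "{\<lambda>_. 0}"]) (auto simp: pd_def rapid_zero)

lemma schwartz_sum: "finite I \<Longrightarrow> (\<And>i. i \<in> I \<Longrightarrow> schwartz (f i)) \<Longrightarrow> schwartz (\<lambda>x. \<Sum>i\<in>I. f i x)"
  by (induction rule: finite_induct) (auto intro: schwartz_zero schwartz_add)

lemma schwartz_lap: "schwartz f \<Longrightarrow> schwartz (lap f)"
  unfolding lap_def by (intro schwartz_sum schwartz_pd) auto

section \<open>The heat equation in the variable l\<close>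

lemma line_deriv_scaled:
  assumes f: "schwartz f" and b: "b \<in> Basis"
  shows "line_deriv b (\<lambda>y. f (x - l *\<^sub>R y)) y (- complex_of_real l * pd b f (x - l *\<^sub>R y))"
proof -
  have D: "((\<lambda>s. f ((x - l *\<^sub>R y) + s *\<^sub>R b)) has_vector_derivative pd b f (x - l *\<^sub>R y)) (at (- l * 0))"
    using line_deriv_pd[OF f b, of "x - l *\<^sub>R y"] by (simp add: line_deriv_def)
  have "((\<lambda>t. - l * t) has_vector_derivative - l) (at 0)" by (auto intro!: derivative_eq_intros)
  from vector_diff_chain_at[OF this D]
  show ?thesis by (simp add: line_deriv_def o_def algebra_simps scaleR_conv_of_real)
qed

text \<open>The inner integral of the heat transform at fixed l: up to normalisation, the heat
  evolution of \<open>h\<close> at time (i / k) l^2.\<close>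

definition gauss_average :: "complex \<Rightarrow> ('a::euclidean_space \<Rightarrow> complex) \<Rightarrow> 'a \<Rightarrow> real \<Rightarrow> complex" where
  "gauss_average k h x l = (LINT y|lborel. gauss k y * h (x - l *\<^sub>R y))"

context
  fixes k :: complex
  assumes k: "Im k > 0"
begin

lemma integrable_gauss_average:
  fixes h :: "'a::euclidean_space \<Rightarrow> complex"
  assumes h: "schwartz h"
  shows "integrable lborel (\<lambda>y. gauss k y * h (x - l *\<^sub>R y))"
    and "b \<in> Basis \<Longrightarrow> integrable lborel (\<lambda>y. gauss k y * (complex_of_real (y \<bullet> b) * h (x - l *\<^sub>R y)))"
proof -
  have [measurable]: "h \<in> borel_measurable borel" by (rule borel_measurable_schwartz[OF h])
  obtain C where C: "0 \<le> C" "\<And>x. norm (h x) \<le> C" using rapid_bounded[OF schwartz_rapid[OF h]] by metis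
  show "integrable lborel (\<lambda>y. gauss k y * h (x - l *\<^sub>R y))"
    by (rule integrable_gauss_bounded[OF k, where C=C and N=0]) (use C in auto)
  show "integrable lborel (\<lambda>y. gauss k y * (complex_of_real (y \<bullet> b) * h (x - l *\<^sub>R y)))" if b: "b \<in> Basis"
  proof (rule integrable_gauss_bounded[OF k, where C=C and N=1])
    fix y :: 'a
    have "\<bar>y \<bullet> b\<bar> * norm (h (x - l *\<^sub>R y)) \<le> (1 + norm y) * C"
      using Basis_le_norm[OF b, of y] C by (intro mult_mono) auto
    then show "norm (complex_of_real (y \<bullet> b) * h (x - l *\<^sub>R y)) \<le> C * (1 + norm y) ^ 1"
      by (simp add: norm_mult mult.commute)
  qed measurable
qed

text \<open>A coordinate of y times the Gaussian is 2 / (i k) times a derivative of the Gaussian;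
  moving that derivative onto \<open>h (x - l y)\<close> produces the factor l.\<close>

lemma gauss_average_by_parts:
  fixes h :: "'a::euclidean_space \<Rightarrow> complex"
  assumes h: "schwartz h" and d: "DIM('a) \<ge> 2" and b: "b \<in> Basis"
  shows "(LINT y|lborel. gauss k y * (complex_of_real (y \<bullet> b) * h (x - l *\<^sub>R y))) = - (2 * \<i> * complex_of_real l / k) * gauss_average k (pd b h) x l"
proof -
  note int = integrable_gauss_average
  have "(LINT y|lborel. gauss k y * (- complex_of_real l * pd b h (x - l *\<^sub>R y)) + (\<i> * k / 2 * complex_of_real (y \<bullet> b) * gauss k y) * h (x - l *\<^sub>R y)) = 0"
  proof (rule integral_line_derivative_eq_0[OF d b int(1)[OF h]])
    have "integrable lborel (\<lambda>y. - complex_of_real l * (gauss k y * pd b h (x - l *\<^sub>R y)) + \<i> * k / 2 * (gauss k y * (complex_of_real (y \<bullet> b) * h (x - l *\<^sub>R y))))"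
      using int(1)[OF schwartz_pd[OF h b]] int(2)[OF h b] by (intro Bochner_Integration.integrable_add integrable_mult_right)
    then show "integrable lborel (\<lambda>y. gauss k y * (- complex_of_real l * pd b h (x - l *\<^sub>R y)) + (\<i> * k / 2 * complex_of_real (y \<bullet> b) * gauss k y) * h (x - l *\<^sub>R y))"
      by (simp add: mult_ac)
    show "((\<lambda>t. gauss k (y + t *\<^sub>R b) * h (x - l *\<^sub>R (y + t *\<^sub>R b))) has_vector_derivative
       gauss k y * (- complex_of_real l * pd b h (x - l *\<^sub>R y)) + (\<i> * k / 2 * complex_of_real (y \<bullet> b) * gauss k y) * h (x - l *\<^sub>R y)) (at 0)" for y
      using line_deriv_mult[OF line_deriv_gauss[OF b] line_deriv_scaled[OF h b]] unfolding line_deriv_def .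
  qed
  also have "(\<lambda>y. gauss k y * (- complex_of_real l * pd b h (x - l *\<^sub>R y)) + (\<i> * k / 2 * complex_of_real (y \<bullet> b) * gauss k y) * h (x - l *\<^sub>R y))
     = (\<lambda>y. - complex_of_real l * (gauss k y * pd b h (x - l *\<^sub>R y)) + \<i> * k / 2 * (gauss k y * (complex_of_real (y \<bullet> b) * h (x - l *\<^sub>R y))))"
    by (auto simp: mult_ac)
  finally have "- complex_of_real l * gauss_average k (pd b h) x l + \<i> * k / 2 * (LINT y|lborel. gauss k y * (complex_of_real (y \<bullet> b) * h (x - l *\<^sub>R y))) = 0"
    using int(1)[OF schwartz_pd[OF h b]] int(2)[OF h b]
    by (subst (asm) Bochner_Integration.integral_add) (auto simp: gauss_average_def)
  moreover have "k \<noteq> 0" using k by auto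
  moreover have "I = - (2 * \<i> * a / c) * G" if "- a * G + \<i> * c / 2 * I = 0" "c \<noteq> 0" for I G a c :: complex
  proof -
    have "I = - (2 * \<i> / c) * (\<i> * c / 2 * I)" using that(2) by simp
    also have "\<i> * c / 2 * I = a * G" using that(1) by algebra
    finally show ?thesis by simp
  qed
  ultimately show ?thesis by blast
qed

lemma gauss_average_lap:
  fixes h :: "'a::euclidean_space \<Rightarrow> complex"
  assumes "schwartz h"
  shows "gauss_average k (lap h) x l = (\<Sum>b\<in>Basis. gauss_average k (pd b (pd b h)) x l)"
  unfolding gauss_average_def lap_def sum_distrib_left
  by (intro Bochner_Integration.integral_sum integrable_gauss_average schwartz_pd assms)

text \<open>The heat equation: for tau = (i / k) l^2 the factor 2 i l / k is d tau / d l, and the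
  derivative in tau is the Laplacian. Differentiation in l brings down coordinates of y, which
  integration by parts converts into second derivatives.\<close>

lemma has_vector_derivative_gauss_average:
  fixes h :: "'a::euclidean_space \<Rightarrow> complex"
  assumes h: "schwartz h" and d: "DIM('a) \<ge> 2"
  shows "(gauss_average k h x has_vector_derivative (2 * \<i> * complex_of_real l / k * gauss_average k (lap h) x l)) (at l)"
proof -
  let ?D = "\<Sum>b\<in>Basis. - (LINT y|lborel. gauss k y * (complex_of_real (y \<bullet> b) * pd b h (x - l *\<^sub>R y)))"
  obtain C where C: "0 \<le> C" "\<And>x v. norm (h (x + v) - h x - (\<Sum>b\<in>Basis. (v \<bullet> b) *\<^sub>R pd b h x)) \<le> C * (norm v)\<^sup>2"
    using schwartz_taylor[OF h] by metis
  note int = integrable_gauss_average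
  have "(gauss_average k h x has_derivative (\<lambda>s. s *\<^sub>R ?D)) (at l)"
  proof (rule has_derivative_quadratic_error[where C = "C * (LINT y|lborel. norm (gauss k (y::'a)) * (1 + norm y) ^ 2)"])
    show "bounded_linear (\<lambda>s. s *\<^sub>R ?D)" by (rule bounded_linear_scaleR_left)
    fix s :: real
    let ?err = "\<lambda>y. h (x - l *\<^sub>R y + (- s) *\<^sub>R y) - h (x - l *\<^sub>R y) - (\<Sum>b\<in>Basis. (((- s) *\<^sub>R y) \<bullet> b) *\<^sub>R pd b h (x - l *\<^sub>R y))"
    have intb: "integrable lborel (\<lambda>y. (- complex_of_real s) * (gauss k y * (complex_of_real (y \<bullet> b) * pd b h (x - l *\<^sub>R y))))" if "b \<in> Basis" for b
      using int(2)[OF schwartz_pd[OF h that] that] by (intro integrable_mult_right)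
    have err: "gauss k y * ?err y = gauss k y * h (x - (l + s) *\<^sub>R y) - gauss k y * h (x - l *\<^sub>R y)
          - (\<Sum>b\<in>Basis. (- complex_of_real s) * (gauss k y * (complex_of_real (y \<bullet> b) * pd b h (x - l *\<^sub>R y))))" for y
    proof -
      have 1: "x - l *\<^sub>R y + (- s) *\<^sub>R y = x - (l + s) *\<^sub>R y" by (simp add: algebra_simps)
      have 2: "gauss k y * (\<Sum>b\<in>Basis. (((- s) *\<^sub>R y) \<bullet> b) *\<^sub>R pd b h (x - l *\<^sub>R y)) = (\<Sum>b\<in>Basis. (- complex_of_real s) * (gauss k y * (complex_of_real (y \<bullet> b) * pd b h (x - l *\<^sub>R y))))"
        unfolding sum_distrib_left by (intro sum.cong refl) (simp add: scaleR_conv_of_real mult_ac)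
      show ?thesis unfolding 1 right_diff_distrib 2 ..
    qed
    have int_err: "integrable lborel (\<lambda>y. gauss k y * ?err y)"
      unfolding err using int(1)[OF h] intb by (intro Bochner_Integration.integrable_diff Bochner_Integration.integrable_sum)
    have "gauss_average k h x (l + s) - gauss_average k h x l - s *\<^sub>R ?D = (LINT y|lborel. gauss k y * ?err y)"
      unfolding err using int(1)[OF h] intb int(2)[OF schwartz_pd[OF h]]
      by (simp add: Bochner_Integration.integral_diff Bochner_Integration.integral_sum gauss_average_def sum_negf scaleR_conv_of_real sum_distrib_left)
    also have "norm \<dots> \<le> (LINT y|lborel. C * s\<^sup>2 * (norm (gauss k (y::'a)) * (1 + norm y) ^ 2))"
    proof (rule Bochner_Integration.integral_norm_bound_integral[OF int_err])
      show "integrable lborel (\<lambda>y::'a. C * s\<^sup>2 * (norm (gauss k y) * (1 + norm y) ^ 2))"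
        by (intro integrable_mult_right integrable_gauss_weight k)
      fix y :: 'a
      have "norm (?err y) \<le> C * (norm ((- s) *\<^sub>R y))\<^sup>2" by (rule C(2))
      also have "\<dots> = C * s\<^sup>2 * (norm y)\<^sup>2" by (simp add: power_mult_distrib)
      also have "\<dots> \<le> C * s\<^sup>2 * (1 + norm y)\<^sup>2" using C(1) by (intro mult_left_mono power_mono) auto
      finally have "norm (gauss k y) * norm (?err y) \<le> norm (gauss k y) * (C * s\<^sup>2 * (1 + norm y)\<^sup>2)"
        by (intro mult_left_mono) auto
      then show "norm (gauss k y * ?err y) \<le> C * s\<^sup>2 * (norm (gauss k y) * (1 + norm y) ^ 2)"
        by (simp only: norm_mult mult_ac)
    qed
    also have "\<dots> = C * (LINT y|lborel. norm (gauss k (y::'a)) * (1 + norm y) ^ 2) * (norm s)\<^sup>2"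
      by simp
    finally show "norm (gauss_average k h x (l + s) - gauss_average k h x l - s *\<^sub>R ?D) \<le> C * (LINT y|lborel. norm (gauss k (y::'a)) * (1 + norm y) ^ 2) * (norm s)\<^sup>2" .
  qed
  moreover have "?D = 2 * \<i> * complex_of_real l / k * gauss_average k (lap h) x l"
    unfolding gauss_average_lap[OF h] sum_distrib_left
    by (intro sum.cong refl) (simp add: gauss_average_by_parts[OF schwartz_pd[OF h] d])
  ultimately show ?thesis unfolding has_vector_derivative_def by simp
qed

text \<open>That the bound is uniform in l lets the factor exp (i k l^2) annihilate the boundary
  term at infinity.\<close>

lemma norm_gauss_average_le:
  fixes h :: "'a::euclidean_space \<Rightarrow> complex"
  assumes h: "schwartz h"
  obtains M where "\<And>l. norm (gauss_average k h x l) \<le> M"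
proof -
  obtain C where C: "0 \<le> C" "\<And>x. norm (h x) \<le> C" using rapid_bounded[OF schwartz_rapid[OF h]] by metis
  have "norm (gauss_average k h x l) \<le> (LINT y|lborel. norm (gauss k (y::'a)) * C)" for l
    unfolding gauss_average_def
  proof (rule Bochner_Integration.integral_norm_bound_integral[OF integrable_gauss_average(1)[OF h]])
    show "integrable lborel (\<lambda>y::'a. norm (gauss k y) * C)"
      using integrable_gauss_weight[OF k, of 0, where 'a='a] by (intro integrable_mult_left) simp
    show "norm (gauss k y * h (x - l *\<^sub>R y)) \<le> norm (gauss k y) * C" for y :: 'a
      unfolding norm_mult by (intro mult_left_mono C(2)) auto
  qed
  then show ?thesis by (rule that)
qed

text \<open>By the heat equation the integrand in l is -i k times the derivative of exp (i k l^2)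
  \<open>gauss_average k h x l\<close>. The integral reduces to boundary terms: infinity contributes
  0, and l = 0 contributes the Gaussian integral times \<open>h x\<close>.\<close>

lemma heat_transform_inverse:
  fixes h :: "'a::euclidean_space \<Rightarrow> complex"
  assumes h: "schwartz h" and d: "DIM('a) \<ge> 2"
  shows "heat_transform k (\<lambda>x. lap h x + k\<^sup>2 * h x) x = \<i> * k * (LINT y|lborel. gauss k (y::'a)) * h x"
proof -
  let ?P = "gauss_average k h x" and ?Q = "gauss_average k (lap h) x"
  let ?f = "\<lambda>x. lap h x + k\<^sup>2 * h x"
  have k0: "k \<noteq> 0" using k by auto
  have lh: "schwartz (lap h)" by (rule schwartz_lap[OF h])
  have f: "schwartz ?f" by (intro schwartz_add schwartz_cmult lh h)
  define F where "F l = exp (\<i> * k * complex_of_real (l\<^sup>2)) * ?P l" for l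
  define F' where "F' l = \<i> / k * (complex_of_real (2 * l) * exp (\<i> * k * complex_of_real (l\<^sup>2)) * (?Q l + k\<^sup>2 * ?P l))" for l
  have DF: "(F has_vector_derivative F' l) (at l)" for l
  proof -
    have "((\<lambda>l. l\<^sup>2) has_field_derivative 2 * l) (at l)" by (auto intro!: derivative_eq_intros)
    then have "((\<lambda>l. complex_of_real (l\<^sup>2)) has_vector_derivative complex_of_real (2 * l)) (at l)"
      by (intro has_vector_derivative_of_real) (simp add: has_real_derivative_iff_has_vector_derivative)
    from field_vector_diff_chain_at[OF has_vector_derivative_mult_right[OF this, of "\<i> * k"] DERIV_exp]
    have "((\<lambda>l. exp (\<i> * k * complex_of_real (l\<^sup>2))) has_vector_derivative \<i> * k * complex_of_real (2 * l) * exp (\<i> * k * complex_of_real (l\<^sup>2))) (at l)"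
      by (simp add: o_def)
    from has_vector_derivative_mult[OF this has_vector_derivative_gauss_average[OF h d]]
    have "(F has_vector_derivative exp (\<i> * k * complex_of_real (l\<^sup>2)) * (2 * \<i> * complex_of_real l / k * ?Q l) + \<i> * k * complex_of_real (2 * l) * exp (\<i> * k * complex_of_real (l\<^sup>2)) * ?P l) (at l)"
      unfolding F_def .
    also have "exp (\<i> * k * complex_of_real (l\<^sup>2)) * (2 * \<i> * complex_of_real l / k * ?Q l) + \<i> * k * complex_of_real (2 * l) * exp (\<i> * k * complex_of_real (l\<^sup>2)) * ?P l = F' l"
      unfolding F'_def using k0 by (simp add: field_simps power2_eq_square)
    finally show ?thesis .
  qed
  have cont: "isCont F' l" for l
    unfolding F'_def
    by (intro continuous_intros has_vector_derivative_continuous[OF has_vector_derivative_gauss_average[OF h d]] has_vector_derivative_continuous[OF has_vector_derivative_gauss_average[OF lh d]])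
  have slice: "(LINT y|lborel. radial_weight k l * gauss k y * ?f (x - l *\<^sub>R y)) = indicat_real {0<..} l *\<^sub>R (- \<i> * k * F' l)" for l
  proof -
    have "(LINT y|lborel. radial_weight k l * gauss k y * ?f (x - l *\<^sub>R y)) = radial_weight k l * (LINT y|lborel. gauss k y * lap h (x - l *\<^sub>R y) + k\<^sup>2 * (gauss k y * h (x - l *\<^sub>R y)))"
      by (subst integral_mult_right_zero[symmetric]) (simp add: algebra_simps)
    also have "\<dots> = radial_weight k l * (?Q l + k\<^sup>2 * ?P l)"
      using integrable_gauss_average(1)[OF lh, of x l] integrable_gauss_average(1)[OF h, of x l] by (simp add: gauss_average_def)
    also have "\<dots> = indicat_real {0<..} l *\<^sub>R (- \<i> * k * F' l)"
      using k0 by (simp add: radial_weight_def F'_def)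
    finally show ?thesis .
  qed
  have int: "integrable (lborel \<Otimes>\<^sub>M lborel) (\<lambda>p. radial_weight k (fst p) * gauss k (snd p) * ?f (x - fst p *\<^sub>R snd p))"
    by (rule integrable_heat_transform[OF k f])
  have eq: "heat_transform k ?f x = (LINT l|lborel. indicat_real {0<..} l *\<^sub>R (- \<i> * k * F' l))"
    unfolding heat_transform_def lborel_pair.integral_fst'[OF int, symmetric] using slice by simp
  \<comment> \<open>Integrability on the half-line, required by the fundamental theorem there, is
    inherited from the double integral by Fubini.\<close>
  have "integrable lborel (\<lambda>l. indicat_real {0<..} l *\<^sub>R (- \<i> * k * F' l))"
    using lborel_pair.integrable_fst'[OF int] slice by simp
  then have "integrable lborel (\<lambda>l. (\<i> / k) * (indicat_real {0<..} l *\<^sub>R (- \<i> * k * F' l)))" by (rule integrable_mult_right)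
  also have "(\<lambda>l. (\<i> / k) * (indicat_real {0<..} l *\<^sub>R (- \<i> * k * F' l))) = (\<lambda>l. indicat_real {0<..} l *\<^sub>R F' l)"
    using k0 by (auto simp: fun_eq_iff)
  finally have intF': "set_integrable lborel (einterval 0 \<infinity>) F'"
    by (simp add: set_integrable_def einterval_eq_Ici zero_ereal_def)
  have "(LBINT l=0..\<infinity>. F' l) = 0 - F 0"
  proof (rule interval_integral_FTC_integrable[OF _ DF cont intF'])
    show "((F \<circ> real_of_ereal) \<longlongrightarrow> F 0) (at_right 0)"
    proof -
      have "(F \<longlongrightarrow> F 0) (at_right 0)"
        using has_vector_derivative_continuous[OF DF[of 0]] by (auto simp: continuous_at intro: tendsto_within_subset)
      then show ?thesis by (simp add: zero_ereal_def ereal_tendsto_simps)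
    qed
    obtain M where M: "\<And>l. norm (?P l) \<le> M" using norm_gauss_average_le[OF h] by blast
    obtain C where C: "0 \<le> C" "\<And>t. 0 \<le> t \<Longrightarrow> exp (- Im k * t\<^sup>2) \<le> C / (1 + t)"
      using exp_neg_square_decay[OF k, of 1] by auto
    have "(F \<longlongrightarrow> 0) at_top"
    proof (rule Lim_null_comparison)
      show "\<forall>\<^sub>F l in at_top. norm (F l) \<le> C / (1 + l) * M"
        using eventually_ge_at_top[of 0]
      proof eventually_elim
        case (elim l)
        have "norm (F l) = exp (- Im k * l\<^sup>2) * norm (?P l)" by (simp add: F_def norm_mult)
        also have "\<dots> \<le> C / (1 + l) * M"
          using M[of l] C(1) C(2)[OF elim] elim by (intro mult_mono) auto
        finally show ?case .
      qed
      have "((\<lambda>l::real. C / (1 + l)) \<longlongrightarrow> 0) at_top"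
        by (intro tendsto_divide_0[OF tendsto_const] filterlim_at_top_imp_at_infinity
            filterlim_tendsto_add_at_top[OF tendsto_const filterlim_ident])
      from tendsto_mult_left_zero[OF this]
      show "((\<lambda>l. C / (1 + l) * M) \<longlongrightarrow> 0) at_top" .
    qed
    then show "((F \<circ> real_of_ereal) \<longlongrightarrow> 0) (at_left \<infinity>)" by (simp add: ereal_tendsto_simps)
  qed simp
  then have "(LINT l|lborel. indicat_real {0<..} l *\<^sub>R F' l) = - F 0"
    by (simp add: interval_lebesgue_integral_def einterval_eq_Ici zero_ereal_def set_lebesgue_integral_def)
  moreover have "heat_transform k ?f x = - \<i> * k * (LINT l|lborel. indicat_real {0<..} l *\<^sub>R F' l)"
    unfolding eq by (subst integral_mult_right_zero[symmetric]) simp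
  moreover have "F 0 = (LINT y|lborel. gauss k (y::'a)) * h x"
    by (simp add: F_def gauss_average_def)
  ultimately show ?thesis by simp
qed

end

section \<open>The Gaussian integral does not vanish\<close>

lemma gauss_moment:
  assumes k: "Im k > 0" and d: "DIM('a::euclidean_space) \<ge> 2"
  shows "integrable lborel (\<lambda>y::'a. gauss k y * complex_of_real ((norm y)\<^sup>2))"
    and "k * (LINT y|lborel. gauss k (y::'a) * complex_of_real ((norm y)\<^sup>2)) = 2 * \<i> * of_nat DIM('a) * (LINT y|lborel. gauss k (y::'a))"
proof -
  define h where "h b y = complex_of_real (y \<bullet> b) * gauss k y" for b y :: 'a
  define h' where "h' b y = complex_of_real (y \<bullet> b) * (\<i> * k / 2 * complex_of_real (y \<bullet> b) * gauss k y) + complex_of_real (b \<bullet> b) * gauss k y" for b y :: 'a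
  have i0: "integrable lborel (gauss k :: 'a \<Rightarrow> complex)"
    using integrable_gauss_bounded[OF k, of "\<lambda>_. 1" 1 0] by simp
  show i2: "integrable lborel (\<lambda>y::'a. gauss k y * complex_of_real ((norm y)\<^sup>2))"
  proof (rule integrable_gauss_bounded[OF k, of _ 1 2])
    show "norm (complex_of_real ((norm y)\<^sup>2)) \<le> 1 * (1 + norm y) ^ 2" for y :: 'a
      by (simp add: norm_power power_mono)
  qed measurable
  have ib: "integrable lborel (\<lambda>y::'a. gauss k y * complex_of_real ((y \<bullet> b)\<^sup>2))" if "b \<in> Basis" for b
  proof (rule integrable_gauss_bounded[OF k, of _ 1 2])
    show "norm (complex_of_real ((y \<bullet> b)\<^sup>2)) \<le> 1 * (1 + norm y) ^ 2" for y :: 'a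
      using Basis_le_norm[OF that, of y] by (simp add: norm_power power2_le_iff_abs_le)
  qed measurable
  \<comment> \<open>The divergence of y \<open>gauss k y\<close>: differentiating the Gaussian gives
    the second moment, differentiating y gives the dimension.\<close>
  define F where "F y = \<i> * k / 2 * (gauss k y * complex_of_real ((norm y)\<^sup>2)) + of_nat DIM('a) * gauss k y" for y :: 'a
  have "integrable lborel F \<and> (LINT y|lborel. F y) = 0"
  proof (rule integral_divergence_eq_0[of h h'])
    show "integrable lborel (h b)" if b: "b \<in> Basis" for b
    proof -
      have "integrable lborel (\<lambda>y::'a. gauss k y * complex_of_real (y \<bullet> b))"
      proof (rule integrable_gauss_bounded[OF k, of _ 1 1])
        show "norm (complex_of_real (y \<bullet> b)) \<le> 1 * (1 + norm y) ^ 1" for y :: 'a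
          using Basis_le_norm[OF b, of y] by simp
      qed measurable
      then show ?thesis unfolding h_def by (simp add: mult.commute)
    qed
    show "integrable lborel (h' b)" if b: "b \<in> Basis" for b
    proof -
      have "integrable lborel (\<lambda>y::'a. \<i> * k / 2 * (gauss k y * complex_of_real ((y \<bullet> b)\<^sup>2)) + complex_of_real (b \<bullet> b) * gauss k y)"
        by (intro Bochner_Integration.integrable_add integrable_mult_right ib b i0)
      then show ?thesis unfolding h'_def by (simp add: power2_eq_square mult_ac)
    qed
    show "line_deriv b (h b) y (h' b y)" if "b \<in> Basis" for b y
      unfolding h_def h'_def by (intro line_deriv_mult line_deriv_inner line_deriv_gauss that)
    show "F y = (\<Sum>b\<in>Basis. h' b y)" for y
    proof -
      have "(\<Sum>b\<in>Basis. h' b y) = (\<Sum>b\<in>Basis. \<i> * k / 2 * gauss k y * complex_of_real ((y \<bullet> b)\<^sup>2) + gauss k y)"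
        unfolding h'_def by (intro sum.cong) (auto simp: power2_eq_square)
      then show ?thesis
        unfolding F_def sum_inner_square[symmetric] by (simp add: sum.distrib sum_distrib_left mult_ac)
    qed
    show "F \<in> borel_measurable borel" unfolding F_def by measurable
  qed (rule d)
  then have "\<i> * k / 2 * (LINT y|lborel. gauss k (y::'a) * complex_of_real ((norm y)\<^sup>2)) + of_nat DIM('a) * (LINT y|lborel. gauss k (y::'a)) = 0"
    unfolding F_def using i0 i2 by (subst (asm) Bochner_Integration.integral_add) auto
  moreover have "c * I = 2 * \<i> * a * J" if "\<i> * c / 2 * I + a * J = 0" for a c I J :: complex
  proof -
    have "\<i> * c * I = - (2 * a * J)" using that by (simp add: add_eq_0_iff2 field_simps)
    then have "\<i> * (\<i> * c * I) = \<i> * - (2 * a * J)" by simp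
    then show ?thesis by (simp add: mult.assoc[symmetric])
  qed
  ultimately show "k * (LINT y|lborel. gauss k (y::'a) * complex_of_real ((norm y)\<^sup>2)) = 2 * \<i> * of_nat DIM('a) * (LINT y|lborel. gauss k (y::'a))"
    by blast
qed

text \<open>Differentiation in t brings down i w |y|^2 / 4. A real parameter along a line is enough,
  because the integral is only going to be compared at the two ends of a segment.\<close>

lemma has_vector_derivative_gauss_integral:
  fixes k w :: complex and t :: real
  defines "\<kappa> \<equiv> \<lambda>t. k + complex_of_real t * w"
  assumes k: "Im (\<kappa> t) > 0"
    and int2: "integrable lborel (\<lambda>y::'a::euclidean_space. gauss (\<kappa> t) y * complex_of_real ((norm y)\<^sup>2))"
  shows "((\<lambda>t. LINT y|lborel. gauss (\<kappa> t) (y::'a)) has_vector_derivative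
    (\<i> * w / 4 * (LINT y|lborel. gauss (\<kappa> t) (y::'a) * complex_of_real ((norm y)\<^sup>2)))) (at t)"
proof -
  let ?D = "\<i> * w / 4 * (LINT y|lborel. gauss (\<kappa> t) (y::'a) * complex_of_real ((norm y)\<^sup>2))"
  define \<beta> where "\<beta> = Im (\<kappa> t)"
  \<comment> \<open>Small enough that |s| |w| <= beta / 2. The exponential in the Taylor remainder
    then grows at most like exp (beta |y|^2 / 8), against a Gaussian that decays like exp (-beta
    |y|^2 / 4); their product is the Gaussian with parameter \<open>q\<close>, which serves as
    majorant.\<close>
  define \<epsilon> where "\<epsilon> = \<beta> / (2 * (1 + norm w))"
  have pw: "0 < 1 + norm w" by (simp add: add_pos_nonneg)
  have \<epsilon>: "\<epsilon> > 0" using k pw by (simp add: \<epsilon>_def \<beta>_def)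
  define q where "q = \<i> * complex_of_real (\<beta> / 2)"
  have q: "Im q > 0" using k by (simp add: q_def \<beta>_def)
  let ?M = "(norm w)\<^sup>2 * (LINT y|lborel. norm (gauss q (y::'a)) * (1 + norm y) ^ 4)"
  have "((\<lambda>t. LINT y|lborel. gauss (\<kappa> t) (y::'a)) has_derivative (\<lambda>s. s *\<^sub>R ?D)) (at t within ball t \<epsilon>)"
  proof (rule has_derivative_quadratic_error[where C = ?M])
    show "bounded_linear (\<lambda>s. s *\<^sub>R ?D)" by (rule bounded_linear_scaleR_left)
    fix s assume "t + s \<in> ball t \<epsilon>"
    then have s: "\<bar>s\<bar> < \<epsilon>" by (simp add: dist_norm)
    then have sw: "\<bar>s\<bar> * norm w \<le> \<beta> / 2"
    proof -
      have "\<bar>s\<bar> * norm w \<le> \<epsilon> * (1 + norm w)" using s \<epsilon> by (intro mult_mono) auto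
      also have "\<epsilon> * (1 + norm w) = \<beta> / 2" using pw by (simp add: \<epsilon>_def divide_eq_eq)
      finally show ?thesis .
    qed
    have ks: "Im (\<kappa> (t + s)) > 0"
    proof -
      have "\<bar>s * Im w\<bar> \<le> \<bar>s\<bar> * norm w" by (simp add: abs_mult mult_left_mono abs_Im_le_cmod)
      then show ?thesis using sw k by (simp add: \<kappa>_def \<beta>_def algebra_simps)
    qed
    define a where "a y = \<i> * w / 4 * complex_of_real ((norm y)\<^sup>2)" for y :: 'a
    have split: "gauss (\<kappa> (t + s)) y = gauss (\<kappa> t) y * exp (s *\<^sub>R a y)" for y :: 'a
      unfolding gauss_def \<kappa>_def a_def by (simp add: exp_add[symmetric] scaleR_conv_of_real algebra_simps add_divide_distrib)
    have i0: "integrable lborel (gauss (\<kappa> r) :: 'a \<Rightarrow> complex)" if "Im (\<kappa> r) > 0" for r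
      using integrable_gauss_bounded[OF that, of "\<lambda>_. 1" 1 0] by simp
    have ia: "integrable lborel (\<lambda>y::'a. gauss (\<kappa> t) y * a y)"
    proof -
      have "integrable lborel (\<lambda>y::'a. \<i> * w / 4 * (gauss (\<kappa> t) y * complex_of_real ((norm y)\<^sup>2)))"
        by (rule integrable_mult_right[OF int2])
      then show ?thesis by (simp add: a_def mult_ac)
    qed
    have D: "?D = (LINT y|lborel. gauss (\<kappa> t) (y::'a) * a y)"
      unfolding a_def by (subst integral_mult_right_zero[symmetric]) (simp add: mult_ac)
    have int_err: "integrable lborel (\<lambda>y::'a. gauss (\<kappa> (t + s)) y - gauss (\<kappa> t) y - s *\<^sub>R (gauss (\<kappa> t) y * a y))"
      by (intro Bochner_Integration.integrable_diff integrable_scaleR_right i0 ks k ia)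
    have "(LINT y|lborel. gauss (\<kappa> (t + s)) (y::'a)) - (LINT y|lborel. gauss (\<kappa> t) (y::'a)) - s *\<^sub>R ?D
      = (LINT y|lborel. gauss (\<kappa> (t + s)) (y::'a) - gauss (\<kappa> t) y - s *\<^sub>R (gauss (\<kappa> t) y * a y))"
      unfolding D using i0[OF ks] i0[OF k] ia by simp
    also have "norm \<dots> \<le> (LINT y|lborel. (norm w)\<^sup>2 * s\<^sup>2 * (norm (gauss q (y::'a)) * (1 + norm y) ^ 4))"
    proof (rule Bochner_Integration.integral_norm_bound_integral[OF int_err])
      show "integrable lborel (\<lambda>y::'a. (norm w)\<^sup>2 * s\<^sup>2 * (norm (gauss q y) * (1 + norm y) ^ 4))"
        by (intro integrable_mult_right integrable_gauss_weight q)
      fix y :: 'a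
      have na: "norm (s *\<^sub>R a y) = \<bar>s\<bar> * norm w * (norm y)\<^sup>2 / 4"
        by (simp add: a_def norm_mult norm_power)
      have "norm (exp (s *\<^sub>R a y) - 1 - s *\<^sub>R a y) \<le> exp \<bar>Re (s *\<^sub>R a y)\<bar> * (norm (s *\<^sub>R a y))\<^sup>2"
        using Taylor_exp[of "s *\<^sub>R a y" 1] by (simp add: diff_diff_eq numeral_2_eq_2)
      also have "\<dots> \<le> exp (\<beta> / 8 * (norm y)\<^sup>2) * ((norm w)\<^sup>2 * s\<^sup>2 * (1 + norm y) ^ 4)"
      proof (rule mult_mono)
        have "\<bar>Re (s *\<^sub>R a y)\<bar> \<le> \<bar>s\<bar> * norm w * (norm y)\<^sup>2 / 4" using abs_Re_le_cmod[of "s *\<^sub>R a y"] unfolding na .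
        also have "\<dots> \<le> \<beta> / 2 * (norm y)\<^sup>2 / 4" using sw by (intro divide_right_mono mult_right_mono) auto
        finally show "exp \<bar>Re (s *\<^sub>R a y)\<bar> \<le> exp (\<beta> / 8 * (norm y)\<^sup>2)" by simp
        have "(norm (s *\<^sub>R a y))\<^sup>2 = (norm w)\<^sup>2 * s\<^sup>2 * (norm y ^ 4 / 16)"
        proof -
          have "((norm y)\<^sup>2)\<^sup>2 = norm y ^ 4" by (simp flip: power_mult)
          then show ?thesis unfolding na power_divide power_mult_distrib by simp
        qed
        also have "\<dots> \<le> (norm w)\<^sup>2 * s\<^sup>2 * (1 + norm y) ^ 4"
        proof (rule mult_left_mono)
          have "norm y ^ 4 \<le> (1 + norm y) ^ 4" by (intro power_mono) auto
          moreover have "0 \<le> norm y ^ 4" by simp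
          ultimately show "norm y ^ 4 / 16 \<le> (1 + norm y) ^ 4" by linarith
        qed simp
        finally show "(norm (s *\<^sub>R a y))\<^sup>2 \<le> (norm w)\<^sup>2 * s\<^sup>2 * (1 + norm y) ^ 4" .
      qed auto
      finally have "norm (gauss (\<kappa> t) y) * norm (exp (s *\<^sub>R a y) - 1 - s *\<^sub>R a y) \<le> norm (gauss (\<kappa> t) y) * (exp (\<beta> / 8 * (norm y)\<^sup>2) * ((norm w)\<^sup>2 * s\<^sup>2 * (1 + norm y) ^ 4))"
        by (intro mult_left_mono) auto
      also have "\<dots> = (norm w)\<^sup>2 * s\<^sup>2 * (norm (gauss q y) * (1 + norm y) ^ 4)"
      proof -
        have "norm (gauss (\<kappa> t) y) * exp (\<beta> / 8 * (norm y)\<^sup>2) = norm (gauss q y)"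
          unfolding norm_gauss exp_add[symmetric] by (simp add: q_def \<beta>_def algebra_simps)
        from this[symmetric] show ?thesis by (simp only: mult_ac)
      qed
      finally show "norm (gauss (\<kappa> (t + s)) y - gauss (\<kappa> t) y - s *\<^sub>R (gauss (\<kappa> t) y * a y)) \<le> (norm w)\<^sup>2 * s\<^sup>2 * (norm (gauss q y) * (1 + norm y) ^ 4)"
        unfolding split norm_mult[symmetric] by (simp add: algebra_simps)
    qed
    also have "\<dots> = ?M * (norm s)\<^sup>2" by simp
    finally show "norm ((LINT y|lborel. gauss (\<kappa> (t + s)) (y::'a)) - (LINT y|lborel. gauss (\<kappa> t) (y::'a)) - s *\<^sub>R ?D) \<le> ?M * (norm s)\<^sup>2" .
  qed
  then show ?thesis
    using \<epsilon> by (simp add: has_vector_derivative_def at_within_open[of t "ball t \<epsilon>"])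
qed

text \<open>The square of the Gaussian integral times \<open>k ^ DIM('a)\<close> does not depend on \<open>k\<close>.\<close>

lemma gauss_integral_neq_0:
  assumes k: "Im k > 0" and d: "DIM('a::euclidean_space) \<ge> 2"
  shows "(LINT y|lborel. gauss k (y::'a)) \<noteq> 0"
proof -
  define w where "w = k - \<i>"
  \<comment> \<open>The segment from i to k stays in the upper half-plane. At i the integrand is
    real and positive, so the integral there is nonzero.\<close>
  define \<kappa> where "\<kappa> t = \<i> + complex_of_real t * w" for t
  define F where "F t = (LINT y|lborel. gauss (\<kappa> t) (y::'a))" for t
  define n where "n = DIM('a) - 1"
  have n: "DIM('a) = Suc n" using d by (simp add: n_def)
  \<comment> \<open>Squaring replaces the power d / 2 of the parameter by d, so no branch of a root
    has to be chosen.\<close>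
  define G where "G t = (F t * F t) * \<kappa> t ^ Suc n" for t
  have Im\<kappa>: "Im (\<kappa> t) > 0" if "t \<in> {0..1}" for t
  proof -
    have "Im (\<kappa> t) = (1 - t) + t * Im k" by (simp add: \<kappa>_def w_def algebra_simps)
    moreover have "0 \<le> t * Im k" "t * Im k > 0 \<or> t = 0" using that k by auto
    ultimately show ?thesis using that by auto
  qed
  have DG: "(G has_vector_derivative 0) (at t within {0..1})" if t: "t \<in> {0..1}" for t
  proof -
    let ?S = "LINT y|lborel. gauss (\<kappa> t) (y::'a) * complex_of_real ((norm y)\<^sup>2)"
    have \<kappa>0: "\<kappa> t \<noteq> 0" using Im\<kappa>[OF t] by auto
    have DF: "(F has_vector_derivative (\<i> * w / 4 * ?S)) (at t)"
      using has_vector_derivative_gauss_integral[where 'a='a and k=\<i> and w=w and t=t]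
        Im\<kappa>[OF t] gauss_moment(1)[OF Im\<kappa>[OF t] d] unfolding F_def \<kappa>_def by simp
    have D\<kappa>: "(\<kappa> has_vector_derivative w) (at t)"
      unfolding \<kappa>_def has_vector_derivative_def by (auto intro!: derivative_eq_intros simp: scaleR_conv_of_real)
    have Dp: "((\<lambda>t. \<kappa> t ^ Suc n) has_vector_derivative (w * (of_nat (Suc n) * \<kappa> t ^ n))) (at t)"
    proof -
      have "((\<lambda>z. z ^ Suc n) has_field_derivative of_nat (Suc n) * \<kappa> t ^ n) (at (\<kappa> t))"
        by (rule derivative_eq_intros refl | simp)+
      from field_vector_diff_chain_at[OF D\<kappa> this] show ?thesis by (simp add: o_def)
    qed
    have "(G has_vector_derivative (F t * F t * (w * (of_nat (Suc n) * \<kappa> t ^ n)) + (F t * (\<i> * w / 4 * ?S) + \<i> * w / 4 * ?S * F t) * \<kappa> t ^ Suc n)) (at t)"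
      unfolding G_def by (intro has_vector_derivative_mult DF Dp)
    also have "F t * F t * (w * (of_nat (Suc n) * \<kappa> t ^ n)) + (F t * (\<i> * w / 4 * ?S) + \<i> * w / 4 * ?S * F t) * \<kappa> t ^ Suc n
        = F t * w * \<kappa> t ^ n * (F t * of_nat (Suc n) + \<i> / 2 * (\<kappa> t * ?S))"
      by (simp add: algebra_simps)
    \<comment> \<open>The moment identity makes the derivative of the Gaussian integral cancel that
      of the power.\<close>
    also have "\<kappa> t * ?S = 2 * \<i> * of_nat (Suc n) * F t"
      using gauss_moment(2)[OF Im\<kappa>[OF t] d] by (simp only: F_def n)
    also have "F t * w * \<kappa> t ^ n * (F t * of_nat (Suc n) + \<i> / 2 * (2 * \<i> * of_nat (Suc n) * F t)) = 0"
      by (simp add: algebra_simps)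
    finally show ?thesis by (rule has_vector_derivative_at_within)
  qed
  have "\<exists>c. \<forall>t\<in>{0..1}. G t = c"
    by (rule has_vector_derivative_zero_constant[of "{0..1}" G]) (use DG in auto)
  then have "G 1 = G 0" by force
  moreover have "F 0 \<noteq> 0"
  proof -
    have "gauss \<i> y = complex_of_real (exp (- ((norm y)\<^sup>2 / 4)))" for y :: 'a
      by (simp add: gauss_def exp_of_real[symmetric])
    then have F0: "F 0 = complex_of_real (LINT y|lborel. exp (- ((norm (y::'a))\<^sup>2 / 4)))"
      by (simp add: F_def \<kappa>_def)
    have int: "integrable lborel (\<lambda>y::'a. exp (- ((norm y)\<^sup>2 / 4)))"
      using integrable_gauss_weight[of \<i> 0, where 'a='a] by (simp add: norm_gauss)
    have "(LINT y|lborel. exp (- ((norm (y::'a))\<^sup>2 / 4))) \<noteq> 0"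
    proof
      assume "(LINT y|lborel. exp (- ((norm (y::'a))\<^sup>2 / 4))) = 0"
      \<comment> \<open>A strictly positive function of integral 0 would force the total Lebesgue
        measure to be 0.\<close>
      then have "AE y::'a in lborel. exp (- ((norm y)\<^sup>2 / 4)) = 0"
        by (subst (asm) integral_nonneg_eq_0_iff_AE[OF int]) auto
      then have "AE y::'a in lborel. False" by simp
      then show False by (simp add: AE_iff_null null_sets_def emeasure_lborel_UNIV)
    qed
    then show ?thesis using F0 by simp
  qed
  ultimately have "G 1 \<noteq> 0" by (simp add: G_def \<kappa>_def)
  then have "F 1 \<noteq> 0" by (auto simp: G_def)
  then show ?thesis by (simp add: F_def \<kappa>_def w_def)
qed

section \<open>Inverting the shifted Laplacian on Schwartz functions\<close>

lemma lap_heat_transform: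
  fixes h :: "'a::euclidean_space \<Rightarrow> complex"
  assumes k: "Im k > 0" and h: "schwartz h"
  shows "lap (heat_transform k h) x + k\<^sup>2 * heat_transform k h x = heat_transform k (\<lambda>x. lap h x + k\<^sup>2 * h x) x"
proof -
  note int = integrable_heat_transform[OF k]
  have "lap (heat_transform k h) x = (\<Sum>b\<in>Basis. heat_transform k (pd b (pd b h)) x)"
    unfolding lap_def by (intro sum.cong refl) (simp add: pd_heat_transform[OF k] h schwartz_pd)
  also have "\<dots> = heat_transform k (lap h) x"
    unfolding heat_transform_def lap_def sum_distrib_left
    by (intro Bochner_Integration.integral_sum[symmetric] int schwartz_pd h)
  finally have "lap (heat_transform k h) x + k\<^sup>2 * heat_transform k h x = heat_transform k (lap h) x + k\<^sup>2 * heat_transform k h x" by simp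
  also have "\<dots> = (LINT p|(lborel \<Otimes>\<^sub>M lborel). radial_weight k (fst p) * gauss k (snd p) * lap h (x - fst p *\<^sub>R snd p)
       + k\<^sup>2 * (radial_weight k (fst p) * gauss k (snd p) * h (x - fst p *\<^sub>R snd p)))"
    using int[OF schwartz_lap[OF h], of x] int[OF h, of x] by (simp add: heat_transform_def)
  also have "\<dots> = heat_transform k (\<lambda>x. lap h x + k\<^sup>2 * h x) x"
    unfolding heat_transform_def by (intro Bochner_Integration.integral_cong refl) (simp add: algebra_simps)
  finally show ?thesis .
qed

lemma lap_cmult: "schwartz h \<Longrightarrow> lap (\<lambda>x. c * h x) x = c * lap h x"
  by (simp add: lap_def pd_schwartz_cmult schwartz_pd sum_distrib_left)

text \<open>The transform commutes with the Laplacian and inverts \<open>lap + k^2\<close> up to the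
  constant \<open>c\<close>. Since \<open>c\<close> is nonzero, division by it gives an exact
  solution.\<close>

lemma schwartz_resolvent_solution:
  fixes g :: "'a::euclidean_space \<Rightarrow> complex"
  assumes k: "Im k > 0" and d: "DIM('a) \<ge> 2" and g: "schwartz g"
  obtains u where "schwartz u" "\<And>x. lap u x + k\<^sup>2 * u x = - g x"
proof -
  define c where "c = \<i> * k * (LINT y|lborel. gauss k (y::'a))"
  have c: "c \<noteq> 0" using k gauss_integral_neq_0[OF k d] by (auto simp: c_def)
  let ?v = "heat_transform k g"
  have v: "schwartz ?v" by (rule schwartz_heat_transform[OF k g])
  have "lap (\<lambda>x. - 1 / c * ?v x) x + k\<^sup>2 * (- 1 / c * ?v x) = - g x" for x
  proof -
    have "lap (\<lambda>x. - 1 / c * ?v x) x + k\<^sup>2 * (- 1 / c * ?v x) = - 1 / c * (lap ?v x + k\<^sup>2 * ?v x)"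
      unfolding lap_cmult[OF v] by (simp add: algebra_simps)
    also have "\<dots> = - 1 / c * (c * g x)"
      unfolding lap_heat_transform[OF k g] heat_transform_inverse[OF k g d] c_def by simp
    also have "\<dots> = - g x" using c by simp
    finally show ?thesis .
  qed
  then show ?thesis using schwartz_cmult[OF v, of "- 1 / c"] by (intro that)
qed

section \<open>Weak derivatives and uniqueness\<close>

text \<open>A singularity of the power at 0 is invisible to functions that vanish near 0. The
  products over all integer exponents are closed under differentiation up to linear combinations:
  the power goes to exponent j - 2, and its linear factor is absorbed into f.\<close>

lemma test_functions_mult_norm_powi:
  fixes f :: "'a::euclidean_space \<Rightarrow> complex"
  assumes f: "f \<in> test_functions (- {0})"
  shows "(\<lambda>x. f x * complex_of_real (norm x powi j)) \<in> test_functions (- {0})"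
proof (rule test_functionsI[OF _ f])
  show "closure {x. f x * complex_of_real (norm x powi j) \<noteq> 0} \<subseteq> closure {x. f x \<noteq> 0}"
    by (rule closure_mono) auto
  let ?G = "{\<lambda>x. f x * complex_of_real (norm x powi j) |f j. f \<in> test_functions (- {0})} :: ('a \<Rightarrow> complex) set"
  \<comment> \<open>The product vanishes on a neighbourhood of 0, whatever default value the power
    takes at 0 itself.\<close>
  have zero: "((\<lambda>x. f x * complex_of_real (norm x powi j)) has_derivative (\<lambda>_. 0)) (at 0)"
    if "f \<in> test_functions (- {0})" for f :: "'a \<Rightarrow> complex" and j
  proof (rule has_derivative_transform_within_open[of "\<lambda>_. 0" "\<lambda>_. 0" _ UNIV "- closure {x. f x \<noteq> 0}"])
    show "0 \<in> - closure {x. f x \<noteq> 0}" using test_functionsD(3)[OF that] by auto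
    show "0 = f x * complex_of_real (norm x powi j)" if x: "x \<in> - closure {x. f x \<noteq> 0}" for x
    proof -
      have "x \<notin> {x. f x \<noteq> 0}" using x closure_subset[of "{x. f x \<noteq> 0}"] by blast
      then show ?thesis by simp
    qed
  qed auto
  have vanish: "f 0 = 0" "pd b f 0 = 0" if "f \<in> test_functions (- {0})" for f :: "'a \<Rightarrow> complex" and b
    using pd_eqI[OF zero[OF that, of 0], of b] test_functionsD(3)[OF that] closure_subset[of "{x. f x \<noteq> 0}"] by auto
  have norm_diff: "(\<lambda>x. complex_of_real (norm x powi j)) differentiable (at x)" if "x \<noteq> 0" for x :: 'a and j
  proof -
    have "(\<lambda>x. norm x powi j) differentiable (at x)"
      using has_derivative_power_int[OF _ has_derivative_norm[OF that], of j] that by (auto intro: differentiableI)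
    then show ?thesis using has_derivative_of_real unfolding differentiable_def by blast
  qed
  have diff: "(\<lambda>x. f x * complex_of_real (norm x powi j)) differentiable (at x)"
    if "f \<in> test_functions (- {0})" for f :: "'a \<Rightarrow> complex" and j x
  proof (cases "x = 0")
    case True
    then show ?thesis using zero[OF that] by (auto intro: differentiableI)
  next
    case False
    then show ?thesis
      using smooth_differentiable[OF test_functionsD(1)[OF that]] norm_diff by (intro differentiable_mult)
  qed
  show "smooth (\<lambda>x. f x * complex_of_real (norm x powi j))"
  proof (rule smooth_linear_hull[of _ ?G])
    show "(\<lambda>x. f x * complex_of_real (norm x powi j)) \<in> linear_hull ?G"
      using f by (intro linear_hull_base) blast
    show "g differentiable (at x)" if "g \<in> ?G" for g x using that diff by blast
    show "pd b g \<in> linear_hull ?G" if g: "g \<in> ?G" and b: "b \<in> Basis" for g b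
    proof -
      obtain f j where fj: "g = (\<lambda>x. f x * complex_of_real (norm x powi j))" and f: "f \<in> test_functions (- {0})"
        using g by blast
      have "pd b g x = pd b f x * complex_of_real (norm x powi j)
         + of_int j * (complex_of_real (x \<bullet> b) * f x * complex_of_real (norm x powi (j - 2)))" for x
      proof (cases "x = 0")
        case True
        then show ?thesis using pd_eqI[OF zero[OF f]] vanish[OF f] unfolding fj by simp
      next
        case False
        have "line_deriv b g x (pd b g x)"
          using has_vector_derivative_line_Basis[of g x 0 b] diff[OF f] b unfolding line_deriv_def fj by simp
        moreover have "line_deriv b g x (f x * complex_of_real (of_int j * (x \<bullet> b) * norm x powi (j - 2)) + pd b f x * complex_of_real (norm x powi j))"
          unfolding fj by (intro line_deriv_mult line_deriv_norm_powi False line_deriv_pd test_functions_schwartz[OF f] b)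
        ultimately have "pd b g x = f x * complex_of_real (of_int j * (x \<bullet> b) * norm x powi (j - 2)) + pd b f x * complex_of_real (norm x powi j)"
          unfolding line_deriv_def by (rule vector_derivative_unique_at)
        then show ?thesis by simp
      qed
      then have "pd b g = (\<lambda>x. pd b f x * complex_of_real (norm x powi j)
         + of_int j * (complex_of_real (x \<bullet> b) * f x * complex_of_real (norm x powi (j - 2))))" by auto
      also have "\<dots> \<in> linear_hull ?G"
      proof (intro linear_hull_add linear_hull_cmult linear_hull_base)
        show "(\<lambda>x. pd b f x * complex_of_real (norm x powi j)) \<in> ?G"
          using test_functions_pd[OF f b] by blast
        show "(\<lambda>x. complex_of_real (x \<bullet> b) * f x * complex_of_real (norm x powi (j - 2))) \<in> ?G"
          by (intro CollectI exI[of _ "\<lambda>x. complex_of_real (x \<bullet> b) * f x"] exI[of _ "j - 2"] conjI refl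
              test_functions_mult_left[OF smooth_inner f])
      qed
      finally show ?thesis .
    qed
  qed
qed

lemma mult_inv_norm_test_function:
  assumes "f \<in> test_functions (- {0})"
  shows "mult_inv_norm f \<in> test_functions (- {0})"
  using test_functions_mult_norm_powi[OF assms, of "-1"]
  by (simp add: mult_inv_norm_def power_int_minus divide_inverse mult.commute)

lemma integrable_L2_mult:
  assumes f: "f \<in> L2" and g: "g \<in> L2"
  shows "integrable lborel (\<lambda>x. f x * g x)"
proof (rule Bochner_Integration.integrable_bound)
  show "integrable lborel (\<lambda>x. (norm (f x))\<^sup>2 + (norm (g x))\<^sup>2)"
    using f g by (auto simp: L2_def)
  show "(\<lambda>x. f x * g x) \<in> borel_measurable lborel" using f g by (auto simp: L2_def)
  show "AE x in lborel. norm (f x * g x) \<le> norm ((norm (f x))\<^sup>2 + (norm (g x))\<^sup>2)"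
  proof (rule AE_I2)
    fix x
    have "norm (f x) * norm (g x) \<le> (norm (f x))\<^sup>2 + (norm (g x))\<^sup>2"
    proof -
      have "0 \<le> norm (f x) * norm (g x)" by simp
      then show ?thesis
        using sum_squares_bound[of "norm (f x)" "norm (g x)"] unfolding mult.assoc by linarith
    qed
    then show "norm (f x * g x) \<le> norm ((norm (f x))\<^sup>2 + (norm (g x))\<^sup>2)" by (simp add: norm_mult)
  qed
qed

lemma L2_diff: assumes f: "f \<in> L2" and g: "g \<in> L2" shows "(\<lambda>x. f x - g x) \<in> L2"
proof -
  have [measurable]: "f \<in> borel_measurable lborel" "g \<in> borel_measurable lborel" using f g by (auto simp: L2_def)
  have "integrable lborel (\<lambda>x. (norm (f x - g x))\<^sup>2)"
  proof (rule Bochner_Integration.integrable_bound)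
    show "integrable lborel (\<lambda>x. 2 * (norm (f x))\<^sup>2 + 2 * (norm (g x))\<^sup>2)"
      using f g by (auto simp: L2_def)
    show "AE x in lborel. norm ((norm (f x - g x))\<^sup>2) \<le> norm (2 * (norm (f x))\<^sup>2 + 2 * (norm (g x))\<^sup>2)"
    proof (rule AE_I2)
      fix x
      have "(norm (f x - g x))\<^sup>2 \<le> (norm (f x) + norm (g x))\<^sup>2"
        by (intro power_mono norm_triangle_ineq4) auto
      also have "\<dots> \<le> 2 * (norm (f x))\<^sup>2 + 2 * (norm (g x))\<^sup>2"
        using sum_squares_bound[of "norm (f x)" "norm (g x)"] by (simp add: power2_sum)
      finally show "norm ((norm (f x - g x))\<^sup>2) \<le> norm (2 * (norm (f x))\<^sup>2 + 2 * (norm (g x))\<^sup>2)" by simp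
    qed
  qed measurable
  then show ?thesis by (simp add: L2_def)
qed

lemma schwartz_L2: assumes f: "schwartz f" shows "f \<in> L2"
proof -
  have [measurable]: "f \<in> borel_measurable borel" by (rule borel_measurable_schwartz[OF f])
  have "integrable lborel (\<lambda>x. f x * cnj (f x))"
    using schwartz_rapid[OF f] by (intro integrable_rapid rapid_mult moderate_rapid rapid_cnj) auto
  then have "integrable lborel (\<lambda>x. Re (f x * cnj (f x)))" by (rule integrable_Re)
  also have "(\<lambda>x. Re (f x * cnj (f x))) = (\<lambda>x. (norm (f x))\<^sup>2)"
    by (subst complex_norm_square[symmetric]) simp
  finally show ?thesis by (simp add: L2_def)
qed

lemma schwartz_by_parts:
  fixes u v :: "'a::euclidean_space \<Rightarrow> complex"
  assumes u: "schwartz u" and v: "schwartz v" and b: "b \<in> Basis" and d: "DIM('a) \<ge> 2"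
  shows "(LINT x|lborel. u x * pd b v x) = - (LINT x|lborel. pd b u x * v x)"
proof -
  have L: "u \<in> L2" "v \<in> L2" "pd b u \<in> L2" "pd b v \<in> L2" using u v b by (auto intro: schwartz_L2 schwartz_pd)
  have "(LINT x|lborel. u x * pd b v x + pd b u x * v x) = 0"
    using line_deriv_mult[OF line_deriv_pd[OF u b] line_deriv_pd[OF v b]] unfolding line_deriv_def
    by (intro integral_line_derivative_eq_0[OF d b, of "\<lambda>x. u x * v x"] Bochner_Integration.integrable_add integrable_L2_mult L) auto
  then show ?thesis
    using integrable_L2_mult[OF L(1,4)] integrable_L2_mult[OF L(3,2)] by (simp add: add_eq_0_iff2)
qed

lemma schwartz_iterated_partial: "schwartz f \<Longrightarrow> set bs \<subseteq> Basis \<Longrightarrow> schwartz (iterated_partial bs f)"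
  using iterated_partial_coinduct[of f "Collect schwartz" bs] schwartz_pd by blast

text \<open>The reversal records the order of integrating by parts: the head of the list is the
  outermost derivative on \<open>\<phi>\<close>, is moved first, and becomes the innermost
  derivative on \<open>u\<close>. No interchange of derivatives is involved.\<close>

lemma weak_deriv_schwartz:
  fixes u :: "'a::euclidean_space \<Rightarrow> complex"
  assumes u: "schwartz u" and d: "DIM('a) \<ge> 2" and bs: "set bs \<subseteq> Basis"
  shows "weak_deriv bs u (iterated_partial (rev bs) u)"
  using u bs
proof (induction bs arbitrary: u)
  case Nil
  then show ?case by (simp add: weak_deriv_def)
next
  case (Cons b bs)
  show ?case
    unfolding weak_deriv_def
  proof
    fix \<phi> :: "'a \<Rightarrow> complex" assume \<phi>: "\<phi> \<in> test_functions UNIV"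
    have b: "b \<in> Basis" and bs: "set bs \<subseteq> Basis" using Cons.prems by auto
    have \<psi>: "schwartz (iterated_partial bs \<phi>)"
      using iterated_partial_test_functions[OF \<phi> bs] by (rule test_functions_schwartz)
    have "(LINT x|lborel. u x * iterated_partial (b # bs) \<phi> x) = - (LINT x|lborel. pd b u x * iterated_partial bs \<phi> x)"
      unfolding iterated_partial_Cons_pd by (rule schwartz_by_parts[OF Cons.prems(1) \<psi> b d])
    also have "\<dots> = - ((- 1) ^ length bs * (LINT x|lborel. iterated_partial (rev bs) (pd b u) x * \<phi> x))"
      using Cons.IH[OF schwartz_pd[OF Cons.prems(1) b] bs] \<phi> by (simp add: weak_deriv_def)
    also have "iterated_partial (rev bs) (pd b u) = iterated_partial (rev (b # bs)) u"
      by (simp only: rev.simps iterated_partial_snoc_pd)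
    finally show "(LINT x|lborel. u x * iterated_partial (b # bs) \<phi> x) =
       (- 1) ^ length (b # bs) * (LINT x|lborel. iterated_partial (rev (b # bs)) u x * \<phi> x)" by simp
  qed
qed

lemma schwartz_laplacian_graph:
  fixes u :: "'a::euclidean_space \<Rightarrow> complex"
  assumes u: "schwartz u" and d: "DIM('a) \<ge> 2"
  shows "(u, lap u) \<in> laplacian_graph"
proof -
  have "\<exists>w\<in>L2. weak_deriv bs u w" if "set bs \<subseteq> Basis" for bs
    using weak_deriv_schwartz[OF u d that] schwartz_L2[OF schwartz_iterated_partial[OF u, of "rev bs"]] that by auto
  then have "u \<in> sobolev 2" using schwartz_L2[OF u] by (auto simp: sobolev_def)
  moreover have "pd b (pd b u) \<in> L2 \<and> weak_deriv [b, b] u (pd b (pd b u))" if "b \<in> Basis" for b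
    using weak_deriv_schwartz[OF u d, of "[b, b]"] that schwartz_L2[OF schwartz_pd[OF schwartz_pd[OF u]]] by (simp add: pd_def)
  moreover have "lap u = (\<lambda>x. \<Sum>b\<in>Basis. pd b (pd b u) x)" by (auto simp: lap_def)
  ultimately show ?thesis unfolding laplacian_graph_def
    by (intro CollectI exI[of _ u] exI[of _ "\<lambda>b. pd b (pd b u)"]) simp
qed

text \<open>Square integrability and this distributional form are all that uniqueness uses of the
  graph.\<close>

lemma laplacian_graph_weak:
  assumes uv: "(u, v) \<in> laplacian_graph" and \<phi>: "\<phi> \<in> test_functions UNIV"
  shows "u \<in> L2" "integrable lborel (\<lambda>x. v x * \<phi> x)" "(LINT x|lborel. v x * \<phi> x) = (LINT x|lborel. u x * lap \<phi> x)"
proof -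
  obtain D where v: "v = (\<lambda>x. \<Sum>b\<in>Basis. D b x)" and u: "u \<in> sobolev 2"
    and D: "\<And>b. b \<in> Basis \<Longrightarrow> D b \<in> L2" "\<And>b. b \<in> Basis \<Longrightarrow> weak_deriv [b, b] u (D b)"
    using uv unfolding laplacian_graph_def by blast
  show uL: "u \<in> L2" using u by (simp add: sobolev_def)
  have \<phi>s: "schwartz \<phi>" by (rule test_functions_schwartz[OF \<phi>])
  have int: "integrable lborel (\<lambda>x. D b x * \<phi> x)" if "b \<in> Basis" for b
    by (intro integrable_L2_mult D that schwartz_L2 \<phi>s)
  have int2: "integrable lborel (\<lambda>x. u x * pd b (pd b \<phi>) x)" if "b \<in> Basis" for b
    by (intro integrable_L2_mult uL that schwartz_L2 schwartz_pd \<phi>s)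
  show "integrable lborel (\<lambda>x. v x * \<phi> x)"
    unfolding v sum_distrib_right using int by auto
  have "(LINT x|lborel. v x * \<phi> x) = (\<Sum>b\<in>Basis. (LINT x|lborel. D b x * \<phi> x))"
    unfolding v sum_distrib_right by (rule Bochner_Integration.integral_sum) (rule int)
  also have "\<dots> = (\<Sum>b\<in>Basis. (LINT x|lborel. u x * pd b (pd b \<phi>) x))"
  proof (rule sum.cong[OF refl])
    fix b :: 'a assume "b \<in> Basis"
    from D(2)[OF this] \<phi> show "(LINT x|lborel. D b x * \<phi> x) = (LINT x|lborel. u x * pd b (pd b \<phi>) x)"
      by (simp add: weak_deriv_def pd_def)
  qed
  also have "\<dots> = (LINT x|lborel. u x * lap \<phi> x)"
    unfolding lap_def sum_distrib_left by (rule Bochner_Integration.integral_sum[symmetric]) (rule int2)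
  finally show "(LINT x|lborel. v x * \<phi> x) = (LINT x|lborel. u x * lap \<phi> x)" .
qed

section \<open>Uniqueness by duality and cutoffs\<close>

lemma smooth_scaled_pd: "smooth f \<Longrightarrow> pd b (\<lambda>x. f (r *\<^sub>R x)) = (\<lambda>x. of_real r * pd b f (r *\<^sub>R x))"
  by (auto simp: pd_scale smooth_differentiable)

text \<open>Each derivative that falls on the cutoff carries a factor r, so the commutator terms
  disappear as r tends to 0.\<close>

lemma lap_cutoff:
  assumes \<eta>: "smooth \<eta>" and f: "smooth f"
  shows "lap (\<lambda>x. \<eta> (r *\<^sub>R x) * f x) x = \<eta> (r *\<^sub>R x) * lap f x
     + 2 * of_real r * (\<Sum>b\<in>Basis. pd b \<eta> (r *\<^sub>R x) * pd b f x) + (of_real r)\<^sup>2 * (lap \<eta> (r *\<^sub>R x) * f x)"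
proof -
  have s: "smooth (\<lambda>x. \<eta> (r *\<^sub>R x))" by (rule smooth_scale[OF \<eta>])
  have "pd b (pd b (\<lambda>x. \<eta> (r *\<^sub>R x) * f x)) x = \<eta> (r *\<^sub>R x) * pd b (pd b f) x
     + 2 * of_real r * (pd b \<eta> (r *\<^sub>R x) * pd b f x) + (of_real r)\<^sup>2 * (pd b (pd b \<eta>) (r *\<^sub>R x) * f x)"
    if b: "b \<in> Basis" for b
  proof -
    have s': "smooth (\<lambda>x. of_real r * pd b \<eta> (r *\<^sub>R x))" by (intro smooth_cmult smooth_scale smooth_pd \<eta> b)
    have "pd b (\<lambda>x. \<eta> (r *\<^sub>R x) * f x) = (\<lambda>x. \<eta> (r *\<^sub>R x) * pd b f x + (of_real r * pd b \<eta> (r *\<^sub>R x)) * f x)"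
      using smooth_differentiable[OF s] smooth_differentiable[OF f] by (auto simp: pd_mult smooth_scaled_pd[OF \<eta>])
    then have "pd b (pd b (\<lambda>x. \<eta> (r *\<^sub>R x) * f x)) x = \<eta> (r *\<^sub>R x) * pd b (pd b f) x + (of_real r * pd b \<eta> (r *\<^sub>R x)) * pd b f x
        + ((of_real r * pd b \<eta> (r *\<^sub>R x)) * pd b f x + pd b (\<lambda>x. of_real r * pd b \<eta> (r *\<^sub>R x)) x * f x)"
      using smooth_differentiable[OF s] smooth_differentiable[OF f] smooth_differentiable[OF s'] smooth_differentiable[OF smooth_pd[OF f b]]
      by (simp only: pd_add pd_mult differentiable_mult smooth_scaled_pd[OF \<eta>])
    also have "pd b (\<lambda>x. of_real r * pd b \<eta> (r *\<^sub>R x)) x = of_real r * (of_real r * pd b (pd b \<eta>) (r *\<^sub>R x))"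
      using smooth_differentiable[OF smooth_scale[OF smooth_pd[OF \<eta> b]]] by (simp add: pd_cmult smooth_scaled_pd[OF smooth_pd[OF \<eta> b]])
    finally show ?thesis by (simp add: algebra_simps power2_eq_square)
  qed
  then show ?thesis
    by (simp add: lap_def sum.distrib sum_distrib_left sum_distrib_right)
qed

text \<open>Duality: the difference w annihilates \<open>lap \<phi> + k\<^sup>2 * \<phi>\<close> for
  every test function \<open>\<phi>\<close>, so it vanishes if every test function is of this form.
  The equation is solved only by a Schwartz function, hence the slowly varying cutoffs and a limit.
  The pairing is bilinear, without conjugation, so the dual problem has the same parameter
  k.\<close>

lemma laplacian_graph_unique:
  fixes u\<^sub>1 u\<^sub>2 g :: "'a::euclidean_space \<Rightarrow> complex"
  assumes k: "Im k > 0" and d: "DIM('a) \<ge> 2"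
    and 1: "(u\<^sub>1, v\<^sub>1) \<in> laplacian_graph" "AE x in lborel. - v\<^sub>1 x - k\<^sup>2 * u\<^sub>1 x = g x"
    and 2: "(u\<^sub>2, v\<^sub>2) \<in> laplacian_graph" "AE x in lborel. - v\<^sub>2 x - k\<^sup>2 * u\<^sub>2 x = g x"
  shows "AE x in lborel. u\<^sub>1 x = u\<^sub>2 x"
proof -
  define w where "w x = u\<^sub>1 x - u\<^sub>2 x" for x
  have zero_test: "(\<lambda>_::'a. 0) \<in> test_functions UNIV"
    using smooth_const[of 0] by (simp add: test_functions_def)
  have uL: "u\<^sub>1 \<in> L2" "u\<^sub>2 \<in> L2" using laplacian_graph_weak(1)[OF 1(1) zero_test] laplacian_graph_weak(1)[OF 2(1) zero_test] by auto
  have w: "w \<in> L2" unfolding w_def by (rule L2_diff[OF uL])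
  have weak: "(LINT x|lborel. w x * (lap \<phi> x + k\<^sup>2 * \<phi> x)) = 0" if \<phi>: "\<phi> \<in> test_functions UNIV" for \<phi>
  proof -
    have \<phi>s: "schwartz \<phi>" by (rule test_functions_schwartz[OF \<phi>])
    have i\<phi>: "integrable lborel (\<lambda>x. f x * \<phi> x)" "integrable lborel (\<lambda>x. f x * lap \<phi> x)" if "f \<in> L2" for f
      by (intro integrable_L2_mult that schwartz_L2 schwartz_lap \<phi>s)+
    note v1 = laplacian_graph_weak(2,3)[OF 1(1) \<phi>] and v2 = laplacian_graph_weak(2,3)[OF 2(1) \<phi>]
    have "(LINT x|lborel. v\<^sub>1 x * \<phi> x - v\<^sub>2 x * \<phi> x) = (LINT x|lborel. - (k\<^sup>2 * (w x * \<phi> x)))"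
    proof (rule integral_cong_AE)
      show "AE x in lborel. v\<^sub>1 x * \<phi> x - v\<^sub>2 x * \<phi> x = - (k\<^sup>2 * (w x * \<phi> x))"
        using 1(2) 2(2)
      proof eventually_elim
        case (elim x)
        have "v\<^sub>1 x - v\<^sub>2 x = ((- v\<^sub>2 x - k\<^sup>2 * u\<^sub>2 x) - (- v\<^sub>1 x - k\<^sup>2 * u\<^sub>1 x)) - k\<^sup>2 * w x"
          by (simp add: w_def algebra_simps)
        then have "v\<^sub>1 x - v\<^sub>2 x = - (k\<^sup>2 * w x)" unfolding elim by simp
        then show ?case by (metis left_diff_distrib mult.assoc mult_minus_left)
      qed
      show "(\<lambda>x. v\<^sub>1 x * \<phi> x - v\<^sub>2 x * \<phi> x) \<in> borel_measurable lborel" using v1(1) v2(1) by auto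
      show "(\<lambda>x. - (k\<^sup>2 * (w x * \<phi> x))) \<in> borel_measurable lborel" using i\<phi>(1)[OF w] by auto
    qed
    then have "(LINT x|lborel. u\<^sub>1 x * lap \<phi> x) - (LINT x|lborel. u\<^sub>2 x * lap \<phi> x) = - (k\<^sup>2 * (LINT x|lborel. w x * \<phi> x))"
      using v1 v2 i\<phi>(1)[OF w] by simp
    moreover have "(LINT x|lborel. w x * lap \<phi> x) = (LINT x|lborel. u\<^sub>1 x * lap \<phi> x) - (LINT x|lborel. u\<^sub>2 x * lap \<phi> x)"
      using i\<phi>(2)[OF uL(1)] i\<phi>(2)[OF uL(2)] by (simp add: w_def left_diff_distrib)
    moreover have "(LINT x|lborel. w x * (lap \<phi> x + k\<^sup>2 * \<phi> x)) = (LINT x|lborel. w x * lap \<phi> x) + k\<^sup>2 * (LINT x|lborel. w x * \<phi> x)"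
    proof -
      have "(LINT x|lborel. w x * (lap \<phi> x + k\<^sup>2 * \<phi> x)) = (LINT x|lborel. w x * lap \<phi> x + k\<^sup>2 * (w x * \<phi> x))"
        by (intro Bochner_Integration.integral_cong refl) (simp add: algebra_simps)
      then show ?thesis using i\<phi>(1)[OF w] i\<phi>(2)[OF w] by simp
    qed
    ultimately show ?thesis by simp
  qed
  have "(LINT x|lborel. w x * \<psi> x) = 0" if \<psi>: "\<psi> \<in> test_functions UNIV" for \<psi>
  proof -
    have \<psi>s: "schwartz \<psi>" by (rule test_functions_schwartz[OF \<psi>])
    obtain \<phi> where \<phi>: "schwartz \<phi>" "\<And>x. lap \<phi> x + k\<^sup>2 * \<phi> x = - \<psi> x"
      using schwartz_resolvent_solution[OF k d \<psi>s] by metis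
    define \<eta> where "\<eta> = box_bump 1 (- One) (One :: 'a)"
    have \<eta>: "\<eta> \<in> test_functions UNIV" unfolding \<eta>_def by (rule box_bump_test_function) simp
    have \<eta>s: "schwartz \<eta>" by (rule test_functions_schwartz[OF \<eta>])
    \<comment> \<open>The cutoff is not normalised to 1 at the origin; its nonzero value is divided
      out at the end.\<close>
    have \<eta>0: "\<eta> 0 \<noteq> 0" by (simp add: \<eta>_def box_bump_def bump_def)
    define r where "r n = 1 / real (Suc n)" for n
    have r: "0 < r n" "r n \<le> 1" for n by (simp_all add: r_def)
    have r0: "r \<longlonglongrightarrow> 0" using LIMSEQ_inverse_real_of_nat unfolding r_def inverse_eq_divide .
    have cut: "(\<lambda>x. \<eta> (r n *\<^sub>R x) * \<phi> x) \<in> test_functions UNIV" for n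
    proof -
      \<comment> \<open>Rescaling the argument gives a bump on a larger box with slope parameter r,
        hence again a test function.\<close>
      have "(\<lambda>x. \<eta> (r n *\<^sub>R x)) = box_bump (r n) (- ((1 / r n) *\<^sub>R One)) ((1 / r n) *\<^sub>R One)"
        using r[of n] by (simp add: \<eta>_def box_bump_def fun_eq_iff inner_diff_left algebra_simps)
      then have "(\<lambda>x. \<eta> (r n *\<^sub>R x)) \<in> test_functions UNIV" using box_bump_test_function[OF r(1)] by simp
      from test_functions_mult_left[OF schwartz_smooth[OF \<phi>(1)] this] show ?thesis by (simp add: mult.commute)
    qed
    define S where "S n x = - (\<eta> (r n *\<^sub>R x) * \<psi> x) + 2 * of_real (r n) * (\<Sum>b\<in>Basis. pd b \<eta> (r n *\<^sub>R x) * pd b \<phi> x)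
        + (of_real (r n))\<^sup>2 * (lap \<eta> (r n *\<^sub>R x) * \<phi> x)" for n x
    have S: "lap (\<lambda>x. \<eta> (r n *\<^sub>R x) * \<phi> x) x + k\<^sup>2 * (\<eta> (r n *\<^sub>R x) * \<phi> x) = S n x" for n x
    proof -
      have "\<eta> (r n *\<^sub>R x) * lap \<phi> x + k\<^sup>2 * (\<eta> (r n *\<^sub>R x) * \<phi> x) = \<eta> (r n *\<^sub>R x) * (lap \<phi> x + k\<^sup>2 * \<phi> x)"
        by (simp add: algebra_simps)
      then show ?thesis
        unfolding lap_cutoff[OF schwartz_smooth[OF \<eta>s] schwartz_smooth[OF \<phi>(1)]] S_def using \<phi>(2)[of x] by simp
    qed
    obtain A where A: "\<And>x. norm (\<eta> x) \<le> A" using rapid_bounded[OF schwartz_rapid[OF \<eta>s]] by metis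
    obtain B where B: "\<And>x. norm (lap \<eta> x) \<le> B" using rapid_bounded[OF schwartz_rapid[OF schwartz_lap[OF \<eta>s]]] by metis
    have "\<forall>b\<in>Basis. \<exists>C. \<forall>x. norm (pd b \<eta> x) \<le> C"
      using rapid_bounded[OF schwartz_rapid[OF schwartz_pd[OF \<eta>s]]] by metis
    then obtain C where C: "\<And>b x. b \<in> Basis \<Longrightarrow> norm (pd b \<eta> x) \<le> C b" by metis
    \<comment> \<open>A majorant independent of n, from r <= 1 and the global bounds on the cutoff
      and its derivatives; it is integrable as a combination of products of square integrable
      functions.\<close>
    define M where "M x = A * norm (w x * \<psi> x) + 2 * (\<Sum>b\<in>Basis. C b * norm (w x * pd b \<phi> x)) + B * norm (w x * \<phi> x)" for x
    have iw: "integrable lborel (\<lambda>x. norm (w x * f x))" if "schwartz f" for f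
      by (intro integrable_norm integrable_L2_mult w schwartz_L2 that)
    have "(\<lambda>n. LINT x|lborel. w x * S n x) \<longlonglongrightarrow> (LINT x|lborel. w x * (- (\<eta> 0 * \<psi> x)))"
    proof (rule integral_dominated_convergence[where w = M])
      show "integrable lborel M"
        unfolding M_def
        by (intro Bochner_Integration.integrable_add integrable_mult_right Bochner_Integration.integrable_sum iw \<psi>s \<phi>(1) schwartz_pd)
      have "schwartz (\<lambda>x. \<eta> 0 * \<psi> x)" by (rule schwartz_cmult[OF \<psi>s])
      from borel_measurable_integrable[OF integrable_L2_mult[OF w schwartz_L2[OF this]]]
      show "(\<lambda>x. w x * (- (\<eta> 0 * \<psi> x))) \<in> borel_measurable lborel" by simp
      show "(\<lambda>x. w x * S n x) \<in> borel_measurable lborel" for n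
      proof -
        have cs: "schwartz (\<lambda>x. \<eta> (r n *\<^sub>R x) * \<phi> x)" by (rule test_functions_schwartz[OF cut])
        have "schwartz (\<lambda>x. lap (\<lambda>x. \<eta> (r n *\<^sub>R x) * \<phi> x) x + k\<^sup>2 * (\<eta> (r n *\<^sub>R x) * \<phi> x))"
          by (intro schwartz_add schwartz_cmult schwartz_lap cs)
        then have "schwartz (S n)" unfolding S .
        from borel_measurable_integrable[OF integrable_L2_mult[OF w schwartz_L2[OF this]]] show ?thesis .
      qed
      show "AE x in lborel. (\<lambda>n. w x * S n x) \<longlonglongrightarrow> w x * (- (\<eta> 0 * \<psi> x))"
      proof (rule AE_I2)
        fix x
        have lim: "(\<lambda>n. f (r n *\<^sub>R x)) \<longlonglongrightarrow> f 0" if "schwartz f" for f :: "'a \<Rightarrow> complex"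
        proof -
          have "isCont f 0" using schwartz_differentiable[OF that] by (rule differentiable_imp_continuous_within)
          moreover have "(\<lambda>n. r n *\<^sub>R x) \<longlonglongrightarrow> 0" using tendsto_scaleR[OF r0 tendsto_const[of x]] by simp
          ultimately show ?thesis by (rule isCont_tendsto_compose)
        qed
        have rc: "(\<lambda>n. complex_of_real (r n)) \<longlonglongrightarrow> of_real 0" by (intro tendsto_of_real r0)
        have "(\<lambda>n. w x * S n x) \<longlonglongrightarrow> w x * (- (\<eta> 0 * \<psi> x) + 2 * of_real 0 * (\<Sum>b\<in>Basis. pd b \<eta> 0 * pd b \<phi> x)
          + (of_real 0)\<^sup>2 * (lap \<eta> 0 * \<phi> x))"
          unfolding S_def by (intro tendsto_intros lim rc \<eta>s schwartz_pd schwartz_lap) auto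
        then show "(\<lambda>n. w x * S n x) \<longlonglongrightarrow> w x * (- (\<eta> 0 * \<psi> x))" by simp
      qed
      show "AE x in lborel. norm (w x * S n x) \<le> M x" for n
      proof (rule AE_I2)
        fix x
        have 1: "norm (w x * - (\<eta> (r n *\<^sub>R x) * \<psi> x)) \<le> A * norm (w x * \<psi> x)"
          using mult_right_mono[OF A[of "r n *\<^sub>R x"], of "norm (w x * \<psi> x)"] by (simp add: norm_mult mult_ac)
        have 2: "norm (w x * (2 * of_real (r n) * (\<Sum>b\<in>Basis. pd b \<eta> (r n *\<^sub>R x) * pd b \<phi> x))) \<le> 2 * (\<Sum>b\<in>Basis. C b * norm (w x * pd b \<phi> x))"
        proof -
          let ?s = "\<Sum>b\<in>Basis. w x * (pd b \<eta> (r n *\<^sub>R x) * pd b \<phi> x)"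
          have "norm (w x * (2 * of_real (r n) * (\<Sum>b\<in>Basis. pd b \<eta> (r n *\<^sub>R x) * pd b \<phi> x))) = 2 * (r n * norm ?s)"
            unfolding sum_distrib_left[symmetric] using r(1)[of n] by (simp add: norm_mult)
          also have "\<dots> \<le> 2 * norm ?s" using mult_right_mono[OF r(2)[of n] norm_ge_zero[of ?s]] by simp
          also have "norm ?s \<le> (\<Sum>b\<in>Basis. C b * norm (w x * pd b \<phi> x))"
          proof (rule sum_norm_le)
            fix b :: 'a assume "b \<in> Basis"
            from mult_right_mono[OF C[OF this, of "r n *\<^sub>R x"], of "norm (w x * pd b \<phi> x)"]
            show "norm (w x * (pd b \<eta> (r n *\<^sub>R x) * pd b \<phi> x)) \<le> C b * norm (w x * pd b \<phi> x)" by (simp add: norm_mult mult_ac)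
          qed
          finally show ?thesis by simp
        qed
        have 3: "norm (w x * ((of_real (r n))\<^sup>2 * (lap \<eta> (r n *\<^sub>R x) * \<phi> x))) \<le> B * norm (w x * \<phi> x)"
        proof -
          have "(r n)\<^sup>2 \<le> 1" using r[of n] by (simp add: power_le_one)
          have "norm (w x * ((of_real (r n))\<^sup>2 * (lap \<eta> (r n *\<^sub>R x) * \<phi> x))) = (r n)\<^sup>2 * (norm (lap \<eta> (r n *\<^sub>R x)) * norm (w x * \<phi> x))"
            using r(1)[of n] by (simp add: norm_mult norm_power mult_ac)
          also have "\<dots> \<le> 1 * (norm (lap \<eta> (r n *\<^sub>R x)) * norm (w x * \<phi> x))"
            using \<open>(r n)\<^sup>2 \<le> 1\<close> by (intro mult_right_mono) auto
          also have "\<dots> \<le> B * norm (w x * \<phi> x)" using mult_right_mono[OF B[of "r n *\<^sub>R x"], of "norm (w x * \<phi> x)"] by simp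
          finally show ?thesis .
        qed
        show "norm (w x * S n x) \<le> M x"
          unfolding S_def M_def distrib_left[of "w x"]
          by (intro norm_triangle_mono 1 2 3)
      qed
    qed
    moreover have "(LINT x|lborel. w x * S n x) = 0" for n
      using weak[OF cut[of n]] unfolding S .
    ultimately have "(LINT x|lborel. w x * (- (\<eta> 0 * \<psi> x))) = 0" by (simp add: LIMSEQ_const_iff)
    also have "(\<lambda>x. w x * (- (\<eta> 0 * \<psi> x))) = (\<lambda>x. - \<eta> 0 * (w x * \<psi> x))" by auto
    finally show ?thesis using \<eta>0 by simp
  qed
  from AE_eq_0_if_test_functions[OF w this] show ?thesis by (simp add: w_def)
qed

section \<open>From the weighted estimate to the operator norm\<close>

lemma exists_square_root_Im_pos:
  assumes "z \<in> - (complex_of_real ` {0..})"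
  obtains k where "k\<^sup>2 = z" "Im k > 0"
proof -
  have "Im (csqrt z) \<noteq> 0"
  proof
    assume "Im (csqrt z) = 0"
    then have "csqrt z = complex_of_real (Re (csqrt z))" by (simp add: complex_eq_iff)
    then have "z = complex_of_real ((Re (csqrt z))\<^sup>2)" by (metis of_real_power power2_csqrt)
    then have "z \<in> complex_of_real ` {0..}" by (rule image_eqI) simp
    then show False using assms by simp
  qed
  then consider "Im (csqrt z) > 0" | "Im (- csqrt z) > 0" by fastforce
  then show ?thesis using that[of "csqrt z"] that[of "- csqrt z"] by cases auto
qed

lemma L2_norm_laplace_resolvent_le:
  fixes f :: "'a::euclidean_space \<Rightarrow> complex"
  assumes z: "z \<in> - (complex_of_real ` {0..})" and d: "DIM('a) \<ge> 3"
    and f: "f \<in> test_functions (- {0})" "L2_norm f \<le> 1"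
  shows "L2_norm (mult_inv_norm (laplace_resolvent z (mult_inv_norm f)))
    \<le> ennreal (if DIM('a) = 3 then 4 else 2 / sqrt ((real DIM('a) - 1) * (real DIM('a) - 3)))"
proof -
  define K where "K = (if DIM('a) = 3 then 1 / 16 else (real DIM('a) - 1) * (real DIM('a) - 3) / 4)"
  have K: "K > 0" using d by (simp add: K_def)
  obtain k where k: "k\<^sup>2 = z" "Im k > 0" using exists_square_root_Im_pos[OF z] by blast
  define g where "g = mult_inv_norm f"
  have g: "schwartz g" unfolding g_def by (rule test_functions_schwartz[OF mult_inv_norm_test_function[OF f(1)]])
  have d2: "DIM('a) \<ge> 2" using d by simp
  obtain u where u: "schwartz u" "\<And>x. lap u x + k\<^sup>2 * u x = - g x"
    using schwartz_resolvent_solution[OF k(2) d2 g] by metis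
  have gu: "g x = - lap u x - k\<^sup>2 * u x" for x using u(2)[of x] by algebra
  define U where "U = laplace_resolvent z g"
  have "\<exists>u. \<exists>v. (u, v) \<in> laplacian_graph \<and> (AE x in lborel. - v x - z * u x = g x)"
    using schwartz_laplacian_graph[OF u(1) d2] gu k(1) by (intro exI[of _ u] exI[of _ "lap u"]) auto
  \<comment> \<open>The representative picked by the choice operator need not be the explicit
    solution; uniqueness identifies the two almost everywhere, which is enough for the norm.\<close>
  from someI_ex[OF this] obtain v where v: "(U, v) \<in> laplacian_graph" "AE x in lborel. - v x - k\<^sup>2 * U x = g x"
    unfolding U_def laplace_resolvent_def k(1) by blast
  have Uu: "AE x in lborel. U x = u x"
    by (rule laplacian_graph_unique[OF k(2) d2 v schwartz_laplacian_graph[OF u(1) d2]]) (use gu in auto)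
  have fL: "f \<in> L2" by (rule schwartz_L2[OF test_functions_schwartz[OF f(1)]])
  \<comment> \<open>Division by the norm has value 0 at the origin, so f has to vanish there for |x|
    g and f to have the same modulus everywhere.\<close>
  have f0: "f 0 = 0" using test_functionsD(3)[OF f(1)] closure_subset[of "{x. f x \<noteq> 0}"] by auto
  have "K * (LINT x|lborel. (cmod (u x))\<^sup>2 / (norm x)\<^sup>2) \<le> (LINT x|lborel. (norm x)\<^sup>2 * (cmod (g x))\<^sup>2)"
    unfolding K_def by (rule weighted_resolvent_estimate(2)[OF u(1) d k(2) gu])
  also have "(\<lambda>x. (norm x)\<^sup>2 * (cmod (g x))\<^sup>2) = (\<lambda>x. (cmod (f x))\<^sup>2)"
  proof
    show "(norm x)\<^sup>2 * (cmod (g x))\<^sup>2 = (cmod (f x))\<^sup>2" for x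
      by (cases "x = 0") (simp_all add: g_def mult_inv_norm_def f0 norm_divide power_mult_distrib power_divide)
  qed
  also have "(LINT x|lborel. (cmod (f x))\<^sup>2) \<le> 1"
    using f(2) fL by (simp add: L2_norm_def ennreal_le_1 flip: ennreal_1)
  finally have le: "(LINT x|lborel. (cmod (u x))\<^sup>2 / (norm x)\<^sup>2) \<le> 1 / K"
    using K by (simp add: field_simps)
  have [measurable]: "U \<in> borel_measurable lborel" using v(1) by (auto simp: laplacian_graph_def sobolev_def L2_def)
  have [measurable]: "u \<in> borel_measurable borel" by (rule borel_measurable_schwartz[OF u(1)])
  have AE: "AE x in lborel. (cmod (mult_inv_norm U x))\<^sup>2 = (cmod (u x))\<^sup>2 / (norm x)\<^sup>2"
    using Uu by eventually_elim (simp add: mult_inv_norm_def norm_mult norm_divide power_mult_distrib power_divide)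
  have m: "mult_inv_norm U \<in> borel_measurable lborel" unfolding mult_inv_norm_def by measurable
  then have m2: "(\<lambda>x. (cmod (mult_inv_norm U x))\<^sup>2) \<in> borel_measurable lborel" by measurable
  have m3: "(\<lambda>x. (cmod (u x))\<^sup>2 / (norm x)\<^sup>2) \<in> borel_measurable lborel" by measurable
  have "integrable lborel (\<lambda>x. (cmod (mult_inv_norm U x))\<^sup>2)"
    using weighted_resolvent_estimate(1)[OF u(1) d k(2) gu] by (subst integrable_cong_AE[OF m2 m3 AE])
  then have "mult_inv_norm U \<in> L2" using m by (simp add: L2_def)
  then have "L2_norm (mult_inv_norm U) = ennreal (sqrt (LINT x|lborel. (cmod (u x))\<^sup>2 / (norm x)\<^sup>2))"
    by (simp add: L2_norm_def integral_cong_AE[OF m2 m3 AE])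
  also have "\<dots> \<le> ennreal (sqrt (1 / K))" using le by (intro ennreal_leI real_sqrt_le_mono)
  also have "sqrt (1 / K) = (if DIM('a) = 3 then 4 else 2 / sqrt ((real DIM('a) - 1) * (real DIM('a) - 3)))"
  proof -
    have "sqrt 16 = (4::real)" "sqrt 4 = (2::real)" by (rule real_sqrt_unique; simp)+
    then show ?thesis by (simp add: K_def real_sqrt_divide real_sqrt_mult)
  qed
  finally show ?thesis unfolding U_def g_def .
qed

theorem theorem1p2:
  assumes "CARD('n::finite) \<ge> 3"
  shows "(SUP z\<in>- (complex_of_real ` {0..}).
            L2_opnorm (test_functions (- {0 :: real ^ 'n}))
              (\<lambda>f. mult_inv_norm (laplace_resolvent z (mult_inv_norm f))))
         \<le> ennreal (if CARD('n) = 3 then 4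
                    else 2 / sqrt ((real CARD('n) - 1) * (real CARD('n) - 3)))"
  unfolding L2_opnorm_def
proof (intro SUP_least)
  have D: "DIM(real ^ 'n) = CARD('n)" by simp
  fix z and f :: "real ^ 'n \<Rightarrow> complex"
  assume "z \<in> - (complex_of_real ` {0..})" "f \<in> {f \<in> test_functions (- {0}). L2_norm f \<le> 1}"
  then show "L2_norm (mult_inv_norm (laplace_resolvent z (mult_inv_norm f)))
      \<le> ennreal (if CARD('n) = 3 then 4 else 2 / sqrt ((real CARD('n) - 1) * (real CARD('n) - 3)))"
    using L2_norm_laplace_resolvent_le[of z f, unfolded D] assms by blast
qed

end
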